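(* Let $G$ be a finite group of order $g$. Then for every integer $p\ge 1$ and every finite dimensional complex representation $V$ of $G$, $$s_p(V)\le p g^3 .$$
   Context: Fix a finite group $G$ of order $g$. For a finite dimensional complex representation $V$ of $G$, let $R=\mathrm{Sym}(V)^G$ be the ring of invariants in the symmetric algebra of $V$, graded by the usual grading in which $V$ has degree $1$. For a homogeneous (graded) vector subspace $E\subset R$, contained in the positive degree part of $R$ and generating $R$ as a $\mathbf{C}$-algebra, put $S=\mathrm{Sym}(E)$, graded so that elements of $E$ keep their degree in $R$; the inclusion $E\subset R$ induces a surjection $S\to R$ of graded algebras, making $R$ a graded $S$-module. Regard $\mathbf{C}$ as the graded $S$-module $S/S_{+}$, where $S_+$ is the ideal generated by $E$. Then $\mathrm{Tor}^S_p(R,\mathbf{C})$ is a graded vector space, and $s_p(V;E)$ denotes the maximal degree in which it is nonzero (with the convention $s_p(V;E)=-\infty$ if it vanishes). The value $s_p(V;E)$ is independent of $E$ if $E$ is chosen to be minimal (i.e. minimal among homogeneous generating subspaces); this common value is denoted $s_p(V)$. *)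

theory Defs
  imports
    Complex_Main
    "HOL-Algebra.Coset"
    "HOL-Library.Poly_Mapping"
    "HOL-Library.Extended_Real"
    "Jordan_Normal_Form.Matrix"
begin

section \<open>Polynomials over the complex numbers\<close>

text \<open>
  A polynomial maps monomials (exponent functions of finite support) to coefficients.
  The symmetric algebra of a complex vector space with basis \<open>X\<close> is \<open>polys X\<close>, the polynomial ring
  whose variables are the elements of \<open>X\<close>. It is graded by giving each basis vector \<open>x\<close> a
  weight \<open>w x\<close>.
\<close>

type_synonym 'x cpoly = "('x \<Rightarrow>\<^sub>0 nat) \<Rightarrow>\<^sub>0 complex"

definition const_poly :: "complex \<Rightarrow> 'x cpoly" where
  "const_poly c = Poly_Mapping.single 0 c"

definition var_poly :: "'x \<Rightarrow> 'x cpoly" where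
  "var_poly x = Poly_Mapping.single (Poly_Mapping.single x 1) 1"

global_interpretation cpoly: vector_space "\<lambda>c (p :: 'x cpoly). const_poly c * p"
  by unfold_locales
    (simp_all add: const_poly_def distrib_left distrib_right single_add mult_single
      mult.assoc[symmetric])

definition polys :: "'x set \<Rightarrow> 'x cpoly set" where
  "polys X = {p. \<forall>m \<in> Poly_Mapping.keys p. Poly_Mapping.keys m \<subseteq> X}"

text \<open>The algebra homomorphism that sends each variable \<open>x\<close> to \<open>f x\<close>.\<close>

definition subst_poly :: "('x \<Rightarrow> 'y cpoly) \<Rightarrow> 'x cpoly \<Rightarrow> 'y cpoly" where
  "subst_poly f p =
     (\<Sum>m \<in> Poly_Mapping.keys p. const_poly (Poly_Mapping.lookup p m) *
        (\<Prod>x \<in> Poly_Mapping.keys m. f x ^ Poly_Mapping.lookup m x))"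

definition mon_weight :: "('x \<Rightarrow> nat) \<Rightarrow> ('x \<Rightarrow>\<^sub>0 nat) \<Rightarrow> nat" where
  "mon_weight w m = (\<Sum>x \<in> Poly_Mapping.keys m. Poly_Mapping.lookup m x * w x)"

text \<open>Degrees are integers, so that free modules may have generators of any degree.\<close>

definition homogeneous :: "('x \<Rightarrow> nat) \<Rightarrow> int \<Rightarrow> 'x cpoly \<Rightarrow> bool" where
  "homogeneous w d p \<longleftrightarrow> (\<forall>m \<in> Poly_Mapping.keys p. int (mon_weight w m) = d)"

definition total_deg :: "'x cpoly \<Rightarrow> nat" where
  "total_deg p = Max (mon_weight (\<lambda>_. 1) ` Poly_Mapping.keys p)"

section \<open>Representations and rings of invariants\<close>

text \<open>
  A representation on \<open>V\<close>, the space of complex column vectors of length \<open>n\<close> (\<open>n = 0\<close> is allowed).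
  Invertibility of \<open>\<rho> x\<close> follows from the conditions.
\<close>

definition representation ::
  "('g, 'm) monoid_scheme \<Rightarrow> nat \<Rightarrow> ('g \<Rightarrow> complex mat) \<Rightarrow> bool" where
  "representation G n \<rho> \<longleftrightarrow>
     (\<forall>x \<in> carrier G. \<rho> x \<in> carrier_mat n n) \<and>
     \<rho> \<one>\<^bsub>G\<^esub> = 1\<^sub>m n \<and>
     (\<forall>x \<in> carrier G. \<forall>y \<in> carrier G. \<rho> (x \<otimes>\<^bsub>G\<^esub> y) = \<rho> x * \<rho> y)"

text \<open>
  The variables \<open>0, \<dots>, n - 1\<close> are the standard basis of \<open>V\<close>; column \<open>j\<close> of the matrix \<open>A\<close> is the
  image of the \<open>j\<close>-th basis vector.
\<close>

definition sym_act :: "nat \<Rightarrow> complex mat \<Rightarrow> nat cpoly \<Rightarrow> nat cpoly" where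
  "sym_act n A = subst_poly (\<lambda>j. \<Sum>i<n. const_poly (A $$ (i, j)) * var_poly i)"

definition invariants ::
  "('g, 'm) monoid_scheme \<Rightarrow> nat \<Rightarrow> ('g \<Rightarrow> complex mat) \<Rightarrow> nat cpoly set" where
  "invariants G n \<rho> = {f \<in> polys {..<n}. \<forall>x \<in> carrier G. sym_act n (\<rho> x) f = f}"

section \<open>Homogeneous generating subspaces\<close>

inductive_set subalgebra_generated :: "'x cpoly set \<Rightarrow> 'x cpoly set" for E where
  base: "f \<in> E \<Longrightarrow> f \<in> subalgebra_generated E"
| const: "const_poly c \<in> subalgebra_generated E"
| add: "f \<in> subalgebra_generated E \<Longrightarrow> h \<in> subalgebra_generated E \<Longrightarrow>
    f + h \<in> subalgebra_generated E"
| mult: "f \<in> subalgebra_generated E \<Longrightarrow> h \<in> subalgebra_generated E \<Longrightarrow>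
    f * h \<in> subalgebra_generated E"

definition homogeneous_subspace :: "'x cpoly set \<Rightarrow> bool" where
  "homogeneous_subspace E \<longleftrightarrow>
     cpoly.subspace E \<and> cpoly.span {f \<in> E. \<exists>d. homogeneous (\<lambda>_. 1) d f} = E"

definition generating_subspace :: "'x cpoly set \<Rightarrow> 'x cpoly set \<Rightarrow> bool" where
  "generating_subspace R E \<longleftrightarrow>
     homogeneous_subspace E \<and>
     E \<subseteq> {f \<in> R. \<forall>m \<in> Poly_Mapping.keys f. mon_weight (\<lambda>_. 1) m > 0} \<and>
     subalgebra_generated E = R"

definition minimal_generating_subspace :: "'x cpoly set \<Rightarrow> 'x cpoly set \<Rightarrow> bool" where
  "minimal_generating_subspace R E \<longleftrightarrow>
     generating_subspace R E \<and> (\<forall>E'. generating_subspace R E' \<and> E' \<subseteq> E \<longrightarrow> E' = E)"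

definition homogeneous_basis :: "'x cpoly set \<Rightarrow> 'x cpoly set \<Rightarrow> bool" where
  "homogeneous_basis E B \<longleftrightarrow>
     B \<subseteq> {f \<in> E. \<exists>d. homogeneous (\<lambda>_. 1) d f} \<and>
     \<not> cpoly.dependent B \<and> cpoly.span B = E"

section \<open>Graded free modules over the symmetric algebra of E\<close>

text \<open>
  Let \<open>B\<close> be a homogeneous basis of a subspace \<open>E\<close> of \<open>R\<close>. The ring \<open>S = Sym(E)\<close> is \<open>polys B\<close>: its
  variables are themselves polynomials, the variable \<open>b\<close> has weight \<open>total_deg b\<close>, and
  \<open>subst_poly (\<lambda>b. b)\<close> is the map from \<open>S\<close> to \<open>R\<close> that extends the inclusion of \<open>E\<close>.

  The free \<open>S\<close>-module on generators indexed by \<open>X\<close> consists of the finitely supported families of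
  elements of \<open>S\<close>. For a ring of invariants \<open>R\<close>, both \<open>R\<close> and \<open>S\<close> have countable dimension, so all
  the modules in a resolution can be countably generated, and natural numbers suffice as indices.
\<close>

type_synonym 'x free_elem = "nat \<Rightarrow>\<^sub>0 'x cpoly"

definition free_mod :: "'x set \<Rightarrow> nat set \<Rightarrow> 'x free_elem set" where
  "free_mod B X =
     {v. Poly_Mapping.keys v \<subseteq> X \<and> (\<forall>i. Poly_Mapping.lookup v i \<in> polys B)}"

definition smult_free :: "'x cpoly \<Rightarrow> 'x free_elem \<Rightarrow> 'x free_elem" where
  "smult_free s v = Poly_Mapping.map (\<lambda>a. s * a) v"

text \<open>Elements of degree \<open>d\<close>, where the generator with index \<open>i\<close> has degree \<open>e i\<close>.\<close>

definition free_deg ::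
  "('x \<Rightarrow> nat) \<Rightarrow> 'x set \<Rightarrow> nat set \<Rightarrow> (nat \<Rightarrow> int) \<Rightarrow> int \<Rightarrow> 'x free_elem set" where
  "free_deg w B X e d =
     {v \<in> free_mod B X.
        \<forall>i \<in> Poly_Mapping.keys v. homogeneous w (d - e i) (Poly_Mapping.lookup v i)}"

text \<open>
  The submodule \<open>S\<^sub>+ F\<close> of \<open>F = free_mod B X\<close>. The ideal \<open>S\<^sub>+\<close> generated by the variables consists
  of the polynomials in \<open>S\<close> without constant term.
\<close>

definition aug_free :: "'x set \<Rightarrow> nat set \<Rightarrow> 'x free_elem set" where
  "aug_free B X =
     {v \<in> free_mod B X. \<forall>i. Poly_Mapping.lookup (Poly_Mapping.lookup v i) 0 = 0}"

section \<open>Graded free resolutions and Tor\<close>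

text \<open>
  A resolution of the graded \<open>S\<close>-module \<open>R\<close>, where
  \<open>F p = free_mod B (X p)\<close>, \<open>\<epsilon>\<close> maps \<open>F 0\<close> onto \<open>R\<close> and \<open>\<delta> p\<close> maps \<open>F (Suc p)\<close> to \<open>F p\<close>.
\<close>

locale graded_free_resolution =
  fixes R :: "'x cpoly set"
    and B :: "'x cpoly set"
    and X :: "nat \<Rightarrow> nat set"
    and e :: "nat \<Rightarrow> nat \<Rightarrow> int"
    and \<epsilon> :: "'x cpoly free_elem \<Rightarrow> 'x cpoly"
    and \<delta> :: "nat \<Rightarrow> 'x cpoly free_elem \<Rightarrow> 'x cpoly free_elem"
  assumes eps_add: "\<And>u v. \<lbrakk>u \<in> free_mod B (X 0); v \<in> free_mod B (X 0)\<rbrakk> \<Longrightarrow>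
      \<epsilon> (u + v) = \<epsilon> u + \<epsilon> v"
    and eps_smult: "\<And>s v. \<lbrakk>s \<in> polys B; v \<in> free_mod B (X 0)\<rbrakk> \<Longrightarrow>
      \<epsilon> (smult_free s v) = subst_poly (\<lambda>b. b) s * \<epsilon> v"
    and eps_deg: "\<And>d v. v \<in> free_deg total_deg B (X 0) (e 0) d \<Longrightarrow>
      homogeneous (\<lambda>_. 1) d (\<epsilon> v)"
    and eps_surj: "\<epsilon> ` free_mod B (X 0) = R"
    and del_add: "\<And>p u v. \<lbrakk>u \<in> free_mod B (X (Suc p)); v \<in> free_mod B (X (Suc p))\<rbrakk> \<Longrightarrow>
      \<delta> p (u + v) = \<delta> p u + \<delta> p v"
    and del_smult: "\<And>p s v. \<lbrakk>s \<in> polys B; v \<in> free_mod B (X (Suc p))\<rbrakk> \<Longrightarrow>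
      \<delta> p (smult_free s v) = smult_free s (\<delta> p v)"
    and del_deg: "\<And>p d v. v \<in> free_deg total_deg B (X (Suc p)) (e (Suc p)) d \<Longrightarrow>
      \<delta> p v \<in> free_deg total_deg B (X p) (e p) d"
    and exact_0: "\<delta> 0 ` free_mod B (X 1) = {v \<in> free_mod B (X 0). \<epsilon> v = 0}"
    and exact_Suc: "\<And>p. \<delta> (Suc p) ` free_mod B (X (Suc (Suc p))) =
      {v \<in> free_mod B (X (Suc p)). \<delta> p v = 0}"

text \<open>
  The complex obtained by tensoring a resolution with \<open>S/S\<^sub>+\<close> has the terms \<open>F p / S\<^sub>+ F p\<close>.
  The next two sets are the preimages in \<open>F p\<close> of its \<open>p\<close>-cycles and \<open>p\<close>-boundaries of degree \<open>d\<close>;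
  the degree \<open>d\<close> part of \<open>Tor\<^sub>p(R, \<complex>)\<close> is their quotient.
\<close>

definition tor_cycles where
  "tor_cycles B X e \<delta> p d =
     {z \<in> free_deg total_deg B (X p) (e p) d.
        case p of 0 \<Rightarrow> True | Suc q \<Rightarrow> \<delta> q z \<in> aug_free B (X q)}"

definition tor_boundaries where
  "tor_boundaries B X e \<delta> p d =
     {z \<in> free_deg total_deg B (X p) (e p) d.
        \<exists>y \<in> free_mod B (X (Suc p)). z - \<delta> p y \<in> aug_free B (X p)}"

text \<open>
  Up to isomorphism the graded vector space \<open>Tor\<^sub>p(R, \<complex>)\<close> does not depend on the basis \<open>B\<close> of \<open>E\<close>
  or on the resolution, so the existential quantifiers are only a choice of these data.
\<close>

definition tor_nonzero :: "'x cpoly set \<Rightarrow> 'x cpoly set \<Rightarrow> nat \<Rightarrow> int \<Rightarrow> bool" where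
  "tor_nonzero R E p d \<longleftrightarrow>
     (\<exists>B X e \<epsilon> \<delta>. homogeneous_basis E B \<and> graded_free_resolution R B X e \<epsilon> \<delta> \<and>
        tor_boundaries B X e \<delta> p d \<noteq> tor_cycles B X e \<delta> p d)"

section \<open>Degrees of syzygies\<close>

text \<open>
  In \<^typ>\<open>ereal\<close> the supremum of the empty set is \<open>-\<infinity>\<close>, and a supremum of
  integers that is neither \<open>\<infinity>\<close> nor \<open>-\<infinity>\<close> is a maximum.
\<close>

definition syz_degree_wrt :: "'x cpoly set \<Rightarrow> nat \<Rightarrow> 'x cpoly set \<Rightarrow> ereal" where
  "syz_degree_wrt R p E = (SUP d \<in> {d. tor_nonzero R E p d}. ereal (of_int d))"

text \<open>
  All minimal \<open>E\<close> give the same value of \<^const>\<open>syz_degree_wrt\<close>, and minimal \<open>E\<close> exist; the supremum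
  below is this common value.
\<close>

definition syz_degree ::
  "('g, 'm) monoid_scheme \<Rightarrow> nat \<Rightarrow> ('g \<Rightarrow> complex mat) \<Rightarrow> nat \<Rightarrow> ereal" where
  "syz_degree G n \<rho> p =
     (SUP E \<in> {E. minimal_generating_subspace (invariants G n \<rho>) E}.
        syz_degree_wrt (invariants G n \<rho>) p E)"

end

theory Submission
  imports Defs "HOL-Library.Function_Algebras"
begin

text \<open>
  Let \<open>T = Sym(V)\<close>, let \<open>\<mm>\<close> be its maximal homogeneous ideal, and let \<open>K = T \<otimes> \<Lambda>(E)\<close> be the Koszul
  complex in which \<open>E \<subseteq> T\<close> acts by multiplication. By the Reynolds operator, \<open>Tor\<^sub>p(R, \<complex>)\<close> is a direct
  summand of \<open>H\<^sub>p(K)\<close>. Let \<open>t\<^sub>p\<close> be the top degree of \<open>H\<^sub>p(K)\<close>. This homology is annihilated by \<open>E\<close>, hence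
  by \<open>\<mm>\<^sup>g\<close> (Benson), so \<open>t\<^sub>p\<close> exceeds the degree of any \<open>T\<close>-module generator of \<open>H\<^sub>p(K)\<close> by at most
  \<open>g - 1\<close>. The spectral sequence from \<open>Tor\<^sup>T\<^sub>i(H\<^sub>j(K), \<complex>)\<close> to \<open>\<Lambda>\<^sup>i\<^sup>+\<^sup>j(E)\<close> shows that the generators have
  degree at most \<open>max(p g, t\<^sub>p\<^sub>+\<^sub>1\<^sub>-\<^sub>r + r)\<close>, where \<open>2 \<le> r \<le> p + 1\<close>: the group \<open>Tor\<^sup>T\<^sub>r(H\<^sub>j(K), \<complex>)\<close> is computed by
  the Koszul complex of the variables and lives in degrees at most \<open>t\<^sub>j + r\<close>, and \<open>E\<close> lives in degrees
  at most \<open>g\<close> (Noether). By induction \<open>t\<^sub>p \<le> (p + 1)(g + 1) - 2\<close>, which is at most \<open>p g\<^sup>3\<close> when \<open>g \<ge> 2\<close> and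
  \<open>p \<ge> 1\<close>. For \<open>g = 1\<close> the complex \<open>K\<close> is exact in positive degrees.
\<close>

section \<open>Koszul complexes of commuting operators\<close>

text \<open>The obstacle is that Tor is given by an arbitrary free resolution of \<open>R\<close>,
  whereas the degree estimate lives on a Koszul complex, which resolves \<complex>. So the balancing
  of Tor has to be proved as well, and like the spectral sequence for \<open>K\<close> it only
  concerns a few entries of a double complex. Both become instances of one staircase argument on
  elements, \<open>double_complex_chase\<close>; no homology module is formed, and
  \<open>acyclic_at i d\<close> expresses that H_i(K) vanishes in degree d. Both double complexes
  have Koszul rows over a polynomial ring. In characteristic 0 such a row is contracted, outside one
  exceptional degree, by the weighted exterior derivative divided by the total degree. This is why
  chains carry a degree. The direct summand comes from a retraction of \<open>T\<close> onto
  \<open>R\<close> that is linear over the invariants. Only one consequence is used: a Koszul cycle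
  over \<open>R\<close> that bounds over \<open>T\<close> also bounds over \<open>R\<close>.\<close>

definition subgrp :: "'m::ab_group_add set \<Rightarrow> bool" where
  "subgrp M \<longleftrightarrow> 0 \<in> M \<and> (\<forall>x\<in>M. \<forall>y\<in>M. x - y \<in> M)"

lemma subgrp_zero: "subgrp M \<Longrightarrow> 0 \<in> M"
  by (simp add: subgrp_def)

lemma subgrp_diff: "subgrp M \<Longrightarrow> x \<in> M \<Longrightarrow> y \<in> M \<Longrightarrow> x - y \<in> M"
  by (simp add: subgrp_def)

lemma subgrp_uminus: "subgrp M \<Longrightarrow> x \<in> M \<Longrightarrow> - x \<in> M"
  using subgrp_diff[of M 0 x] subgrp_zero[of M] by simp

lemma subgrp_add: "subgrp M \<Longrightarrow> x \<in> M \<Longrightarrow> y \<in> M \<Longrightarrow> x + y \<in> M"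
  using subgrp_diff[of M x "- y"] subgrp_uminus[of M y] by simp

lemma subgrp_sum: "subgrp M \<Longrightarrow> (\<And>i. i \<in> I \<Longrightarrow> f i \<in> M) \<Longrightarrow> (\<Sum>i\<in>I. f i) \<in> M"
  by (induction I rule: infinite_finite_induct) (auto intro: subgrp_zero subgrp_add)

text \<open>Adjacent transpositions generate the symmetric group, so this is the full sign rule. A
  repetition of adjacent entries gives \<open>v = - v\<close>, hence 0 in a complex vector
  space.\<close>

definition alternating :: "('i list \<Rightarrow> 'm::ab_group_add) \<Rightarrow> bool" where
  "alternating c \<longleftrightarrow> (\<forall>us x y vs. c (us @ x # y # vs) = - c (us @ y # x # vs))"

text \<open>
  An element of \<open>M \<otimes> \<Lambda>\<^sup>j(E)\<close>, where \<open>E\<close> has basis \<open>B\<close>, is encoded by its coefficients: an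
  alternating function on \<open>B\<^sup>j\<close>, extended by \<open>0\<close> to all lists. The module of values may depend on
  the list, to account for the degrees of the elements of \<open>B\<close>.
\<close>

definition alt_chains ::
  "'i set \<Rightarrow> ('i list \<Rightarrow> 'm::ab_group_add set) \<Rightarrow> nat \<Rightarrow> ('i list \<Rightarrow> 'm) set" where
  "alt_chains B M j = {c. alternating c \<and> (\<forall>xs. c xs \<in> M xs) \<and>
     (\<forall>xs. c xs \<noteq> 0 \<longrightarrow> length xs = j \<and> set xs \<subseteq> B)}"

text \<open>The Koszul differential in coefficients. Putting the removed factor in front absorbs all
  signs.\<close>

definition kos ::
  "'i set \<Rightarrow> ('i \<Rightarrow> 'm \<Rightarrow> 'm::ab_group_add) \<Rightarrow> ('i list \<Rightarrow> 'm) \<Rightarrow> 'i list \<Rightarrow> 'm" where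
  "kos B a c xs = (\<Sum>b\<in>B. a b (c (b # xs)))"

text \<open>
  The sum of \<open>\<plusminus> F x\<^sub>i [x\<^sub>0, \<dots>, x\<^sub>i\<^sub>-\<^sub>1, x\<^sub>i\<^sub>+\<^sub>1, \<dots>]\<close> with alternating signs. All
  homotopies of Koszul complexes below are of this form.
\<close>

fun alt_sum :: "('i \<Rightarrow> 'i list \<Rightarrow> 'm::ab_group_add) \<Rightarrow> 'i list \<Rightarrow> 'm" where
  "alt_sum F [] = 0"
| "alt_sum F (x # xs) = F x xs - alt_sum (\<lambda>y ys. F y (x # ys)) xs"

section \<open>Alternating chains\<close>

lemma alternatingD: "alternating c \<Longrightarrow> c (us @ x # y # vs) = - c (us @ y # x # vs)"
  unfolding alternating_def by blast

lemma alternating_swap: "alternating c \<Longrightarrow> c (x # y # vs) = - c (y # x # vs)"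
  using alternatingD[of c "[]" x y vs] by simp

lemma alternating_Cons: "alternating c \<Longrightarrow> alternating (\<lambda>ys. c (x # ys))"
  unfolding alternating_def by (metis append_Cons)

lemma alternating_diff:
  assumes "alternating c" "alternating c'"
  shows "alternating (c - c')"
  unfolding alternating_def
proof (intro allI)
  fix us x y vs
  show "(c - c') (us @ x # y # vs) = - (c - c') (us @ y # x # vs)"
    using alternatingD[OF assms(1), of us x y vs] alternatingD[OF assms(2), of us x y vs] by simp
qed

lemma alternating_comp:
  assumes "alternating c" "\<And>v. v \<in> range c \<Longrightarrow> \<phi> (- v) = - \<phi> v"
  shows "alternating (\<lambda>xs. \<phi> (c xs))"
  unfolding alternating_def
proof (intro allI)
  fix us x y vs
  show "\<phi> (c (us @ x # y # vs)) = - \<phi> (c (us @ y # x # vs))"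
    using alternatingD[OF assms(1), of us x y vs] assms(2) by simp
qed

lemma alternating_sum:
  assumes "\<And>i. i \<in> I \<Longrightarrow> alternating (c i)"
  shows "alternating (\<lambda>xs. \<Sum>i\<in>I. c i xs)"
  unfolding alternating_def
proof (intro allI)
  fix us x y vs
  have "(\<Sum>i\<in>I. c i (us @ x # y # vs)) = (\<Sum>i\<in>I. - c i (us @ y # x # vs))"
    by (intro sum.cong refl alternatingD assms)
  then show "(\<Sum>i\<in>I. c i (us @ x # y # vs)) = - (\<Sum>i\<in>I. c i (us @ y # x # vs))"
    by (simp add: sum_negf)
qed

lemma alt_chainsD:
  assumes "c \<in> alt_chains B M j"
  shows "alternating c" "c xs \<in> M xs" "c xs \<noteq> 0 \<Longrightarrow> length xs = j" "c xs \<noteq> 0 \<Longrightarrow> set xs \<subseteq> B"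
  using assms by (auto simp: alt_chains_def)

lemma alt_chainsI:
  assumes "alternating c" "\<And>xs. c xs \<in> M xs"
    "\<And>xs. c xs \<noteq> 0 \<Longrightarrow> length xs = j \<and> set xs \<subseteq> B"
  shows "c \<in> alt_chains B M j"
  using assms by (auto simp: alt_chains_def)

lemma subgrp_alt_chains:
  assumes "\<And>xs. subgrp (M xs)"
  shows "subgrp (alt_chains B M j)"
  unfolding subgrp_def
proof (intro conjI ballI)
  show "0 \<in> alt_chains B M j"
    by (rule alt_chainsI) (auto simp: alternating_def subgrp_zero assms)
next
  fix c c' assume c: "c \<in> alt_chains B M j" and c': "c' \<in> alt_chains B M j"
  show "c - c' \<in> alt_chains B M j"
  proof (rule alt_chainsI)
    show "alternating (c - c')"
      by (rule alternating_diff) (use c c' alt_chainsD(1) in auto)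
    show "(c - c') xs \<in> M xs" for xs
      using alt_chainsD(2)[OF c] alt_chainsD(2)[OF c'] assms by (auto intro: subgrp_diff)
    show "length xs = j \<and> set xs \<subseteq> B" if "(c - c') xs \<noteq> 0" for xs
    proof -
      have "c xs \<noteq> 0 \<or> c' xs \<noteq> 0" using that by auto
      then show ?thesis using alt_chainsD(3,4)[OF c, of xs] alt_chainsD(3,4)[OF c', of xs] by auto
    qed
  qed
qed

lemma alt_chains_comp:
  assumes "c \<in> alt_chains B M j" "\<And>xs v. v \<in> M xs \<Longrightarrow> \<phi> v \<in> M' xs"
    "\<And>xs v. v \<in> M xs \<Longrightarrow> \<phi> (- v) = - \<phi> v" "\<phi> 0 = 0"
  shows "(\<lambda>xs. \<phi> (c xs)) \<in> alt_chains B M' j"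
proof (rule alt_chainsI)
  show "alternating (\<lambda>xs. \<phi> (c xs))"
    by (rule alternating_comp[OF alt_chainsD(1)[OF assms(1)]])
       (use alt_chainsD(2)[OF assms(1)] assms(3) in blast)
  show "\<phi> (c xs) \<in> M' xs" for xs by (intro assms(2) alt_chainsD(2)[OF assms(1)])
  show "length xs = j \<and> set xs \<subseteq> B" if "\<phi> (c xs) \<noteq> 0" for xs
    using that alt_chainsD(3,4)[OF assms(1), of xs] assms(4) by metis
qed

lemma kos_alt_chains:
  assumes c: "c \<in> alt_chains B M (Suc j)"
    and a: "\<And>b xs v. b \<in> B \<Longrightarrow> v \<in> M (b # xs) \<Longrightarrow> a b v \<in> M' xs"
    and a_neg: "\<And>b v. a b (- v) = - a b v" and a0: "\<And>b. a b 0 = 0"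
    and M': "\<And>xs. subgrp (M' xs)"
  shows "kos B a c \<in> alt_chains B M' j"
proof (rule alt_chainsI)
  show "alternating (kos B a c)"
    unfolding kos_def[abs_def]
    by (rule alternating_sum, rule alternating_comp[OF alternating_Cons[OF alt_chainsD(1)[OF c]]])
       (rule a_neg)
  show "kos B a c xs \<in> M' xs" for xs
    unfolding kos_def by (intro subgrp_sum M' a alt_chainsD(2)[OF c])
  show "length xs = j \<and> set xs \<subseteq> B" if "kos B a c xs \<noteq> 0" for xs
  proof -
    obtain b where "b \<in> B" "a b (c (b # xs)) \<noteq> 0"
      using \<open>kos B a c xs \<noteq> 0\<close> unfolding kos_def by (meson sum.neutral)
    then have "c (b # xs) \<noteq> 0" using a0 by metis
    then show ?thesis using alt_chainsD(3,4)[OF c, of "b # xs"] by auto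
  qed
qed

section \<open>Alternating sums\<close>

lemma alt_sum_cong:
  "(\<And>x ys. F x ys = G x ys) \<Longrightarrow> alt_sum F xs = alt_sum G xs"
  by (rule arg_cong[where f = "\<lambda>F. alt_sum F xs"]) (intro ext)

lemma alt_sum_diff:
  "alt_sum (\<lambda>x ys. F x ys - G x ys) xs = alt_sum F xs - alt_sum G xs"
proof (induction xs arbitrary: F G)
  case (Cons x xs)
  show ?case
    by (simp only: alt_sum.simps Cons.IH[of "\<lambda>y ys. F y (x # ys)" "\<lambda>y ys. G y (x # ys)"]) simp
qed simp

lemma alt_sum_zero: "alt_sum (\<lambda>x ys. 0) xs = 0"
  by (induction xs) simp_all

lemma alt_sum_uminus: "alt_sum (\<lambda>x ys. - F x ys) xs = - alt_sum F xs"
  using alt_sum_diff[of "\<lambda>x ys. 0" F xs] by (simp add: alt_sum_zero)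

lemma alt_sum_add:
  "alt_sum (\<lambda>x ys. F x ys + G x ys) xs = alt_sum F xs + alt_sum G xs"
  using alt_sum_diff[of F "\<lambda>x ys. - G x ys" xs] by (simp add: alt_sum_uminus)

lemma alt_sum_sum:
  "alt_sum (\<lambda>x ys. \<Sum>i\<in>I. F i x ys) xs = (\<Sum>i\<in>I. alt_sum (F i) xs)"
  by (induction I rule: infinite_finite_induct) (simp_all add: alt_sum_zero alt_sum_add)

lemma alt_sum_mem:
  assumes M: "subgrp M" and F: "\<And>x ys. F x ys \<in> M"
  shows "alt_sum F xs \<in> M"
  using F
proof (induction xs arbitrary: F)
  case (Cons x xs)
  show ?case
    unfolding alt_sum.simps by (rule subgrp_diff[OF M Cons.prems Cons.IH[OF Cons.prems]])
qed (simp add: subgrp_zero[OF M])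

lemma alt_sum_hom:
  assumes M: "subgrp M" and F: "\<And>x ys. F x ys \<in> M"
    and \<phi>: "\<And>u v. u \<in> M \<Longrightarrow> v \<in> M \<Longrightarrow> \<phi> (u - v) = \<phi> u - \<phi> v"
  shows "\<phi> (alt_sum F xs) = alt_sum (\<lambda>x ys. \<phi> (F x ys)) xs"
  using F
proof (induction xs arbitrary: F)
  case Nil
  show ?case using \<phi>[of 0 0] subgrp_zero[OF M] by simp
next
  case (Cons x xs)
  have "alt_sum (\<lambda>y ys. F y (x # ys)) xs \<in> M"
    by (rule alt_sum_mem[OF M Cons.prems])
  then show ?case
    by (simp add: \<phi>[OF Cons.prems] Cons.IH[OF Cons.prems])
qed

lemma alternating_alt_sum:
  assumes "\<And>x. alternating (F x)"
  shows "alternating (alt_sum F)"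
proof -
  have "alt_sum F (us @ x # y # vs) = - alt_sum F (us @ y # x # vs)" for us x y vs
    using assms
  proof (induction us arbitrary: F)
    case Nil
    \<comment> \<open>The terms that extract \<open>x\<close> and \<open>y\<close> trade places with
      opposite signs under the swap, so only the terms extracting a later entry need the sign rule
      for \<open>F\<close>.\<close>
    have "alt_sum (\<lambda>z zs. F z (x # y # zs)) vs = - alt_sum (\<lambda>z zs. F z (y # x # zs)) vs"
      unfolding alt_sum_uminus[symmetric]
      by (rule alt_sum_cong, rule alternating_swap, rule Nil)
    then show ?case by (simp add: algebra_simps)
  next
    case (Cons u us)
    have "F u (us @ x # y # vs) = - F u (us @ y # x # vs)"
      by (rule alternatingD, rule Cons.prems)
    moreover have "alt_sum (\<lambda>z zs. F z (u # zs)) (us @ x # y # vs) =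
        - alt_sum (\<lambda>z zs. F z (u # zs)) (us @ y # x # vs)"
      by (rule Cons.IH, rule alternating_Cons, rule Cons.prems)
    ultimately show ?case unfolding append_Cons alt_sum.simps by simp
  qed
  then show ?thesis unfolding alternating_def by blast
qed

lemma alt_sum_supp:
  assumes "\<And>x ys. F x ys \<noteq> 0 \<Longrightarrow> length ys = j \<and> x \<in> B \<and> set ys \<subseteq> B" "alt_sum F xs \<noteq> 0"
  shows "length xs = Suc j \<and> set xs \<subseteq> B"
  using assms
proof (induction xs arbitrary: F j)
  case (Cons x xs)
  show ?case
  proof (cases "F x xs = 0")
    case True
    then have nz: "alt_sum (\<lambda>y ys. F y (x # ys)) xs \<noteq> 0" using Cons.prems(2) by simp
    have "\<exists>y ys. F y (x # ys) \<noteq> 0"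
    proof (rule ccontr)
      assume "\<nexists>y ys. F y (x # ys) \<noteq> 0"
      then have "F y (x # ys) = 0" for y ys by blast
      then show False using nz by (simp add: alt_sum_zero)
    qed
    then obtain y ys where *: "F y (x # ys) \<noteq> 0" by blast
    then obtain j' where j': "j = Suc j'" using Cons.prems(1)[OF *] by auto
    have "length xs = Suc j' \<and> set xs \<subseteq> B"
    proof (rule Cons.IH[OF _ nz])
      show "length zs = j' \<and> z \<in> B \<and> set zs \<subseteq> B" if "F z (x # zs) \<noteq> 0" for z zs
        using Cons.prems(1)[OF that] j' by simp
    qed
    then show ?thesis using * Cons.prems(1)[OF *] j' by auto
  qed (use Cons.prems(1)[of x xs] in simp)
qed simp

lemma alt_sum_graded_mem:
  assumes "\<And>xs. subgrp (M xs)" "\<And>x us vs. F x (us @ vs) \<in> M (us @ x # vs)"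
  shows "alt_sum F xs \<in> M xs"
proof -
  \<comment> \<open>The family \<open>M\<close> has to vary in the induction: the tail is treated
    with \<open>M\<close> shifted by the leading entry.\<close>
  have "alt_sum F xs \<in> M xs"
    if "\<And>x us vs. F x (us @ vs) \<in> M (us @ x # vs)" "\<And>xs. subgrp (M xs)" for M
    using that
  proof (induction xs arbitrary: F M)
    case (Cons x xs)
    have "F x xs \<in> M (x # xs)" using Cons.prems(1)[of x "[]" xs] by simp
    moreover have "alt_sum (\<lambda>y ys. F y (x # ys)) xs \<in> M (x # xs)"
    proof (rule Cons.IH[where M = "\<lambda>ys. M (x # ys)"])
      show "F y (x # us @ vs) \<in> M (x # us @ y # vs)" for y us vs
        using Cons.prems(1)[of y "x # us" vs] by simp
    qed (use Cons.prems(2) in simp)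
    ultimately show ?case by (auto intro: subgrp_diff Cons.prems(2))
  qed (simp add: subgrp_zero)
  then show ?thesis using assms by blast
qed

lemma alt_sum_alt_chains:
  assumes "\<And>xs. subgrp (M xs)" "\<And>x us vs. F x (us @ vs) \<in> M (us @ x # vs)"
    "\<And>x. alternating (F x)"
    "\<And>x ys. F x ys \<noteq> 0 \<Longrightarrow> length ys = j \<and> x \<in> B \<and> set ys \<subseteq> B"
  shows "alt_sum F \<in> alt_chains B M (Suc j)"
proof (rule alt_chainsI)
  show "alternating (alt_sum F)" by (rule alternating_alt_sum) (rule assms)
  show "alt_sum F xs \<in> M xs" for xs by (rule alt_sum_graded_mem) (rule assms)+
  show "length xs = Suc j \<and> set xs \<subseteq> B" if "alt_sum F xs \<noteq> 0" for xs
    using alt_sum_supp[of F j B xs] assms(4) that by blast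
qed

text \<open>The operators act on a whole ambient space; graded pieces enter only as sets of allowed
  values. The instances are \<open>T\<close> with the elements of \<open>B\<close>, functions into
  \<open>T\<close> with the variables of \<open>T\<close>, and free modules with the variables of
  \<open>S\<close>.\<close>

locale koszul = vector_space scale
  for scale :: "complex \<Rightarrow> 'm::ab_group_add \<Rightarrow> 'm" +
  fixes B :: "'i set" and a :: "'i \<Rightarrow> 'm \<Rightarrow> 'm"
  assumes a_diff: "\<And>b u v. a b (u - v) = a b u - a b v"
    and a_scale: "\<And>b r v. a b (scale r v) = scale r (a b v)"
    and a_comm: "\<And>b b' v. a b (a b' v) = a b' (a b v)"
begin

lemma a_zero [simp]: "a b 0 = 0"
  using a_diff[of b 0 0] by simp

lemma a_uminus: "a b (- v) = - a b v"
  using a_diff[of b 0 v] by simp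

lemma a_add: "a b (u + v) = a b u + a b v"
  using a_diff[of b u "- v"] by (simp add: a_uminus)

lemma a_sum: "a b (\<Sum>i\<in>I. f i) = (\<Sum>i\<in>I. a b (f i))"
  by (induction I rule: infinite_finite_induct) (auto simp: a_add)

lemma double_eq_zero:
  assumes "v = - v"
  shows "v = (0 :: 'm)"
proof -
  have "scale 2 v = scale 1 v + scale 1 v"
    unfolding scale_left_distrib[symmetric] by simp
  also have "\<dots> = v + v" by simp
  also have "\<dots> = 0" by (metis assms add.right_inverse)
  finally show ?thesis by simp
qed

text \<open>The operators commute and \<open>c\<close> changes sign when \<open>b\<close> and
  \<open>b'\<close> are exchanged, so the double sum equals its own negative.\<close>

lemma kos_kos:
  assumes "alternating c"
  shows "kos B a (kos B a c) = 0"
proof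
  fix xs
  let ?S = "\<Sum>b\<in>B. \<Sum>b'\<in>B. a b (a b' (c (b' # b # xs)))"
  have "?S = (\<Sum>b\<in>B. \<Sum>b'\<in>B. - a b (a b' (c (b # b' # xs))))"
    by (intro sum.cong refl, subst alternating_swap[OF assms]) (simp add: a_uminus)
  also have "\<dots> = - (\<Sum>b\<in>B. \<Sum>b'\<in>B. a b' (a b (c (b # b' # xs))))"
    by (simp add: sum_negf a_comm)
  also have "(\<Sum>b\<in>B. \<Sum>b'\<in>B. a b' (a b (c (b # b' # xs)))) = ?S"
    by (rule sum.swap)
  finally have "?S = 0" by (rule double_eq_zero)
  then show "kos B a (kos B a c) xs = 0 xs"
    by (simp add: kos_def a_sum)
qed

lemma kos_diff: "kos B a (c - c') = kos B a c - kos B a c'"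
  by (rule ext) (simp add: kos_def a_diff sum_subtractf)

text \<open>Contraction anticommutes with exterior multiplication up to one term: either it meets
  the extracted entry, or it passes it with a sign and acts on \<open>F y\<close>.\<close>

lemma kos_alt_sum:
  "kos B a (alt_sum F) xs = (\<Sum>b\<in>B. a b (F b xs)) - alt_sum (\<lambda>y. kos B a (F y)) xs"
proof -
  have hom: "a b (alt_sum (\<lambda>y ys. F y (b # ys)) xs) = alt_sum (\<lambda>y ys. a b (F y (b # ys))) xs" for b
    by (rule alt_sum_hom[where M = UNIV and \<phi> = "a b"]) (simp_all add: subgrp_def a_diff)
  have "kos B a (alt_sum F) xs =
      (\<Sum>b\<in>B. a b (F b xs)) - (\<Sum>b\<in>B. alt_sum (\<lambda>y ys. a b (F y (b # ys))) xs)"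
    by (simp only: kos_def alt_sum.simps a_diff sum_subtractf hom)
  also have "(\<Sum>b\<in>B. alt_sum (\<lambda>y ys. a b (F y (b # ys))) xs) = alt_sum (\<lambda>y. kos B a (F y)) xs"
    by (simp only: kos_def[abs_def] alt_sum_sum)
  finally show ?thesis .
qed

text \<open>Exterior multiplication by \<open>e\<close> is a homotopy from \<open>a e\<close> to \<open>0\<close>.\<close>

lemma kos_annihilated:
  assumes "finite B" "e \<in> B" and c: "c \<in> alt_chains B M j" and cyc: "kos B a c = 0"
    and M': "\<And>xs. subgrp (M' xs)" and MM': "\<And>us vs. M (us @ vs) \<subseteq> M' (us @ e # vs)"
  shows "\<exists>y \<in> alt_chains B M' (Suc j). kos B a y = (\<lambda>xs. a e (c xs))"
proof
  define F where "F = (\<lambda>x ys. if x = e then c ys else 0)"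
  show "alt_sum F \<in> alt_chains B M' (Suc j)"
  proof (rule alt_sum_alt_chains)
    show "F x (us @ vs) \<in> M' (us @ x # vs)" for x us vs
      using alt_chainsD(2)[OF c] MM' M' by (auto simp: F_def subgrp_zero)
    show "alternating (F x)" for x
      unfolding F_def
      by (rule alternating_comp[OF alt_chainsD(1)[OF c], of "\<lambda>v. if x = e then v else 0"]) simp
    show "length ys = j \<and> x \<in> B \<and> set ys \<subseteq> B" if "F x ys \<noteq> 0" for x ys
      using that alt_chainsD(3,4)[OF c, of ys] \<open>e \<in> B\<close> by (auto simp: F_def split: if_splits)
  qed (rule M')
  have F0: "kos B a (F y) = (\<lambda>_. 0)" for y
    using cyc by (cases "y = e") (auto simp: kos_def F_def fun_eq_iff)
  have "(\<Sum>b\<in>B. a b (F b xs)) = a e (c xs)" for xs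
  proof -
    have "(\<Sum>b\<in>B. a b (F b xs)) = (\<Sum>b\<in>B. if b = e then a e (c xs) else 0)"
      by (intro sum.cong) (auto simp: F_def)
    then show ?thesis using assms(1,2) by simp
  qed
  then show "kos B a (alt_sum F) = (\<lambda>xs. a e (c xs))"
    by (intro ext) (simp add: kos_alt_sum F0 alt_sum_zero)
qed

text \<open>Returning the extracted entry to its place costs exactly the sign with which
  \<open>alt_sum\<close> counts it. This yields the exterior part of the Euler operator.\<close>

lemma alt_sum_Cons_alternating:
  assumes "alternating c"
  shows "alt_sum (\<lambda>x ys. scale (w x) (c (x # ys))) xs = scale (\<Sum>x\<leftarrow>xs. w x) (c xs)"
  using assms
proof (induction xs arbitrary: c)
  case (Cons x xs)
  have "alt_sum (\<lambda>y ys. scale (w y) (c (y # x # ys))) xs =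
      - alt_sum (\<lambda>y ys. scale (w y) (c (x # y # ys))) xs"
    unfolding alt_sum_uminus[symmetric]
    by (rule alt_sum_cong, subst alternating_swap[OF Cons.prems]) simp
  also have "\<dots> = - scale (\<Sum>x\<leftarrow>xs. w x) (c (x # xs))"
    using Cons.IH[OF alternating_Cons[OF Cons.prems, of x]] by simp
  finally show ?case by (simp add: scale_left_distrib)
qed simp

text \<open>
  The Euler homotopy: \<open>D\<close> plays the role of the partial derivatives, so that the hypothesis on \<open>L\<close>
  says that \<open>L\<close> inverts the Euler operator, which is multiplication by the degree.
\<close>

lemma kos_exact:
  assumes fin: "finite B" and c: "c \<in> alt_chains B M j" and cyc: "kos B a c = 0"
    and M: "\<And>xs. subgrp (M xs)"
    and D_diff: "\<And>b u v. D b (u - v) = D b u - D b v"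
    and D_scale: "\<And>b r v. D b (scale r v) = scale r (D b v)"
    and D_a: "\<And>b b' v. b \<in> B \<Longrightarrow> b' \<in> B \<Longrightarrow> D b (a b' v) = a b' (D b v) + (if b = b' then v else 0)"
    and D_M: "\<And>b us vs v. b \<in> B \<Longrightarrow> v \<in> M (us @ vs) \<Longrightarrow> D b v \<in> M (us @ b # vs)"
    and M_scale: "\<And>r xs v. v \<in> M xs \<Longrightarrow> scale r v \<in> M xs"
    and L_diff: "\<And>u v. L (u - v) = L u - L v"
    and L_a: "\<And>b v. L (a b v) = a b (L v)"
    and L_M: "\<And>xs v. v \<in> M xs \<Longrightarrow> L v \<in> M xs"
    and L: "\<And>xs. c xs \<noteq> 0 \<Longrightarrow>
      L ((\<Sum>b\<in>B. scale (w b) (a b (D b (c xs)))) + scale (\<Sum>x\<leftarrow>xs. w x) (c xs)) = c xs"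
  shows "\<exists>y \<in> alt_chains B M (Suc j). kos B a y = c"
proof
  \<comment> \<open>\<open>alt_sum F\<close> is the exterior derivative of \<open>c\<close>, with
    the direction \<open>x\<close> weighted by \<open>w x\<close>.\<close>
  define F where "F = (\<lambda>x ys. if x \<in> B then scale (w x) (D x (c ys)) else 0)"
  have D0: "D b 0 = 0" for b using D_diff[of b 0 0] by simp
  have L0: "L 0 = 0" using L_diff[of 0 0] by simp
  have L_neg: "L (- v) = - L v" for v using L_diff[of 0 v] by (simp add: L0)
  have L_add: "L (u + v) = L u + L v" for u v using L_diff[of u "- v"] by (simp add: L_neg)
  have L_sum: "L (\<Sum>i\<in>I. f i) = (\<Sum>i\<in>I. L (f i))" for I :: "'i set" and f
    by (induction I rule: infinite_finite_induct) (auto simp: L_add L0)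
  have D_neg: "D b (- v) = - D b v" for b v using D_diff[of b 0 v] by (simp add: D0)
  have D_add: "D b (u + v) = D b u + D b v" for b u v
    using D_diff[of b u "- v"] by (simp add: D_neg)
  have D_sum: "D b (\<Sum>i\<in>I. f i) = (\<Sum>i\<in>I. D b (f i))" for I :: "'i set" and f b
    by (induction I rule: infinite_finite_induct) (auto simp: D_add D0)
  have "alt_sum F \<in> alt_chains B M (Suc j)"
  proof (rule alt_sum_alt_chains)
    show "F x (us @ vs) \<in> M (us @ x # vs)" for x us vs
      using D_M[of x "c (us @ vs)" us vs] alt_chainsD(2)[OF c] M
      by (auto simp: F_def subgrp_zero intro: M_scale)
    show "alternating (F x)" for x
      unfolding F_def
      by (rule alternating_comp[OF alt_chainsD(1)[OF c], of "\<lambda>v. if x \<in> B then scale (w x) (D x v) else 0"])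
         (simp add: D_neg)
    show "length ys = j \<and> x \<in> B \<and> set ys \<subseteq> B" if "F x ys \<noteq> 0" for x ys
      using that alt_chainsD(3,4)[OF c, of ys]
      by (cases "c ys = 0") (auto simp: F_def D0 split: if_splits)
  qed (rule M)
  then show "(\<lambda>xs. L (alt_sum F xs)) \<in> alt_chains B M (Suc j)"
    by (rule alt_chains_comp) (auto simp: L_M L_neg L0)
  \<comment> \<open>Differentiate the cycle condition in the direction \<open>y\<close>: by the
    Leibniz rule \<open>D_a\<close>, the derivative of \<open>a y\<close> leaves the extra term
    \<open>c (y # ys)\<close>.\<close>
  have kF: "kos B a (F y) ys = - scale (w y) (c (y # ys))" for y ys
  proof (cases "y \<in> B")
    case True
    have "0 = D y (kos B a c ys)" using cyc by (simp add: D0)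
    also have "\<dots> = (\<Sum>b\<in>B. a b (D y (c (b # ys)))) + (\<Sum>b\<in>B. if b = y then c (y # ys) else 0)"
      unfolding kos_def D_sum sum.distrib[symmetric]
      by (intro sum.cong) (auto simp: D_a True)
    also have "(\<Sum>b\<in>B. if b = y then c (y # ys) else 0) = c (y # ys)"
      using fin True by simp
    finally have "(\<Sum>b\<in>B. a b (D y (c (b # ys)))) = - c (y # ys)"
      by (simp add: eq_neg_iff_add_eq_0)
    then have "scale (w y) (\<Sum>b\<in>B. a b (D y (c (b # ys)))) = - scale (w y) (c (y # ys))" by simp
    then show ?thesis
      using True by (simp add: kos_def F_def a_scale scale_sum_right)
  next
    case False
    then show ?thesis using alt_chainsD(4)[OF c, of "y # ys"] by (auto simp: kos_def F_def)
  qed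
  show "kos B a (\<lambda>xs. L (alt_sum F xs)) = c"
  proof
    fix xs
    have "kos B a (\<lambda>xs. L (alt_sum F xs)) xs = L (kos B a (alt_sum F) xs)"
      by (simp add: kos_def L_sum L_a)
    \<comment> \<open>Cartan's formula on a cycle: the differential of the exterior derivative is
      the Euler operator, which adds the weight of \<open>xs\<close> to that of the
      coefficient.\<close>
    also have "kos B a (alt_sum F) xs =
        (\<Sum>b\<in>B. scale (w b) (a b (D b (c xs)))) + scale (\<Sum>x\<leftarrow>xs. w x) (c xs)"
      unfolding kos_alt_sum kF alt_sum_uminus alt_sum_Cons_alternating[OF alt_chainsD(1)[OF c]]
      by (simp add: F_def a_scale)
    also have "L \<dots> = c xs"
      by (cases "c xs = 0") (auto simp: L D0 L0)
    finally show "kos B a (\<lambda>xs. L (alt_sum F xs)) xs = c xs" .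
  qed
qed

end

section \<open>Antisymmetrization and lifting of alternating chains\<close>

text \<open>
  Up to the factor \<open>j!\<close>, this is the projection of functions on \<open>B\<^sup>j\<close> onto the alternating ones.
\<close>

fun alternize :: "nat \<Rightarrow> ('i list \<Rightarrow> 'm::ab_group_add) \<Rightarrow> 'i list \<Rightarrow> 'm" where
  "alternize 0 c = c"
| "alternize (Suc j) c = alt_sum (\<lambda>x. alternize j (\<lambda>ys. c (x # ys)))"

lemma alternize_zero: "alternize j (\<lambda>_. 0) = (\<lambda>_. 0)"
  by (induction j) (simp_all add: alt_sum_zero)

lemma alternize_alt_chains:
  assumes "subgrp M" "\<And>xs. c xs \<in> M" "\<And>xs. c xs \<noteq> 0 \<Longrightarrow> length xs = j \<and> set xs \<subseteq> B"
  shows "alternize j c \<in> alt_chains B (\<lambda>_. M) j"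
  using assms(2,3)
proof (induction j arbitrary: c)
  case 0
  have "c (u @ x # y # v) = 0" for u x y v using "0.prems"(2)[of "u @ x # y # v"] by auto
  then have "alternating c" unfolding alternating_def by simp
  then show ?case using 0 by (auto intro!: alt_chainsI)
next
  case (Suc j)
  have IH: "alternize j (\<lambda>ys. c (x # ys)) \<in> alt_chains B (\<lambda>_. M) j" for x
    by (rule Suc.IH) (use Suc.prems in fastforce)+
  have IH': "alternize j (\<lambda>ys. c (x # ys)) = 0" if "x \<notin> B" for x
  proof -
    have "(\<lambda>ys. c (x # ys)) = (\<lambda>_. 0)" using Suc.prems(2) that by fastforce
    then show ?thesis by (simp only: alternize_zero zero_fun_def)
  qed
  show ?case
    unfolding alternize.simps
  proof (rule alt_sum_alt_chains)
    show "length ys = j \<and> x \<in> B \<and> set ys \<subseteq> B"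
      if "alternize j (\<lambda>ys. c (x # ys)) ys \<noteq> 0" for x ys
      using that alt_chainsD(3,4)[OF IH that] IH'[of x] by (cases "x \<in> B") auto
  qed (use assms(1) alt_chainsD[OF IH] in auto)
qed

lemma alternize_hom:
  fixes c :: "'a list \<Rightarrow> 'b::ab_group_add"
  assumes "subgrp M" "\<And>xs. c xs \<in> M"
    "\<And>u v. u \<in> M \<Longrightarrow> v \<in> M \<Longrightarrow> \<phi> (u - v) = \<phi> u - \<phi> v"
  shows "\<phi> (alternize j c xs) = alternize j (\<lambda>ys. \<phi> (c ys)) xs"
  using assms(2)
proof (induction j arbitrary: c xs)
  case (Suc j)
  have mem: "alternize j c ys \<in> M" if "\<And>xs. c xs \<in> M" for c :: "'a list \<Rightarrow> 'b" and ys
    using that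
  proof (induction j arbitrary: c ys)
    case (Suc j)
    show ?case
      unfolding alternize.simps by (rule alt_sum_mem[OF assms(1)], rule Suc.IH, rule Suc.prems)
  qed simp
  show ?case
    unfolding alternize.simps
    by (subst alt_sum_hom[where M = M and \<phi> = \<phi>])
       (simp_all add: assms(1,3) mem[OF Suc.prems] Suc.IH[OF Suc.prems])
qed simp

lemma alternize_alternating:
  fixes scale :: "complex \<Rightarrow> 'm::ab_group_add \<Rightarrow> 'm"
  assumes "vector_space scale" "alternating c" "\<And>xs. c xs \<noteq> 0 \<Longrightarrow> length xs = j"
  shows "alternize j c = (\<lambda>xs. scale (fact j) (c xs))"
proof -
  interpret vector_space scale by (rule assms(1))
  \<comment> \<open>A dummy instance that gives access to \<open>alt_sum_Cons_alternating\<close>,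
    whose statement does not mention the operators.\<close>
  interpret koszul scale "{}" "\<lambda>_ v. v" by unfold_locales auto
  show ?thesis
    using assms(2,3)
  proof (induction j arbitrary: c)
    case (Suc j)
    have IH: "alternize j (\<lambda>ys. c (x # ys)) = (\<lambda>ys. scale (fact j) (c (x # ys)))" for x
    proof (rule Suc.IH[OF alternating_Cons[OF Suc.prems(1)]])
      show "length ys = j" if "c (x # ys) \<noteq> 0" for ys
        using Suc.prems(2)[OF that] by simp
    qed
    have "alternize (Suc j) c xs = scale (fact j * of_nat (length xs)) (c xs)" for xs
      using alt_sum_Cons_alternating[OF Suc.prems(1), of "\<lambda>_. fact j" xs]
      by (simp add: IH sum_list_triv mult.commute)
    moreover have "scale (fact j * of_nat (length xs)) (c xs) = scale (fact (Suc j)) (c xs)" for xs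
    proof (cases "c xs = 0")
      case False
      have "fact j * of_nat (Suc j) = (fact (Suc j) :: complex)"
        by (simp only: fact_Suc mult.commute of_nat_mult)
      then show ?thesis by (simp only: Suc.prems(2)[OF False])
    next
      case True
      then show ?thesis by (simp only: scale_zero_right)
    qed
    ultimately show ?case by (intro ext) (rule trans)
  next
    case 0
    show ?case by simp
  qed
qed

text \<open>Tensoring with an exterior power preserves surjectivity. Preimages chosen entry by entry
  need not alternate; antisymmetrizing them repairs this and multiplies the image, which alternates
  already, by \<open>fact j\<close>. Characteristic 0 permits the division.\<close>

lemma alt_chains_lift:
  fixes scale :: "complex \<Rightarrow> 'm::ab_group_add \<Rightarrow> 'm"
    and scale' :: "complex \<Rightarrow> 'n::ab_group_add \<Rightarrow> 'n"
  assumes vs: "vector_space scale" and vs': "vector_space scale'"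
    and M: "subgrp M" "\<And>r v. v \<in> M \<Longrightarrow> scale r v \<in> M"
    and \<phi>: "\<And>u v. u \<in> M \<Longrightarrow> v \<in> M \<Longrightarrow> \<phi> (u - v) = \<phi> u - \<phi> v"
      "\<And>r v. v \<in> M \<Longrightarrow> \<phi> (scale r v) = scale' r (\<phi> v)"
    and c: "c \<in> alt_chains B N j" and surj: "\<And>xs. c xs \<in> \<phi> ` M"
  shows "\<exists>y \<in> alt_chains B (\<lambda>_. M) j. \<forall>xs. \<phi> (y xs) = c xs"
proof -
  interpret v: vector_space scale by (rule vs)
  interpret v': vector_space scale' by (rule vs')
  have \<phi>0: "\<phi> 0 = 0" using \<phi>(1)[of 0 0] subgrp_zero[OF M(1)] by simp
  \<comment> \<open>Zero is lifted to zero, so that the support condition on chains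
    survives.\<close>
  have "\<exists>v \<in> M. \<phi> v = c xs \<and> (c xs = 0 \<longrightarrow> v = 0)" for xs
    using surj[of xs] subgrp_zero[OF M(1)] \<phi>0 by (cases "c xs = 0") auto
  then obtain y0 where y0: "\<And>xs. y0 xs \<in> M" "\<And>xs. \<phi> (y0 xs) = c xs" "\<And>xs. c xs = 0 \<Longrightarrow> y0 xs = 0"
    by metis
  define y where "y = alternize j y0"
  have y: "y \<in> alt_chains B (\<lambda>_. M) j"
    unfolding y_def by (rule alternize_alt_chains) (use M y0 alt_chainsD(3,4)[OF c] in metis)+
  have "\<phi> (y xs) = scale' (fact j) (c xs)" for xs
    unfolding y_def using alternize_alternating[OF vs' alt_chainsD(1)[OF c] alt_chainsD(3)[OF c]]
    by (subst alternize_hom[where M = M and \<phi> = \<phi>]) (simp_all add: y0 M \<phi>)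
  then have "\<phi> (scale (1 / fact j) (y xs)) = c xs" for xs
    using alt_chainsD(2)[OF y] by (simp add: \<phi>(2))
  moreover have "(\<lambda>xs. scale (1 / fact j) (y xs)) \<in> alt_chains B (\<lambda>_. M) j"
    by (rule alt_chains_comp[OF y]) (simp_all add: M(2))
  ultimately show ?thesis by (intro bexI allI)
qed

text \<open>The staircase. \<open>\<kappa>\<close> lowers \<open>j\<close> and is exact on
  \<open>D\<close> for positive \<open>j\<close>; \<open>del\<close> lowers \<open>i\<close> and is
  exact on the cycles in \<open>C\<close> along \<open>i + j = N\<close> for
  \<open>j \<ge> 2\<close>. The descent writes \<open>del i z\<close> as \<open>\<kappa> z'\<close>
  and passes to \<open>z'\<close>, until \<open>base\<close> applies in row 0; on the way back, the
  corrected \<open>z'\<close> is a \<open>del\<close>-boundary and its preimage corrects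
  \<open>z\<close>. There are two families because the descent divides by degrees and needs
  homogeneous chains, whereas preimages under \<open>del\<close> may be inhomogeneous.\<close>

lemma double_complex_chase:
  fixes C D :: "nat \<Rightarrow> nat \<Rightarrow> 'c::ab_group_add set"
  assumes DC: "\<And>i j. D i j \<subseteq> C i j" and C: "\<And>i j. subgrp (C i j)"
    and \<kappa>_diff: "\<And>u v. \<kappa> (u - v) = \<kappa> u - \<kappa> v"
    and \<kappa>_C: "\<And>i j c. c \<in> C i (Suc j) \<Longrightarrow> \<kappa> c \<in> C i j"
    and \<kappa>\<kappa>: "\<And>i j c. c \<in> C i j \<Longrightarrow> \<kappa> (\<kappa> c) = 0"
    and \<kappa>_exact: "\<And>i j c. c \<in> D i (Suc j) \<Longrightarrow> \<kappa> c = 0 \<Longrightarrow> \<exists>z \<in> D i (Suc (Suc j)). c = \<kappa> z"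
    and del_diff: "\<And>i j u v. u \<in> C (Suc i) j \<Longrightarrow> v \<in> C (Suc i) j \<Longrightarrow> del i (u - v) = del i u - del i v"
    and del_D: "\<And>i j c. c \<in> D (Suc i) j \<Longrightarrow> del i c \<in> D i j"
    and del_\<kappa>: "\<And>i j c. c \<in> C (Suc i) (Suc j) \<Longrightarrow> del i (\<kappa> c) = \<kappa> (del i c)"
    and cyc_Suc: "\<And>i c. cyc (Suc i) c \<longleftrightarrow> del i c = 0"
    and cyc_del: "\<And>i j c. c \<in> C (Suc i) j \<Longrightarrow> cyc i (del i c)"
    and del_exact: "\<And>i j c. c \<in> C i j \<Longrightarrow> i + j = N \<Longrightarrow> 2 \<le> j \<Longrightarrow> cyc i c \<Longrightarrow>
      \<exists>y \<in> C (Suc i) j. c = del i y"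
    and base: "\<And>z. z \<in> D 0 N \<Longrightarrow> cyc 0 (\<kappa> z) \<Longrightarrow> \<exists>y \<in> C 0 (Suc N). cyc 0 (z - \<kappa> y)"
    and z: "z \<in> D i j" "i + j = N" "1 \<le> j" "cyc i (\<kappa> z)"
  shows "\<exists>y \<in> C i (Suc j). cyc i (z - \<kappa> y)"
  using z
proof (induction i arbitrary: j z)
  case 0
  then show ?case using base by simp
next
  case (Suc i)
  obtain j' where j': "j = Suc j'" using Suc.prems(3) by (cases j) auto
  have zC: "z \<in> C (Suc i) j" using Suc.prems(1) DC by blast
  have "\<kappa> (del i z) = 0"
    using Suc.prems(4) del_\<kappa> zC by (simp add: cyc_Suc j')
  then obtain z' where z': "z' \<in> D i (Suc j)" "del i z = \<kappa> z'"
    using \<kappa>_exact del_D Suc.prems(1) j' by metis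
  have "cyc i (\<kappa> z')" using cyc_del[OF zC] z' by simp
  then obtain y' where y': "y' \<in> C i (Suc (Suc j))" "cyc i (z' - \<kappa> y')"
    using Suc.IH[of z' "Suc j"] z' Suc.prems by auto
  have "z' - \<kappa> y' \<in> C i (Suc j)"
    using z'(1) DC \<kappa>_C[OF y'(1)] C by (blast intro: subgrp_diff)
  then obtain y where y: "y \<in> C (Suc i) (Suc j)" "z' - \<kappa> y' = del i y"
    using del_exact[of "z' - \<kappa> y'" i "Suc j"] y'(2) Suc.prems by auto
  have "del i (z - \<kappa> y) = \<kappa> z' - \<kappa> (del i y)"
    using del_diff[OF zC \<kappa>_C[OF y(1)]] z'(2) del_\<kappa>[OF y(1)] by simp
  also have "\<dots> = \<kappa> (\<kappa> y')"
    unfolding y(2)[symmetric] by (simp add: \<kappa>_diff)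
  also have "\<dots> = 0" using \<kappa>\<kappa>[OF y'(1)] .
  finally show ?case using y(1) cyc_Suc by blast
qed

section \<open>Graded polynomial rings\<close>

lemma const_poly_0 [simp]: "const_poly 0 = 0"
  by (simp add: const_poly_def)

lemma const_poly_1 [simp]: "const_poly 1 = 1"
  by (simp add: const_poly_def)

lemma const_poly_add: "const_poly (c + d) = const_poly c + const_poly d"
  by (simp add: const_poly_def single_add)

lemma const_poly_mult: "const_poly (c * d) = const_poly c * const_poly d"
  by (simp add: const_poly_def mult_single)

lemma const_poly_uminus: "const_poly (- c) = - const_poly c"
  by (simp add: const_poly_def single_uminus)

lemma const_poly_sum: "const_poly (\<Sum>i\<in>I. f i) = (\<Sum>i\<in>I. const_poly (f i))"
  by (induction I rule: infinite_finite_induct) (simp_all add: const_poly_add)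

lemma const_poly_of_nat: "const_poly (of_nat k) = of_nat k"
  by (simp add: const_poly_def)

lemma const_poly_single: "const_poly c * Poly_Mapping.single m d = Poly_Mapping.single m (c * d)"
  by (simp add: const_poly_def mult_single)

lemma cpoly_sum_keys:
  "(\<Sum>m\<in>Poly_Mapping.keys p. Poly_Mapping.single m (Poly_Mapping.lookup p m)) = (p :: 'x cpoly)"
  by (rule poly_mapping_eqI)
     (auto simp: lookup_sum lookup_single when_def sum.delta in_keys_iff)

lemma cpoly_induct [case_names zero single add]:
  fixes p :: "'x cpoly"
  assumes "P 0" "\<And>m c. P (Poly_Mapping.single m c)" "\<And>p q. P p \<Longrightarrow> P q \<Longrightarrow> P (p + q)"
  shows "P p"
proof -
  have "P (\<Sum>m\<in>K. Poly_Mapping.single m (Poly_Mapping.lookup p m))" for K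
    by (induction K rule: infinite_finite_induct) (auto intro: assms)
  from this[of "Poly_Mapping.keys p"] show ?thesis by (simp only: cpoly_sum_keys)
qed

lemma lookup_const_mult:
  "Poly_Mapping.lookup (const_poly c * p) m = c * Poly_Mapping.lookup p m"
proof (induction p rule: cpoly_induct)
  case (single m' d)
  then show ?case by (simp add: const_poly_single lookup_single when_def)
qed (simp_all add: distrib_left lookup_add)

lemma sum_keys_add:
  fixes p q :: "'x cpoly"
  assumes "\<And>m c d. f m (c + d) = f m c + (f m d :: 'b::comm_monoid_add)" "\<And>m. f m 0 = 0"
  shows "(\<Sum>m\<in>Poly_Mapping.keys (p + q). f m (Poly_Mapping.lookup (p + q) m)) =
    (\<Sum>m\<in>Poly_Mapping.keys p. f m (Poly_Mapping.lookup p m)) +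
    (\<Sum>m\<in>Poly_Mapping.keys q. f m (Poly_Mapping.lookup q m))"
  by (rule setsum_keys_plus_distrib) (simp_all add: assms)

lemma mon_weight_0 [simp]: "mon_weight w 0 = 0"
  by (simp add: mon_weight_def)

lemma mon_weight_add: "mon_weight w (m + m') = mon_weight w m + mon_weight w m'"
  unfolding mon_weight_def by (rule setsum_keys_plus_distrib) (simp_all add: algebra_simps)

lemma mon_weight_single: "mon_weight w (Poly_Mapping.single x k) = k * w x"
  by (simp add: mon_weight_def)

lemma keys_add_nat: "Poly_Mapping.keys (m + m' :: 'x \<Rightarrow>\<^sub>0 nat) = Poly_Mapping.keys m \<union> Poly_Mapping.keys m'"
  by (auto simp: in_keys_iff lookup_add)

text \<open>With integer degrees, shifts such as \<open>d - wt xs\<close> need no truncation: in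
  negative degrees only 0 remains.\<close>

definition hpolys :: "'x set \<Rightarrow> ('x \<Rightarrow> nat) \<Rightarrow> int \<Rightarrow> 'x cpoly set" where
  "hpolys X w d = {p \<in> polys X. homogeneous w d p}"

lemma polys_zero [simp]: "0 \<in> polys X"
  by (simp add: polys_def)

lemma polys_one [simp]: "1 \<in> polys X"
  by (simp add: polys_def)

lemma polys_single [simp]:
  "Poly_Mapping.single m c \<in> polys X \<longleftrightarrow> c = 0 \<or> Poly_Mapping.keys m \<subseteq> X"
  by (simp add: polys_def)

lemma polys_const [simp]: "const_poly c \<in> polys X"
  by (simp add: const_poly_def)

lemma polys_var [simp]: "var_poly x \<in> polys X \<longleftrightarrow> x \<in> X"
  by (simp add: var_poly_def)

lemma polys_add: "p \<in> polys X \<Longrightarrow> q \<in> polys X \<Longrightarrow> p + q \<in> polys X"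
  using Poly_Mapping.keys_add[of p q] by (auto simp: polys_def)

lemma polys_uminus: "p \<in> polys X \<Longrightarrow> - p \<in> polys X"
  by (auto simp: polys_def in_keys_iff)

lemma polys_diff: "p \<in> polys X \<Longrightarrow> q \<in> polys X \<Longrightarrow> p - q \<in> polys X"
  using polys_add[of p X "- q"] polys_uminus[of q X] by simp

lemma polys_mult:
  assumes "p \<in> polys X" "q \<in> polys X"
  shows "p * q \<in> polys X"
  unfolding polys_def
proof safe
  fix m x assume "m \<in> Poly_Mapping.keys (p * q)" "x \<in> Poly_Mapping.keys m"
  then obtain a b where "a \<in> Poly_Mapping.keys p" "b \<in> Poly_Mapping.keys q" "m = a + b"
    using keys_mult[of p q] by blast
  then show "x \<in> X" using assms \<open>x \<in> Poly_Mapping.keys m\<close> by (auto simp: polys_def keys_add_nat)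
qed

lemma polys_sum: "(\<And>i. i \<in> I \<Longrightarrow> f i \<in> polys X) \<Longrightarrow> (\<Sum>i\<in>I. f i) \<in> polys X"
  by (induction I rule: infinite_finite_induct) (auto intro: polys_add)

lemma polys_prod: "(\<And>i. i \<in> I \<Longrightarrow> f i \<in> polys X) \<Longrightarrow> (\<Prod>i\<in>I. f i) \<in> polys X"
  by (induction I rule: infinite_finite_induct) (auto intro: polys_mult)

lemma polys_power: "p \<in> polys X \<Longrightarrow> p ^ k \<in> polys X"
  by (induction k) (auto intro: polys_mult)

lemma hpolysD: "p \<in> hpolys X w d \<Longrightarrow> p \<in> polys X" "p \<in> hpolys X w d \<Longrightarrow> homogeneous w d p"
  by (auto simp: hpolys_def)

lemma hpolys_single [simp]:
  "Poly_Mapping.single m c \<in> hpolys X w d \<longleftrightarrow>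
    c = 0 \<or> Poly_Mapping.keys m \<subseteq> X \<and> int (mon_weight w m) = d"
  by (auto simp: hpolys_def homogeneous_def)

lemma hpolys_zero [simp]: "0 \<in> hpolys X w d"
  by (simp add: hpolys_def homogeneous_def)

lemma hpolys_const [simp]: "const_poly c \<in> hpolys X w 0"
  by (simp add: const_poly_def)

lemma hpolys_var: "x \<in> X \<Longrightarrow> var_poly x \<in> hpolys X w (int (w x))"
  by (simp add: var_poly_def mon_weight_single)

lemma hpolys_add: "p \<in> hpolys X w d \<Longrightarrow> q \<in> hpolys X w d \<Longrightarrow> p + q \<in> hpolys X w d"
  using Poly_Mapping.keys_add[of p q] by (auto simp: hpolys_def polys_add homogeneous_def)

lemma hpolys_uminus: "p \<in> hpolys X w d \<Longrightarrow> - p \<in> hpolys X w d"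
  by (auto simp: hpolys_def polys_uminus homogeneous_def in_keys_iff)

lemma hpolys_diff: "p \<in> hpolys X w d \<Longrightarrow> q \<in> hpolys X w d \<Longrightarrow> p - q \<in> hpolys X w d"
  using hpolys_add[of p X w d "- q"] hpolys_uminus[of q X w d] by simp

lemma subgrp_hpolys [simp]: "subgrp (hpolys X w d)"
  by (simp add: subgrp_def hpolys_diff)

lemma hpolys_sum: "(\<And>i. i \<in> I \<Longrightarrow> f i \<in> hpolys X w d) \<Longrightarrow> (\<Sum>i\<in>I. f i) \<in> hpolys X w d"
  by (rule subgrp_sum) auto

lemma homogeneous_mult:
  assumes "homogeneous w d p" "homogeneous w e q"
  shows "homogeneous w (d + e) (p * q)"
  unfolding homogeneous_def
proof
  fix m assume "m \<in> Poly_Mapping.keys (p * q)"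
  then obtain a b where "a \<in> Poly_Mapping.keys p" "b \<in> Poly_Mapping.keys q" "m = a + b"
    using keys_mult[of p q] by blast
  then show "int (mon_weight w m) = d + e"
    using assms by (auto simp: homogeneous_def mon_weight_add)
qed

lemma hpolys_mult: "p \<in> hpolys X w d \<Longrightarrow> q \<in> hpolys X w e \<Longrightarrow> p * q \<in> hpolys X w (d + e)"
  by (simp add: hpolys_def polys_mult homogeneous_mult)

lemma hpolys_const_mult: "p \<in> hpolys X w d \<Longrightarrow> const_poly c * p \<in> hpolys X w d"
  using hpolys_mult[of "const_poly c" X w 0 p d] by simp

lemma hpolys_prod:
  "(\<And>i. i \<in> I \<Longrightarrow> f i \<in> hpolys X w (d i)) \<Longrightarrow> (\<Prod>i\<in>I. f i) \<in> hpolys X w (\<Sum>i\<in>I. d i)"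
proof (induction I rule: infinite_finite_induct)
  case (insert i I)
  then show ?case by (auto intro!: hpolys_mult)
qed (use hpolys_const[of 1] in simp_all)

lemma hpolys_negative: "p \<in> hpolys X w d \<Longrightarrow> d < 0 \<Longrightarrow> p = 0"
proof -
  assume "p \<in> hpolys X w d" "d < 0"
  then have "Poly_Mapping.keys p = {}" by (force simp: hpolys_def homogeneous_def)
  then show "p = 0" using cpoly_sum_keys[of p] by simp
qed

text \<open>Truncated subtraction of exponents is harmless: where it truncates, the factor
  \<open>Poly_Mapping.lookup m x\<close> is 0.\<close>

definition pd :: "'x \<Rightarrow> 'x cpoly \<Rightarrow> 'x cpoly" where
  "pd x p = (\<Sum>m\<in>Poly_Mapping.keys p. Poly_Mapping.single (m - Poly_Mapping.single x 1)
      (of_nat (Poly_Mapping.lookup m x) * Poly_Mapping.lookup p m))"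

lemma pd_zero [simp]: "pd x 0 = 0"
  by (simp add: pd_def)

lemma pd_single: "pd x (Poly_Mapping.single m c) =
    Poly_Mapping.single (m - Poly_Mapping.single x 1) (of_nat (Poly_Mapping.lookup m x) * c)"
  by (simp add: pd_def)

lemma pd_add: "pd x (p + q) = pd x p + pd x q"
  unfolding pd_def by (rule sum_keys_add) (simp_all add: single_add[symmetric] distrib_left)

lemma pd_diff: "pd x (p - q) = pd x p - pd x q"
  using pd_add[of x "p - q" q] by (simp add: algebra_simps)

lemma pd_const_mult: "pd x (const_poly c * p) = const_poly c * pd x p"
proof (induction p rule: cpoly_induct)
  case (single m d)
  then show ?case by (simp add: const_poly_single pd_single mult_ac)
qed (simp_all add: distrib_left pd_add)

lemma var_mult_pd_single:
  "var_poly x * pd x (Poly_Mapping.single m c) =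
    Poly_Mapping.single m (of_nat (Poly_Mapping.lookup m x) * c)"
proof (cases "Poly_Mapping.lookup m x = 0")
  case False
  then have "Poly_Mapping.single x 1 + (m - Poly_Mapping.single x 1) = m"
    by (intro poly_mapping_eqI) (auto simp: lookup_add lookup_minus lookup_single when_def)
  then show ?thesis by (simp add: pd_single var_poly_def mult_single)
qed (simp add: pd_single)

lemma pd_var_mult: "pd x (var_poly y * p) = var_poly y * pd x p + (if x = y then p else 0)"
proof (induction p rule: cpoly_induct)
  case (single m c)
  show ?case
  proof (cases "x = y")
    case True
    have "Poly_Mapping.single x 1 + m - Poly_Mapping.single x 1 = m" by simp
    then have "pd x (var_poly x * Poly_Mapping.single m c) =
        Poly_Mapping.single m ((1 + of_nat (Poly_Mapping.lookup m x)) * c)"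
      by (simp add: var_poly_def mult_single pd_single lookup_add)
    then show ?thesis
      using True by (simp add: var_mult_pd_single distrib_right single_add)
  next
    case False
    have "Poly_Mapping.single y 1 + m - Poly_Mapping.single x 1 =
        Poly_Mapping.single y 1 + (m - Poly_Mapping.single x 1)" if "Poly_Mapping.lookup m x \<noteq> 0"
      using that False
      by (intro poly_mapping_eqI) (auto simp: lookup_add lookup_minus lookup_single when_def)
    then show ?thesis
      using False by (cases "Poly_Mapping.lookup m x = 0")
        (simp_all add: var_poly_def mult_single pd_single lookup_add lookup_single)
  qed
qed (simp_all add: distrib_left pd_add)

lemma pd_hpolys:
  assumes "p \<in> hpolys X w d"
  shows "pd x p \<in> hpolys X w (d - int (w x))"
proof -
  have "Poly_Mapping.single (m - Poly_Mapping.single x 1)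
      (of_nat (Poly_Mapping.lookup m x) * Poly_Mapping.lookup p m) \<in> hpolys X w (d - int (w x))"
    if "m \<in> Poly_Mapping.keys p" for m
  proof (cases "Poly_Mapping.lookup m x = 0")
    case False
    then have m: "Poly_Mapping.single x 1 + (m - Poly_Mapping.single x 1) = m"
      by (intro poly_mapping_eqI) (auto simp: lookup_add lookup_minus lookup_single when_def)
    have "mon_weight w m = w x + mon_weight w (m - Poly_Mapping.single x 1)"
      by (subst m[symmetric]) (simp only: mon_weight_add mon_weight_single)
    moreover have "Poly_Mapping.keys (m - Poly_Mapping.single x 1) \<subseteq> Poly_Mapping.keys m"
      using keys_add_nat[of "Poly_Mapping.single x 1" "m - Poly_Mapping.single x 1"] unfolding m by blast
    ultimately show ?thesis
      using assms that by (auto simp: hpolys_def polys_def homogeneous_def)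
  qed simp
  then show ?thesis unfolding pd_def by (rule hpolys_sum)
qed

lemma euler_identity:
  assumes "finite X" "p \<in> hpolys X w d"
  shows "(\<Sum>x\<in>X. const_poly (of_nat (w x)) * (var_poly x * pd x p)) = const_poly (of_int d) * p"
proof -
  define E where "E = (\<lambda>p. \<Sum>x\<in>X. const_poly (of_nat (w x)) * (var_poly x * pd x p))"
  have E_add: "E (p + q) = E p + E q" for p q
    by (simp add: E_def pd_add distrib_left sum.distrib)
  have E_sum: "E (\<Sum>i\<in>I. f i) = (\<Sum>i\<in>I. E (f i))" for I :: "('a \<Rightarrow>\<^sub>0 nat) set" and f
    by (induction I rule: infinite_finite_induct) (simp_all add: E_add, simp_all add: E_def)
  have E_single: "E (Poly_Mapping.single m c) = const_poly (of_int d) * Poly_Mapping.single m c"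
    if "m \<in> Poly_Mapping.keys p" for m c
  proof -
    have keys: "Poly_Mapping.keys m \<subseteq> X" and d: "int (mon_weight w m) = d"
      using assms(2) that by (auto simp: hpolys_def polys_def homogeneous_def)
    have "mon_weight w m = (\<Sum>x\<in>X. Poly_Mapping.lookup m x * w x)"
      unfolding mon_weight_def using keys assms(1)
      by (intro sum.mono_neutral_left) (auto simp: in_keys_iff)
    then have "of_int d = (\<Sum>x\<in>X. of_nat (w x) * (of_nat (Poly_Mapping.lookup m x)) :: complex)"
      unfolding d[symmetric] by (simp add: mult.commute)
    moreover have "E (Poly_Mapping.single m c) =
        Poly_Mapping.single m ((\<Sum>x\<in>X. of_nat (w x) * of_nat (Poly_Mapping.lookup m x)) * c)"
      unfolding E_def var_mult_pd_single const_poly_single sum_distrib_right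
      by (induction X rule: infinite_finite_induct) (simp_all add: single_add mult.assoc)
    ultimately show ?thesis by (simp add: const_poly_single)
  qed
  have "E p = (\<Sum>m\<in>Poly_Mapping.keys p. E (Poly_Mapping.single m (Poly_Mapping.lookup p m)))"
    by (subst cpoly_sum_keys[of p, symmetric]) (rule E_sum)
  also have "\<dots> = const_poly (of_int d) * p"
    by (subst (2) cpoly_sum_keys[of p, symmetric]) (simp add: E_single sum_distrib_left)
  finally show ?thesis by (simp only: E_def)
qed

section \<open>Homogeneous components\<close>

definition hcomp :: "('x \<Rightarrow> nat) \<Rightarrow> int \<Rightarrow> 'x cpoly \<Rightarrow> 'x cpoly" where
  "hcomp w d = Poly_Mapping.mapp (\<lambda>m c. if int (mon_weight w m) = d then c else 0)"

lemma lookup_hcomp: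
  "Poly_Mapping.lookup (hcomp w d p) m = (if int (mon_weight w m) = d then Poly_Mapping.lookup p m else 0)"
  by (simp add: hcomp_def lookup_mapp when_def in_keys_iff)

lemma hcomp_zero [simp]: "hcomp w d 0 = 0"
  by (rule poly_mapping_eqI) (simp add: lookup_hcomp)

lemma hcomp_add: "hcomp w d (p + q) = hcomp w d p + hcomp w d q"
  by (rule poly_mapping_eqI) (simp add: lookup_hcomp lookup_add)

lemma hcomp_sum: "hcomp w d (\<Sum>i\<in>I. f i) = (\<Sum>i\<in>I. hcomp w d (f i))"
  by (induction I rule: infinite_finite_induct) (simp_all add: hcomp_add)

lemma hcomp_hpolys: "p \<in> polys X \<Longrightarrow> hcomp w d p \<in> hpolys X w d"
  by (auto simp: hpolys_def polys_def homogeneous_def in_keys_iff lookup_hcomp split: if_splits)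

lemma hcomp_homogeneous: "homogeneous w d p \<Longrightarrow> hcomp w d p = p"
  by (rule poly_mapping_eqI) (auto simp: lookup_hcomp homogeneous_def in_keys_iff)

lemma hcomp_single:
  "hcomp w d (Poly_Mapping.single m c) = (if int (mon_weight w m) = d then Poly_Mapping.single m c else 0)"
  by (rule poly_mapping_eqI) (auto simp: lookup_hcomp lookup_single when_def)

lemma hcomp_mult:
  assumes "homogeneous w e q"
  shows "hcomp w d (q * p) = q * hcomp w (d - e) p"
proof -
  have *: "hcomp w d (Poly_Mapping.single m c * p) = Poly_Mapping.single m c * hcomp w (d - e) p"
    if "m \<in> Poly_Mapping.keys q" for m c
  proof (induction p rule: cpoly_induct)
    case (single m' c')
    have "int (mon_weight w m) = e" using assms that by (simp add: homogeneous_def)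
    then show ?case by (auto simp: mult_single hcomp_single mon_weight_add)
  qed (simp_all add: distrib_left hcomp_add)
  have "hcomp w d (q * p) =
      hcomp w d (\<Sum>m\<in>Poly_Mapping.keys q. Poly_Mapping.single m (Poly_Mapping.lookup q m) * p)"
    by (subst cpoly_sum_keys[of q, symmetric]) (simp only: sum_distrib_right)
  also have "\<dots> = q * hcomp w (d - e) p"
    by (subst (3) cpoly_sum_keys[of q, symmetric]) (simp add: hcomp_sum * sum_distrib_right)
  finally show ?thesis .
qed

section \<open>Substitution homomorphisms\<close>

definition mon_subst :: "('x \<Rightarrow> 'y cpoly) \<Rightarrow> ('x \<Rightarrow>\<^sub>0 nat) \<Rightarrow> 'y cpoly" where
  "mon_subst f m = (\<Prod>x\<in>Poly_Mapping.keys m. f x ^ Poly_Mapping.lookup m x)"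

lemma mon_subst_superset:
  assumes "finite A" "Poly_Mapping.keys m \<subseteq> A"
  shows "mon_subst f m = (\<Prod>x\<in>A. f x ^ Poly_Mapping.lookup m x)"
  unfolding mon_subst_def using assms by (intro prod.mono_neutral_left) (auto simp: in_keys_iff)

lemma mon_subst_add: "mon_subst f (m + m') = mon_subst f m * mon_subst f m'"
proof -
  let ?A = "Poly_Mapping.keys m \<union> Poly_Mapping.keys m'"
  have "mon_subst f (m + m') = (\<Prod>x\<in>?A. f x ^ Poly_Mapping.lookup (m + m') x)"
    by (rule mon_subst_superset) (auto simp: keys_add_nat)
  also have "\<dots> = mon_subst f m * mon_subst f m'"
    by (simp add: mon_subst_superset[of ?A] lookup_add power_add prod.distrib)
  finally show ?thesis .
qed

lemma subst_poly_eq: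
  "subst_poly f p = (\<Sum>m\<in>Poly_Mapping.keys p. const_poly (Poly_Mapping.lookup p m) * mon_subst f m)"
  by (simp add: subst_poly_def mon_subst_def)

lemma subst_poly_0 [simp]: "subst_poly f 0 = 0"
  by (simp add: subst_poly_eq)

lemma subst_poly_single: "subst_poly f (Poly_Mapping.single m c) = const_poly c * mon_subst f m"
  by (simp add: subst_poly_eq)

lemma subst_poly_const: "subst_poly f (const_poly c) = const_poly c"
  by (simp add: const_poly_def[of c] subst_poly_single) (simp add: const_poly_def mon_subst_def)

lemma subst_poly_1 [simp]: "subst_poly f 1 = 1"
  using subst_poly_const[of f 1] by simp

lemma subst_poly_var: "subst_poly f (var_poly x) = f x"
  by (simp add: var_poly_def subst_poly_single mon_subst_def)

lemma subst_poly_add: "subst_poly f (p + q) = subst_poly f p + subst_poly f q"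
  unfolding subst_poly_eq by (rule sum_keys_add) (simp_all add: const_poly_add distrib_right)

lemma subst_poly_mult: "subst_poly f (p * q) = subst_poly f p * subst_poly f q"
proof (induction p rule: cpoly_induct)
  case (single m c)
  show ?case
  proof (induction q rule: cpoly_induct)
    case (single m' c')
    show ?case
      by (simp only: mult_single subst_poly_single mon_subst_add const_poly_mult mult_ac)
  qed (simp_all add: distrib_left subst_poly_add)
qed (simp_all add: distrib_right subst_poly_add)

lemma subst_poly_sum: "subst_poly f (\<Sum>i\<in>I. g i) = (\<Sum>i\<in>I. subst_poly f (g i))"
  by (induction I rule: infinite_finite_induct) (simp_all add: subst_poly_add)

lemma subst_poly_prod: "subst_poly f (\<Prod>i\<in>I. g i) = (\<Prod>i\<in>I. subst_poly f (g i))"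
  by (induction I rule: infinite_finite_induct) (simp_all add: subst_poly_mult)

lemma subst_poly_power: "subst_poly f (p ^ k) = subst_poly f p ^ k"
  by (induction k) (simp_all add: subst_poly_mult)

lemma subst_poly_cong:
  assumes "p \<in> polys X" "\<And>x. x \<in> X \<Longrightarrow> f x = g x"
  shows "subst_poly f p = subst_poly g p"
proof -
  have "f x = g x" if "m \<in> Poly_Mapping.keys p" "x \<in> Poly_Mapping.keys m" for m x
    using that assms by (auto simp: polys_def)
  then show ?thesis
    unfolding subst_poly_def by (intro sum.cong refl arg_cong2[where f = "(*)"] prod.cong) simp
qed

lemma subst_poly_subst: "subst_poly f (subst_poly g p) = subst_poly (\<lambda>x. subst_poly f (g x)) p"
proof (induction p rule: cpoly_induct)
  case (single m c)
  then show ?case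
    by (simp add: subst_poly_single subst_poly_mult subst_poly_const mon_subst_def
        subst_poly_prod subst_poly_power)
qed (simp_all add: subst_poly_add)

lemma subst_poly_var_id: "subst_poly var_poly p = p"
proof (induction p rule: cpoly_induct)
  case (single m c)
  have pow: "var_poly x ^ k = Poly_Mapping.single (Poly_Mapping.single x k) 1" for x :: 'a and k
    by (induction k) (simp_all add: var_poly_def mult_single single_add[symmetric])
  have "(\<Prod>x\<in>A. Poly_Mapping.single (Poly_Mapping.single x (Poly_Mapping.lookup m x)) 1) =
      (Poly_Mapping.single (\<Sum>x\<in>A. Poly_Mapping.single x (Poly_Mapping.lookup m x)) 1 :: 'a cpoly)" for A
    by (induction A rule: infinite_finite_induct) (simp_all add: mult_single)
  moreover have "(\<Sum>x\<in>Poly_Mapping.keys m. Poly_Mapping.single x (Poly_Mapping.lookup m x)) = m"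
    by (rule poly_mapping_eqI)
       (auto simp: lookup_sum lookup_single when_def sum.delta in_keys_iff)
  ultimately show ?case
    by (simp add: subst_poly_single mon_subst_def pow const_poly_single)
qed (simp_all add: subst_poly_add)

lemma subst_poly_hpolys:
  assumes "p \<in> hpolys X w d" "\<And>x. x \<in> X \<Longrightarrow> f x \<in> hpolys Y w' (int (w x))"
  shows "subst_poly f p \<in> hpolys Y w' d"
  unfolding subst_poly_eq
proof (intro hpolys_sum hpolys_const_mult)
  fix m assume "m \<in> Poly_Mapping.keys p"
  then have m: "Poly_Mapping.keys m \<subseteq> X" "int (mon_weight w m) = d"
    using assms(1) by (auto simp: hpolys_def polys_def homogeneous_def)
  have pow: "f x ^ k \<in> hpolys Y w' (int (k * w x))" if "x \<in> X" for x k
  proof (induction k)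
    case (Suc k)
    then show ?case using hpolys_mult[OF assms(2)[OF that] Suc] by (simp add: algebra_simps)
  qed (use hpolys_const[of 1] in simp)
  have "mon_subst f m \<in> hpolys Y w' (\<Sum>x\<in>Poly_Mapping.keys m. int (Poly_Mapping.lookup m x * w x))"
    unfolding mon_subst_def using m by (intro hpolys_prod pow) auto
  then show "mon_subst f m \<in> hpolys Y w' d"
    unfolding m(2)[symmetric] mon_weight_def by simp
qed

lemma subst_poly_polys:
  assumes "p \<in> polys X" "\<And>x. x \<in> X \<Longrightarrow> f x \<in> polys Y"
  shows "subst_poly f p \<in> polys Y"
  unfolding subst_poly_def
  using assms by (intro polys_sum polys_mult polys_prod polys_power) (auto simp: polys_def[of X])

section \<open>Rings of invariants\<close>

text \<open>Sums of products are built one product at a time, so that homogeneous components, the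
  Reynolds operator and homotopies can be treated by induction on a single summand
  \<open>b * t\<close>.\<close>

inductive_set ideal_of :: "'x cpoly set \<Rightarrow> 'x set \<Rightarrow> 'x cpoly set" for H X where
  zero: "0 \<in> ideal_of H X"
| step: "b \<in> H \<Longrightarrow> t \<in> polys X \<Longrightarrow> s \<in> ideal_of H X \<Longrightarrow> b * t + s \<in> ideal_of H X"

lemma ideal_of_add:
  assumes "p \<in> ideal_of H X" "q \<in> ideal_of H X"
  shows "p + q \<in> ideal_of H X"
  using assms(1) by induction (simp_all add: assms(2) add.assoc ideal_of.step)

lemma ideal_of_mult:
  assumes "p \<in> ideal_of H X" "q \<in> polys X"
  shows "q * p \<in> ideal_of H X"
  using assms(1)
proof induction
  case (step b t s)
  have "q * (b * t + s) = b * (q * t) + q * s" by (simp add: algebra_simps)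
  then show ?case using step assms(2) by (simp add: ideal_of.step polys_mult)
qed (simp add: ideal_of.zero)

lemma ideal_of_base: "b \<in> H \<Longrightarrow> t \<in> polys X \<Longrightarrow> b * t \<in> ideal_of H X"
  using ideal_of.step[OF _ _ ideal_of.zero] by fastforce

lemma ideal_of_sum: "(\<And>i. i \<in> I \<Longrightarrow> f i \<in> ideal_of H X) \<Longrightarrow> (\<Sum>i\<in>I. f i) \<in> ideal_of H X"
  by (induction I rule: infinite_finite_induct) (auto intro: ideal_of.zero ideal_of_add)

lemma ideal_of_subset_polys: "H \<subseteq> polys X \<Longrightarrow> ideal_of H X \<subseteq> polys X"
proof
  fix p assume "H \<subseteq> polys X" "p \<in> ideal_of H X"
  from this(2) show "p \<in> polys X"
    by induction (use \<open>H \<subseteq> polys X\<close> in \<open>auto intro: polys_add polys_mult\<close>)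
qed

text \<open>Constants plus the ideal are closed under products, because
  \<open>f * h - c * c' = f * (h - c') + c' * (f - c)\<close>.\<close>

lemma subalgebra_generated_ideal_of:
  assumes "f \<in> subalgebra_generated E" "cpoly.span H = E" "H \<subseteq> polys X"
  shows "\<exists>c. f - const_poly c \<in> ideal_of H X"
  using assms(1)
proof induction
  case (base f)
  then have "f \<in> cpoly.span H" using assms(2) by simp
  then have "f \<in> ideal_of H X"
  proof (induction rule: cpoly.span_induct_alt)
    case (step c x y)
    then show ?case using ideal_of.step[of x H "const_poly c" X y] by (simp add: mult.commute)
  qed (simp add: ideal_of.zero)
  then show ?case by (intro exI[of _ 0]) simp
next
  case (const c)
  then show ?case by (intro exI[of _ c]) (simp add: ideal_of.zero)
next
  case (add f h)
  then obtain c c' where "f - const_poly c \<in> ideal_of H X" "h - const_poly c' \<in> ideal_of H X"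
    by blast
  from ideal_of_add[OF this] show ?case
    by (intro exI[of _ "c + c'"]) (simp add: const_poly_add algebra_simps)
next
  case (mult f h)
  then obtain c c' where f: "f - const_poly c \<in> ideal_of H X" and h: "h - const_poly c' \<in> ideal_of H X"
    by blast
  have "f = (f - const_poly c) + const_poly c" by simp
  then have "f \<in> polys X"
    using ideal_of_subset_polys[OF assms(3)] f by (metis polys_add polys_const subsetD)
  then have "f * (h - const_poly c') + const_poly c' * (f - const_poly c) \<in> ideal_of H X"
    by (intro ideal_of_add ideal_of_mult f h) simp_all
  moreover have "f * (h - const_poly c') + const_poly c' * (f - const_poly c) =
      f * h - const_poly (c * c')"
    by (simp add: const_poly_mult algebra_simps)
  ultimately show ?case by metis
qed

lemma subalgebra_generated_mono: "E \<subseteq> E' \<Longrightarrow> subalgebra_generated E \<subseteq> subalgebra_generated E'"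
proof
  fix p assume "E \<subseteq> E'" "p \<in> subalgebra_generated E"
  from this(2) show "p \<in> subalgebra_generated E'"
    by induction (use \<open>E \<subseteq> E'\<close> in \<open>auto intro: subalgebra_generated.intros\<close>)
qed

lemma hpolys_deg1_0:
  assumes "p \<in> hpolys X (\<lambda>_. 1) 0"
  shows "p = const_poly (Poly_Mapping.lookup p 0)"
proof (rule poly_mapping_eqI)
  fix m
  have "m = 0" if "Poly_Mapping.lookup p m \<noteq> 0"
  proof -
    have "mon_weight (\<lambda>_. 1) m = 0"
      using assms that by (auto simp: hpolys_def homogeneous_def in_keys_iff)
    then have "Poly_Mapping.lookup m x = 0" for x
      by (cases "x \<in> Poly_Mapping.keys m") (auto simp: mon_weight_def in_keys_iff)
    then show "m = 0" by (intro poly_mapping_eqI) simp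
  qed
  then show "Poly_Mapping.lookup p m = Poly_Mapping.lookup (const_poly (Poly_Mapping.lookup p 0)) m"
    by (auto simp: const_poly_def lookup_single when_def)
qed

lemma hpolys_var_deg1 [simp]: "x \<in> X \<Longrightarrow> var_poly x \<in> hpolys X (\<lambda>_. Suc 0) 1"
  using hpolys_var[of x X "\<lambda>_. 1"] by simp

lemma monomial_factor:
  assumes "k \<le> mon_weight (\<lambda>_. 1) m"
  shows "\<exists>xs m'. length xs = k \<and> set xs \<subseteq> Poly_Mapping.keys m \<and> Poly_Mapping.keys m' \<subseteq> Poly_Mapping.keys m \<and>
    Poly_Mapping.single m 1 = prod_list (map var_poly xs) * Poly_Mapping.single m' (1 :: complex)"
  using assms
proof (induction k arbitrary: m)
  case (Suc k)
  then have "mon_weight (\<lambda>_. 1) m \<noteq> 0" by simp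
  then obtain x where x: "x \<in> Poly_Mapping.keys m"
    unfolding mon_weight_def by (metis (no_types, lifting) sum.neutral ex_in_conv empty_iff)
  define m1 where "m1 = m - Poly_Mapping.single x 1"
  have m: "m = Poly_Mapping.single x 1 + m1"
    unfolding m1_def using x
    by (intro poly_mapping_eqI) (auto simp: lookup_add lookup_minus lookup_single when_def in_keys_iff)
  have "k \<le> mon_weight (\<lambda>_. 1) m1"
    using Suc.prems unfolding m mon_weight_add by (simp add: mon_weight_single)
  from Suc.IH[OF this] obtain xs m' where *: "length xs = k" "set xs \<subseteq> Poly_Mapping.keys m1"
    "Poly_Mapping.keys m' \<subseteq> Poly_Mapping.keys m1"
    "Poly_Mapping.single m1 1 = prod_list (map var_poly xs) * Poly_Mapping.single m' (1 :: complex)"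
    by blast
  have "Poly_Mapping.single m (1 :: complex) = var_poly x * Poly_Mapping.single m1 1"
    by (simp add: m var_poly_def mult_single)
  moreover have "Poly_Mapping.keys m = insert x (Poly_Mapping.keys m1)"
    unfolding m keys_add_nat by simp
  ultimately show ?case
    by (intro exI[of _ "x # xs"] exI[of _ m']) (use * in \<open>auto simp: mult.assoc\<close>)
next
  case 0
  show ?case by (intro exI[of _ "[]"] exI[of _ m]) simp
qed

lemma finite_monomials:
  assumes "finite X"
  shows "finite {m. Poly_Mapping.keys m \<subseteq> X \<and> mon_weight (\<lambda>_. 1) m \<le> k}"
proof (rule inj_on_finite)
  let ?S = "{m. Poly_Mapping.keys m \<subseteq> X \<and> mon_weight (\<lambda>_. 1) m \<le> k}"
  show "finite (PiE X (\<lambda>_. {..k}))" using assms by (intro finite_PiE) auto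
  show "inj_on (\<lambda>m. restrict (Poly_Mapping.lookup m) X) ?S"
  proof (rule inj_onI, rule poly_mapping_eqI)
    fix m m' x
    assume m: "m \<in> ?S" "m' \<in> ?S"
      and eq: "restrict (Poly_Mapping.lookup m) X = restrict (Poly_Mapping.lookup m') X"
    show "Poly_Mapping.lookup m x = Poly_Mapping.lookup m' x"
    proof (cases "x \<in> X")
      case True
      then show ?thesis using fun_cong[OF eq, of x] by simp
    next
      case False
      then have "x \<notin> Poly_Mapping.keys m" "x \<notin> Poly_Mapping.keys m'" using m by auto
      then show ?thesis by (simp add: in_keys_iff)
    qed
  qed
  show "(\<lambda>m. restrict (Poly_Mapping.lookup m) X) ` ?S \<subseteq> PiE X (\<lambda>_. {..k})"
  proof safe
    fix m x
    assume m: "Poly_Mapping.keys m \<subseteq> X" "mon_weight (\<lambda>_. 1) m \<le> k" "x \<in> X"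
    have "Poly_Mapping.lookup m x \<le> mon_weight (\<lambda>_. 1) m"
      unfolding mon_weight_def
      by (cases "x \<in> Poly_Mapping.keys m") (auto intro: member_le_sum simp: in_keys_iff)
    then show "restrict (Poly_Mapping.lookup m) X x \<le> k" using m by simp
  qed auto
qed

lemma total_deg_homogeneous:
  assumes "homogeneous (\<lambda>_. 1) d p" "p \<noteq> 0"
  shows "int (total_deg p) = d"
proof -
  have "Poly_Mapping.keys p \<noteq> {}"
    using assms(2) by (metis cpoly_sum_keys sum.empty)
  then obtain m where m: "m \<in> Poly_Mapping.keys p" by blast
  then have "mon_weight (\<lambda>_. 1) ` Poly_Mapping.keys p = {nat d}"
    using assms(1) by (force simp: homogeneous_def)
  moreover have "d \<ge> 0" using m assms(1) by (force simp: homogeneous_def)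
  ultimately show ?thesis by (simp add: total_deg_def)
qed

section \<open>The group action and the Reynolds operator\<close>

locale finite_representation = group G for G :: "('g, 'm) monoid_scheme" (structure) +
  fixes n :: nat and \<rho> :: "'g \<Rightarrow> complex mat"
  assumes fin: "finite (carrier G)" and rep: "representation G n \<rho>"
begin

abbreviation "R \<equiv> invariants G n \<rho>"

abbreviation "T \<equiv> polys {..<n}"

abbreviation "Th \<equiv> hpolys {..<n} (\<lambda>_. 1)"

definition act :: "'g \<Rightarrow> nat cpoly \<Rightarrow> nat cpoly" where
  "act x = sym_act n (\<rho> x)"

lemma act_eq: "act x = subst_poly (\<lambda>j. \<Sum>i<n. const_poly (\<rho> x $$ (i, j)) * var_poly i)"
  by (simp add: act_def sym_act_def fun_eq_iff)

lemma order_pos: "order G > 0"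
  using fin one_closed by (auto simp: order_def card_gt_0_iff)

lemma act_add: "act x (p + q) = act x p + act x q"
  by (simp add: act_eq subst_poly_add)

lemma act_mult: "act x (p * q) = act x p * act x q"
  by (simp add: act_eq subst_poly_mult)

lemma act_const: "act x (const_poly c) = const_poly c"
  by (simp add: act_eq subst_poly_const)

lemma act_prod: "act x (\<Prod>i\<in>I. f i) = (\<Prod>i\<in>I. act x (f i))"
  by (simp add: act_eq subst_poly_prod)

lemma act_sum: "act x (\<Sum>i\<in>I. f i) = (\<Sum>i\<in>I. act x (f i))"
  by (simp add: act_eq subst_poly_sum)

lemma act_hpolys: "p \<in> Th d \<Longrightarrow> act x p \<in> Th d"
  unfolding act_eq by (erule subst_poly_hpolys) (auto intro!: hpolys_sum hpolys_const_mult hpolys_var)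

lemma act_polys: "p \<in> T \<Longrightarrow> act x p \<in> T"
  unfolding act_eq by (erule subst_poly_polys) (auto intro!: polys_sum polys_mult)

lemma act_act:
  assumes "p \<in> T" "x \<in> carrier G" "y \<in> carrier G"
  shows "act x (act y p) = act (x \<otimes> y) p"
  unfolding act_eq subst_poly_subst
proof (rule subst_poly_cong[OF assms(1)])
  fix j assume "j \<in> {..<n}"
  have mat: "\<rho> x \<in> carrier_mat n n" "\<rho> y \<in> carrier_mat n n" "\<rho> (x \<otimes> y) = \<rho> x * \<rho> y"
    using rep assms by (auto simp: representation_def)
  have "subst_poly (\<lambda>j. \<Sum>i<n. const_poly (\<rho> x $$ (i, j)) * var_poly i)
      (\<Sum>i<n. const_poly (\<rho> y $$ (i, j)) * var_poly i) =
      (\<Sum>i<n. \<Sum>k<n. const_poly (\<rho> y $$ (i, j)) * (const_poly (\<rho> x $$ (k, i)) * var_poly k))"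
    by (simp add: subst_poly_sum subst_poly_mult subst_poly_const subst_poly_var sum_distrib_left)
  also have "\<dots> = (\<Sum>k<n. \<Sum>i<n. const_poly (\<rho> y $$ (i, j)) * (const_poly (\<rho> x $$ (k, i)) * var_poly k))"
    by (rule sum.swap)
  also have "\<dots> = (\<Sum>k<n. const_poly (\<rho> (x \<otimes> y) $$ (k, j)) * var_poly k)"
  proof (rule sum.cong)
    fix k assume "k \<in> {..<n}"
    then have "\<rho> (x \<otimes> y) $$ (k, j) = (\<Sum>i<n. \<rho> x $$ (k, i) * \<rho> y $$ (i, j))"
      using mat \<open>j \<in> {..<n}\<close> by (simp add: scalar_prod_def atLeast0LessThan)
    then show "(\<Sum>i<n. const_poly (\<rho> y $$ (i, j)) * (const_poly (\<rho> x $$ (k, i)) * var_poly k)) =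
        const_poly (\<rho> (x \<otimes> y) $$ (k, j)) * var_poly k"
      by (simp add: const_poly_sum const_poly_mult sum_distrib_right sum_distrib_left mult_ac)
  qed simp
  finally show "subst_poly (\<lambda>j. \<Sum>i<n. const_poly (\<rho> x $$ (i, j)) * var_poly i)
      (\<Sum>i<n. const_poly (\<rho> y $$ (i, j)) * var_poly i) =
      (\<Sum>i<n. const_poly (\<rho> (x \<otimes> y) $$ (i, j)) * var_poly i)" .
qed

lemma act_one:
  assumes "p \<in> T"
  shows "act \<one> p = p"
proof -
  have "act \<one> p = subst_poly var_poly p"
    unfolding act_eq
  proof (rule subst_poly_cong[OF assms])
    fix j assume "j \<in> {..<n}"
    have "(\<Sum>i<n. const_poly (\<rho> \<one> $$ (i, j)) * var_poly i) = (\<Sum>i<n. if i = j then var_poly i else 0)"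
      using rep \<open>j \<in> {..<n}\<close> by (intro sum.cong) (auto simp: representation_def)
    then show "(\<Sum>i<n. const_poly (\<rho> \<one> $$ (i, j)) * var_poly i) = var_poly j"
      using \<open>j \<in> {..<n}\<close> by simp
  qed
  then show ?thesis by (simp add: subst_poly_var_id)
qed

lemma invariants_iff: "f \<in> R \<longleftrightarrow> f \<in> T \<and> (\<forall>x\<in>carrier G. act x f = f)"
  by (auto simp: invariants_def act_def)

lemma invariants_polys: "f \<in> R \<Longrightarrow> f \<in> T"
  by (simp add: invariants_iff)

lemma invariants_mult: "f \<in> R \<Longrightarrow> h \<in> R \<Longrightarrow> f * h \<in> R"
  by (simp add: invariants_iff polys_mult act_mult)

lemma invariants_const: "const_poly c \<in> R"
  by (simp add: invariants_iff act_const)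

lemma sum_act_invariant:
  assumes "f \<in> T"
  shows "(\<Sum>x\<in>carrier G. act x f) \<in> R"
  unfolding invariants_iff
proof (intro conjI ballI)
  show "(\<Sum>x\<in>carrier G. act x f) \<in> T" by (intro polys_sum act_polys assms)
  fix y assume y: "y \<in> carrier G"
  have "act y (\<Sum>x\<in>carrier G. act x f) = (\<Sum>x\<in>carrier G. act (y \<otimes> x) f)"
    unfolding act_sum by (intro sum.cong refl act_act assms y)
  also have "\<dots> = (\<Sum>x\<in>carrier G. act x f)"
  proof (rule sum.reindex_bij_witness[of _ "\<lambda>x. inv y \<otimes> x" "\<lambda>x. y \<otimes> x"])
  qed (use y in \<open>auto simp: m_assoc[symmetric]\<close>)
  finally show "act y (\<Sum>x\<in>carrier G. act x f) = (\<Sum>x\<in>carrier G. act x f)" .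
qed

definition reynolds :: "nat cpoly \<Rightarrow> nat cpoly" where
  "reynolds f = const_poly (1 / of_nat (order G)) * (\<Sum>x\<in>carrier G. act x f)"

lemma reynolds_invariant: "f \<in> T \<Longrightarrow> reynolds f \<in> R"
  unfolding reynolds_def by (intro invariants_mult invariants_const sum_act_invariant)

lemma reynolds_add: "reynolds (f + h) = reynolds f + reynolds h"
  by (simp add: reynolds_def act_add sum.distrib distrib_left)

lemma reynolds_mult: "b \<in> R \<Longrightarrow> reynolds (b * f) = b * reynolds f"
  by (simp add: reynolds_def act_mult invariants_iff sum_distrib_left mult_ac)

lemma reynolds_zero: "reynolds 0 = 0"
  by (simp add: reynolds_def act_eq)

lemma reynolds_uminus: "reynolds (- f) = - reynolds f"
  using reynolds_add[of f "- f"] by (simp add: reynolds_zero add_eq_0_iff2)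

lemma reynolds_sum: "reynolds (\<Sum>i\<in>I. f i) = (\<Sum>i\<in>I. reynolds (f i))"
  by (induction I rule: infinite_finite_induct) (simp_all add: reynolds_add reynolds_zero)

lemma reynolds_id: "f \<in> R \<Longrightarrow> reynolds f = f"
proof -
  assume "f \<in> R"
  then have "reynolds f = const_poly (1 / of_nat (order G)) * (of_nat (order G) * f)"
    by (simp add: reynolds_def invariants_iff order_def)
  also have "\<dots> = const_poly (1 / of_nat (order G) * of_nat (order G)) * f"
    by (simp only: const_poly_mult const_poly_of_nat mult.assoc)
  finally show ?thesis using order_pos by simp
qed

lemma reynolds_hpolys: "f \<in> Th d \<Longrightarrow> reynolds f \<in> Th d"
  unfolding reynolds_def by (intro hpolys_const_mult hpolys_sum act_hpolys)

text \<open>The ideal they generate contains all forms of degree at least \<open>order G\<close>;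
  the degree bound for algebra generators is deduced from this.\<close>

definition low_invariants :: "nat cpoly set" where
  "low_invariants = {f \<in> R. \<exists>d. 1 \<le> d \<and> d \<le> int (order G) \<and> f \<in> Th d}"

section \<open>Products of linear forms lie in the ideal of low invariants\<close>

text \<open>
  Benson's argument: for every \<open>\<sigma>\<close> the product over \<open>x\<close> of \<open>\<sigma> x u\<^sub>x - u\<^sub>x\<close> contains the vanishing
  factor \<open>x = \<sigma>\<^sup>-\<^sup>1\<close>. Expand it and sum over \<open>\<sigma>\<close>.
\<close>

lemma prod_linear_forms_in_ideal:
  assumes u: "\<And>x. x \<in> carrier G \<Longrightarrow> u x \<in> Th 1"
  shows "(\<Prod>x\<in>carrier G. u x) \<in> ideal_of low_invariants {..<n}"
proof -
  let ?C = "carrier G"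
  define P where "P A = (\<Prod>x\<in>A. act x (u x))" for A
  define F where "F A = (\<Sum>s\<in>?C. act s (P A))" for A
  define N where "N A = (\<Prod>x\<in>?C - A. - u x)" for A
  have uT: "u x \<in> T" if "x \<in> ?C" for x using u[OF that] hpolysD by blast
  \<comment> \<open>A nonempty \<open>A\<close> gives a sum over the group of products of
    \<open>card A\<close> linear forms: an invariant whose degree lies between 1 and
    \<open>order G\<close>.\<close>
  have F: "F A \<in> low_invariants" if "A \<in> Pow ?C - {{}}" for A
  proof -
    have A: "A \<subseteq> ?C" "A \<noteq> {}" "finite A" using that fin finite_subset by auto
    have "P A \<in> Th (\<Sum>x\<in>A. 1)"
      unfolding P_def using A by (intro hpolys_prod act_hpolys u) auto
    then have P: "P A \<in> Th (int (card A))" by simp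
    have "F A \<in> Th (int (card A))" unfolding F_def by (intro hpolys_sum act_hpolys P)
    moreover have "F A \<in> R" unfolding F_def by (intro sum_act_invariant hpolysD(1)[OF P])
    moreover have "1 \<le> card A" using A by (simp add: Suc_le_eq card_gt_0_iff)
    moreover have "card A \<le> order G" unfolding order_def by (intro card_mono fin A)
    ultimately show ?thesis
      unfolding low_invariants_def by (intro CollectI conjI exI[of _ "int (card A)"]) simp_all
  qed
  have "(\<Sum>A\<in>Pow ?C. F A * N A) = (\<Sum>s\<in>?C. \<Sum>A\<in>Pow ?C. act s (P A) * N A)"
    unfolding F_def sum_distrib_right by (rule sum.swap)
  also have "\<dots> = (\<Sum>s\<in>?C. \<Prod>x\<in>?C. act (s \<otimes> x) (u x) + - u x)"
  proof (rule sum.cong[OF refl])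
    fix s assume s: "s \<in> ?C"
    have "act s (P A) = (\<Prod>x\<in>A. act (s \<otimes> x) (u x))" if "A \<in> Pow ?C" for A
      unfolding P_def act_prod using that by (intro prod.cong refl act_act uT s) auto
    then show "(\<Sum>A\<in>Pow ?C. act s (P A) * N A) = (\<Prod>x\<in>?C. act (s \<otimes> x) (u x) + - u x)"
      unfolding prod_add[OF fin] N_def by (intro sum.cong refl) simp
  qed
  also have "\<dots> = 0"
  proof (rule sum.neutral, rule ballI)
    fix s assume s: "s \<in> ?C"
    have "act (s \<otimes> inv s) (u (inv s)) + - u (inv s) = 0"
      using s act_one[OF uT] by simp
    then show "(\<Prod>x\<in>?C. act (s \<otimes> x) (u x) + - u x) = 0"
      using fin s by (metis (no_types, lifting) inv_closed prod_zero)
  qed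
  finally have "F {} * N {} + (\<Sum>A\<in>Pow ?C - {{}}. F A * N A) = 0"
    using fin by (subst (asm) sum.remove[of _ "{}"]) auto
  then have eq: "F {} * N {} = (\<Sum>A\<in>Pow ?C - {{}}. F A * (- N A))"
    by (simp add: sum_negf eq_neg_iff_add_eq_0)
  have N: "N A \<in> T" for A unfolding N_def by (intro polys_prod polys_uminus uT) auto
  have "F {} * N {} \<in> ideal_of low_invariants {..<n}"
    unfolding eq by (intro ideal_of_sum ideal_of_base F polys_uminus N)
  \<comment> \<open>The summand of the empty set is the product of the \<open>u x\<close> times this
    constant, which is invertible in characteristic 0.\<close>
  moreover define k where "k = of_nat (order G) * (- 1 :: complex) ^ order G"
  have F0: "F {} = const_poly (of_nat (order G))"
    by (simp add: F_def P_def act_eq order_def const_poly_of_nat)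
  have N0: "N {} = const_poly ((- 1) ^ order G) * (\<Prod>x\<in>?C. u x)"
  proof -
    have "N {} = (\<Prod>x\<in>?C. const_poly (- 1) * u x)"
      by (simp add: N_def const_poly_uminus)
    also have "\<dots> = const_poly (- 1) ^ order G * (\<Prod>x\<in>?C. u x)"
      by (simp only: prod.distrib prod_constant order_def)
    also have "const_poly (- 1) ^ k = const_poly ((- 1) ^ k)" for k
      by (induction k) (simp_all add: const_poly_uminus)
    finally show ?thesis .
  qed
  have "F {} * N {} = const_poly k * (\<Prod>x\<in>?C. u x)"
    by (simp only: F0 N0 k_def const_poly_mult mult.assoc)
  ultimately have "const_poly k * (\<Prod>x\<in>?C. u x) \<in> ideal_of low_invariants {..<n}"
    by (simp only:)
  then have "const_poly (1 / k) * (const_poly k * (\<Prod>x\<in>?C. u x)) \<in> ideal_of low_invariants {..<n}"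
    by (rule ideal_of_mult) simp
  moreover have "k \<noteq> 0" using order_pos by (simp add: k_def)
  then have "const_poly (1 / k) * const_poly k = (1 :: nat cpoly)"
    by (simp only: const_poly_mult[symmetric]) simp
  ultimately show ?thesis by (simp only: mult.assoc[symmetric]) simp
qed

lemma prod_vars_in_ideal:
  assumes "length ks = order G" "set ks \<subseteq> {..<n}"
  shows "prod_list (map var_poly ks) \<in> ideal_of low_invariants {..<n}"
proof -
  obtain h where h: "bij_betw h (carrier G) {0..<order G}"
    using ex_bij_betw_finite_nat[OF fin] unfolding order_def by blast
  have "prod_list (map var_poly ks) = (\<Prod>i = 0..<order G. var_poly (ks ! i) :: nat cpoly)"
    using assms(1) by (simp add: prod.list_conv_set_nth)
  also have "\<dots> = (\<Prod>x\<in>carrier G. var_poly (ks ! h x))"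
    by (rule prod.reindex_bij_betw[OF h, symmetric])
  also have "\<dots> \<in> ideal_of low_invariants {..<n}"
  proof (rule prod_linear_forms_in_ideal)
    fix x assume "x \<in> carrier G"
    then have "h x < order G" using h by (auto simp: bij_betw_def)
    then have "ks ! h x \<in> set ks" using assms(1) by simp
    then have "ks ! h x \<in> {..<n}" using assms(2) by blast
    then show "var_poly (ks ! h x) \<in> Th 1" by simp
  qed
  finally show ?thesis .
qed

lemma hpolys_in_ideal:
  assumes "p \<in> Th d" "int (order G) \<le> d"
  shows "p \<in> ideal_of low_invariants {..<n}"
proof -
  have "Poly_Mapping.single m c \<in> ideal_of low_invariants {..<n}"
    if "m \<in> Poly_Mapping.keys p" for m c
  proof -
    have m: "Poly_Mapping.keys m \<subseteq> {..<n}" "order G \<le> mon_weight (\<lambda>_. 1) m"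
      using assms that by (force simp: hpolys_def polys_def homogeneous_def)+
    obtain xs m' where xs: "length xs = order G" "set xs \<subseteq> {..<n}" "Poly_Mapping.keys m' \<subseteq> {..<n}"
      "Poly_Mapping.single m 1 = prod_list (map var_poly xs) * Poly_Mapping.single m' (1 :: complex)"
      using monomial_factor[OF m(2)] m(1) by blast
    have "Poly_Mapping.single m c = const_poly c * Poly_Mapping.single m' 1 * prod_list (map var_poly xs)"
      using arg_cong[OF xs(4), of "(*) (const_poly c)"] by (simp add: const_poly_single mult_ac)
    then show ?thesis
      using xs by (auto intro!: ideal_of_mult prod_vars_in_ideal simp: const_poly_single)
  qed
  then have "(\<Sum>m\<in>Poly_Mapping.keys p. Poly_Mapping.single m (Poly_Mapping.lookup p m))
      \<in> ideal_of low_invariants {..<n}"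
    by (intro ideal_of_sum) simp
  then show ?thesis by (simp only: cpoly_sum_keys)
qed

section \<open>Noether's degree bound for minimal generators\<close>

text \<open>
  Applying the Reynolds operator to an expression \<open>f = \<Sum> b t\<^sub>b\<close> replaces the coefficients \<open>t\<^sub>b\<close> by
  invariants of smaller degree than \<open>f\<close>.
\<close>

lemma invariant_in_subalgebra_step:
  assumes f: "f \<in> R" "f \<in> Th e" and e: "0 < e"
    and ideal: "f - const_poly c \<in> ideal_of H {..<n}"
    and H: "\<And>b. b \<in> H \<Longrightarrow> b \<in> R \<and> (\<exists>d\<ge>1. b \<in> Th d \<and> (d \<le> e \<longrightarrow> b \<in> subalgebra_generated E))"
    and IH: "\<And>h d. h \<in> R \<Longrightarrow> h \<in> Th d \<Longrightarrow> d < e \<Longrightarrow> h \<in> subalgebra_generated E"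
  shows "f \<in> subalgebra_generated E"
proof -
  have zero: "0 \<in> subalgebra_generated E"
    using subalgebra_generated.const[of 0] by simp
  have "reynolds (hcomp (\<lambda>_. 1) e s) \<in> subalgebra_generated E" if "s \<in> ideal_of H {..<n}" for s
    using that
  proof induction
    case (step b t s)
    obtain d where d: "d \<ge> 1" "b \<in> Th d" "d \<le> e \<longrightarrow> b \<in> subalgebra_generated E" and b: "b \<in> R"
      using H step.hyps by blast
    have t: "hcomp (\<lambda>_. 1) (e - d) t \<in> Th (e - d)" by (rule hcomp_hpolys) (rule step.hyps)
    have "hcomp (\<lambda>_. 1) e (b * t + s) = b * hcomp (\<lambda>_. 1) (e - d) t + hcomp (\<lambda>_. 1) e s"
      by (simp only: hcomp_add hcomp_mult[OF hpolysD(2)[OF d(2)]])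
    then have eq: "reynolds (hcomp (\<lambda>_. 1) e (b * t + s)) =
        b * reynolds (hcomp (\<lambda>_. 1) (e - d) t) + reynolds (hcomp (\<lambda>_. 1) e s)"
      by (simp add: reynolds_add reynolds_mult[OF b])
    show ?case
    proof (cases "d \<le> e")
      case True
      have "reynolds (hcomp (\<lambda>_. 1) (e - d) t) \<in> subalgebra_generated E"
        using t d(1) by (intro IH[of _ "e - d"] reynolds_invariant reynolds_hpolys hpolysD(1)[OF t]) auto
      then show ?thesis
        unfolding eq using d(3) True step.IH
        by (intro subalgebra_generated.add subalgebra_generated.mult) auto
    next
      case False
      then have "hcomp (\<lambda>_. 1) (e - d) t = 0" using hpolys_negative[OF t] by simp
      then show ?thesis unfolding eq using step.IH by (simp add: reynolds_zero)
    qed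
  qed (simp add: reynolds_zero zero)
  from this[OF ideal] have "reynolds (hcomp (\<lambda>_. 1) e (f - const_poly c)) \<in> subalgebra_generated E" .
  \<comment> \<open>Since \<open>e > 0\<close>, the constant \<open>c\<close> has no component of
    degree \<open>e\<close>.\<close>
  moreover have "hcomp (\<lambda>_. 1) e (f - const_poly c) = f"
  proof -
    have "hcomp (\<lambda>_. 1) e (const_poly c :: nat cpoly) = 0"
      using e by (simp add: const_poly_def hcomp_single)
    moreover have "hcomp (\<lambda>_. 1) e f = f" by (rule hcomp_homogeneous[OF hpolysD(2)[OF f(2)]])
    moreover have "f = (f - const_poly c) + const_poly c" by simp
    ultimately show ?thesis by (metis hcomp_add add.right_neutral)
  qed
  ultimately show ?thesis by (simp add: reynolds_id[OF f(1)])
qed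

text \<open>The part \<open>E'\<close> of degree at most \<open>order G\<close> already generates
  \<open>R\<close>, so minimality forces \<open>E' = E\<close>. For generation, induct on the degree
  \<open>e\<close> of an invariant. Up to \<open>order G\<close>, expand it in generators from
  \<open>E\<close>; those of degree above \<open>e\<close> drop out, the others lie in
  \<open>E'\<close>. Above \<open>order G\<close>, expand it in low invariants, which have smaller
  degree than \<open>e\<close>.\<close>

lemma minimal_generating_subspace_low:
  assumes E: "minimal_generating_subspace R E"
  shows "cpoly.span {f \<in> E. \<exists>d \<le> int (order G). homogeneous (\<lambda>_. 1) d f} = E"
proof -
  define H where "H = {f \<in> E. \<exists>d. homogeneous (\<lambda>_. 1) d f}"
  define H' where "H' = {f \<in> E. \<exists>d \<le> int (order G). homogeneous (\<lambda>_. 1) d f}"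
  define E' where "E' = cpoly.span H'"
  have gen: "generating_subspace R E" using E by (simp add: minimal_generating_subspace_def)
  then have sub: "cpoly.subspace E" and span: "cpoly.span H = E" and alg: "subalgebra_generated E = R"
    and pos: "E \<subseteq> {f \<in> R. \<forall>m\<in>Poly_Mapping.keys f. mon_weight (\<lambda>_. 1) m > 0}"
    by (auto simp: generating_subspace_def homogeneous_subspace_def H_def)
  have E'E: "E' \<subseteq> E"
    unfolding E'_def using sub by (intro cpoly.span_minimal) (auto simp: H'_def)
  have H'E': "H' \<subseteq> E'" unfolding E'_def by (rule cpoly.span_superset)
  have H: "b \<in> R \<and> (\<exists>d\<ge>1. b \<in> Th d \<and> (d \<le> int (order G) \<longrightarrow> b \<in> E'))" if bH: "b \<in> H" for b
  proof (cases "b = 0")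
    \<comment> \<open>Zero is homogeneous of every degree; degree 1 is chosen for it.\<close>
    case True
    then show ?thesis
      unfolding E'_def using invariants_const[of 0] by (auto intro!: exI[of _ 1] cpoly.span_zero)
  next
    case False
    then have "Poly_Mapping.keys b \<noteq> {}" by (metis cpoly_sum_keys sum.empty)
    then obtain m where m: "m \<in> Poly_Mapping.keys b" by blast
    obtain d where d: "homogeneous (\<lambda>_. 1) d b" and bE: "b \<in> E" using bH by (auto simp: H_def)
    have bR: "b \<in> R" using bE pos by blast
    have "mon_weight (\<lambda>_. 1) m > 0" using m bE pos by blast
    moreover have "int (mon_weight (\<lambda>_. 1) m) = d" using m d by (simp add: homogeneous_def)
    ultimately have "d \<ge> 1" by simp
    moreover have "b \<in> Th d" using d invariants_polys[OF bR] by (simp add: hpolys_def)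
    moreover have "b \<in> E'" if "d \<le> int (order G)"
      using H'E' bE d that by (auto simp: H'_def)
    ultimately show ?thesis using bR by blast
  qed
  have claim: "f \<in> subalgebra_generated E'" if "f \<in> R" "f \<in> Th (int e)" for e f
    using that
  proof (induction e arbitrary: f rule: less_induct)
    case (less e)
    have IH: "h \<in> subalgebra_generated E'" if "h \<in> R" "h \<in> Th d" "d < int e" for h d
    proof (cases "d < 0")
      case True
      then show ?thesis
        using hpolys_negative[OF that(2)] subalgebra_generated.const[of 0] by simp
    next
      case False
      then show ?thesis using less.IH[of "nat d" h] that by simp
    qed
    consider "e = 0" | "0 < e" "e \<le> order G" | "order G < e" by linarith
    then show ?case
    proof cases
      case 1
      then show ?thesis
        using hpolys_deg1_0[of f] less.prems subalgebra_generated.const by (metis of_nat_0)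
    next
      case 2
      have "f \<in> subalgebra_generated E" using less.prems alg by simp
      moreover have "H \<subseteq> T" using H invariants_polys by blast
      ultimately obtain c where c: "f - const_poly c \<in> ideal_of H {..<n}"
        using subalgebra_generated_ideal_of span by blast
      show ?thesis
      proof (rule invariant_in_subalgebra_step[OF less.prems _ c _ IH])
        show "b \<in> R \<and> (\<exists>d\<ge>1. b \<in> Th d \<and> (d \<le> int e \<longrightarrow> b \<in> subalgebra_generated E'))"
          if "b \<in> H" for b
          using H[OF that] 2 subalgebra_generated.base[of b E'] by force
      qed (use 2 in auto)
    next
      case 3
      have "f - const_poly 0 \<in> ideal_of low_invariants {..<n}"
        using hpolys_in_ideal[OF less.prems(2)] 3 by simp
      then show ?thesis
      proof (rule invariant_in_subalgebra_step[OF less.prems, rotated])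
        show "b \<in> R \<and> (\<exists>d\<ge>1. b \<in> Th d \<and> (d \<le> int e \<longrightarrow> b \<in> subalgebra_generated E'))"
          if "b \<in> low_invariants" for b
          using that IH[of b] 3 by (force simp: low_invariants_def)
      qed (use 3 IH in auto)
    qed
  qed
  have "E \<subseteq> subalgebra_generated E'"
  proof
    fix f assume "f \<in> E"
    then have "f \<in> cpoly.span H" using span by simp
    then show "f \<in> subalgebra_generated E'"
    proof (induction rule: cpoly.span_induct_alt)
      case base
      then show ?case using subalgebra_generated.const[of 0] by simp
    next
      case (step c x y)
      obtain d where "d \<ge> 1" "x \<in> Th d" "x \<in> R" using H[OF step.hyps(1)] by blast
      then have "x \<in> subalgebra_generated E'" using claim[of x "nat d"] by simp
      then show ?case
        using step.IH
        by (intro subalgebra_generated.add subalgebra_generated.mult subalgebra_generated.const)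
    qed
  qed
  have "f \<in> subalgebra_generated E'" if "f \<in> R" for f
  proof -
    have "f \<in> subalgebra_generated E" using that alg by simp
    then show ?thesis
      by induction (use \<open>E \<subseteq> subalgebra_generated E'\<close> in \<open>auto intro: subalgebra_generated.intros\<close>)
  qed
  moreover have "subalgebra_generated E' \<subseteq> R"
    using subalgebra_generated_mono[OF E'E] alg by simp
  ultimately have "subalgebra_generated E' = R" by blast
  moreover have "homogeneous_subspace E'"
    unfolding homogeneous_subspace_def
  proof
    show "cpoly.subspace E'" unfolding E'_def by (rule cpoly.subspace_span)
    have "H' \<subseteq> {f \<in> E'. \<exists>d. homogeneous (\<lambda>_. 1) d f}" using H'E' by (auto simp: H'_def)
    then have "E' \<subseteq> cpoly.span {f \<in> E'. \<exists>d. homogeneous (\<lambda>_. 1) d f}"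
      unfolding E'_def by (rule cpoly.span_mono)
    moreover have "cpoly.span {f \<in> E'. \<exists>d. homogeneous (\<lambda>_. 1) d f} \<subseteq> E'"
      by (intro cpoly.span_minimal \<open>cpoly.subspace E'\<close>) auto
    ultimately show "cpoly.span {f \<in> E'. \<exists>d. homogeneous (\<lambda>_. 1) d f} = E'" by blast
  qed
  ultimately have "generating_subspace R E'"
    using E'E pos by (auto simp: generating_subspace_def)
  then show ?thesis
    using E E'E unfolding minimal_generating_subspace_def E'_def H'_def by blast
qed

end

locale minimal_basis = finite_representation +
  fixes E B :: "nat cpoly set"
  assumes E: "minimal_generating_subspace R E" and B: "homogeneous_basis E B"
begin

lemma span_B: "cpoly.span B = E" and independent_B: "\<not> cpoly.dependent B"
  using B by (auto simp: homogeneous_basis_def)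

lemma basis_element:
  assumes "b \<in> B"
  shows "b \<in> R" "b \<in> Th (int (total_deg b))" "1 \<le> total_deg b" "total_deg b \<le> order G"
proof -
  have gen: "generating_subspace R E" using E by (simp add: minimal_generating_subspace_def)
  have bE: "b \<in> E" using B assms by (auto simp: homogeneous_basis_def)
  then show bR: "b \<in> R" using gen by (auto simp: generating_subspace_def)
  have pos: "mon_weight (\<lambda>_. 1) m > 0" if "m \<in> Poly_Mapping.keys b" for m
    using gen bE that by (auto simp: generating_subspace_def)
  have b0: "b \<noteq> 0" using independent_B assms cpoly.dependent_zero by blast
  then have "Poly_Mapping.keys b \<noteq> {}" by (metis cpoly_sum_keys sum.empty)
  then obtain m where m: "m \<in> Poly_Mapping.keys b" by blast
  obtain d where d: "homogeneous (\<lambda>_. 1) d b" using B assms by (auto simp: homogeneous_basis_def)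
  have deg: "homogeneous (\<lambda>_. 1) (int (total_deg b)) b"
    using d total_deg_homogeneous[OF d b0] by simp
  then show "b \<in> Th (int (total_deg b))" using invariants_polys[OF bR] by (simp add: hpolys_def)
  have w: "mon_weight (\<lambda>_. 1) m = total_deg b" using deg m by (simp add: homogeneous_def)
  then show "1 \<le> total_deg b" using pos[OF m] by simp
  have "b \<in> cpoly.span {f \<in> E. \<exists>d \<le> int (order G). homogeneous (\<lambda>_. 1) d f}"
    using minimal_generating_subspace_low[OF E] bE by simp
  then have "\<forall>m \<in> Poly_Mapping.keys b. mon_weight (\<lambda>_. 1) m \<le> order G"
  proof (induction rule: cpoly.span_induct_alt)
    case (step c x y)
    show ?case
    proof
      fix m assume "m \<in> Poly_Mapping.keys (const_poly c * x + y)"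
      then have "m \<in> Poly_Mapping.keys x \<or> m \<in> Poly_Mapping.keys y"
        by (auto simp: in_keys_iff lookup_add lookup_const_mult)
      then show "mon_weight (\<lambda>_. 1) m \<le> order G"
        using step by (auto simp: homogeneous_def)
    qed
  qed simp
  then show "total_deg b \<le> order G" using m w by auto
qed

text \<open>An independent set in the span of the finitely many monomials of degree at most
  \<open>order G\<close>. The sums over \<open>B\<close> in the Koszul differential depend on
  this.\<close>

lemma finite_B: "finite B"
proof -
  let ?M = "{m. Poly_Mapping.keys m \<subseteq> {..<n} \<and> mon_weight (\<lambda>_. 1) m \<le> order G}"
  have "B \<subseteq> cpoly.span ((\<lambda>m. Poly_Mapping.single m 1) ` ?M)"
  proof
    fix b assume b: "b \<in> B"
    have "(\<Sum>m\<in>Poly_Mapping.keys b. const_poly (Poly_Mapping.lookup b m) * Poly_Mapping.single m 1)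
        \<in> cpoly.span ((\<lambda>m. Poly_Mapping.single m 1) ` ?M)"
    proof (intro cpoly.span_sum cpoly.span_scale cpoly.span_base imageI)
      fix m assume "m \<in> Poly_Mapping.keys b"
      then show "m \<in> ?M"
        using basis_element[OF b] by (auto simp: hpolys_def polys_def homogeneous_def)
    qed
    then show "b \<in> cpoly.span ((\<lambda>m. Poly_Mapping.single m 1) ` ?M)"
      by (simp add: const_poly_single cpoly_sum_keys)
  qed
  moreover have "finite ((\<lambda>m. Poly_Mapping.single m (1::complex)) ` ?M)"
    by (intro finite_imageI finite_monomials) simp
  ultimately show ?thesis using cpoly.independent_span_bound independent_B by blast
qed

text \<open>The constant term left over by \<open>subalgebra_generated_ideal_of\<close> is 0:
  neither \<open>f\<close> nor an element of the ideal has one, all degrees being positive.\<close>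

lemma invariant_ideal_B:
  assumes "f \<in> R" "f \<in> Th d" "1 \<le> d"
  shows "f \<in> ideal_of B {..<n}"
proof -
  have "f \<in> subalgebra_generated E"
    using E assms(1) by (auto simp: minimal_generating_subspace_def generating_subspace_def)
  then obtain c where c: "f - const_poly c \<in> ideal_of B {..<n}"
    using subalgebra_generated_ideal_of[OF _ span_B] basis_element(1) invariants_polys by blast
  have "Poly_Mapping.lookup s 0 = 0" if "s \<in> ideal_of B {..<n}" for s
    using that
  proof induction
    case (step b t s)
    have "hcomp (\<lambda>_. 1) 0 (b * t) = b * hcomp (\<lambda>_. 1) (0 - int (total_deg b)) t"
      by (rule hcomp_mult[OF hpolysD(2)[OF basis_element(2)[OF step.hyps(1)]]])
    also have "hcomp (\<lambda>_. 1) (0 - int (total_deg b)) t = 0"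
      using basis_element(3)[OF step.hyps(1)]
      by (intro hpolys_negative[OF hcomp_hpolys[OF step.hyps(2)]]) simp
    finally have "Poly_Mapping.lookup (hcomp (\<lambda>_. 1) 0 (b * t)) 0 = 0" by simp
    then show ?case using step.IH by (simp add: lookup_hcomp lookup_add)
  qed simp
  from this[OF c] have "Poly_Mapping.lookup f 0 = c"
    by (simp add: lookup_minus const_poly_def)
  moreover have "Poly_Mapping.lookup f 0 = 0"
    using assms(2,3) by (force simp: hpolys_def homogeneous_def in_keys_iff)
  ultimately show ?thesis using c by simp
qed

lemma prod_vars_in_ideal_B:
  assumes "length ks = order G" "set ks \<subseteq> {..<n}"
  shows "prod_list (map var_poly ks) \<in> ideal_of B {..<n}"
  using prod_vars_in_ideal[OF assms]
proof induction
  case (step b t s)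
  then have "b \<in> ideal_of B {..<n}"
    using invariant_ideal_B by (auto simp: low_invariants_def)
  then have "t * b \<in> ideal_of B {..<n}" using step by (intro ideal_of_mult)
  then show ?case using step by (simp add: ideal_of_add mult.commute)
qed (rule ideal_of.zero)

end

section \<open>Degree bound for the Koszul homology of the symmetric algebra\<close>

lemma sum_fun_apply: "(\<Sum>i\<in>I. f i) x = (\<Sum>i\<in>I. f i x)"
  by (induction I rule: infinite_finite_induct) simp_all

text \<open>Chains for the variables of \<open>T\<close> take values in chains of \<open>K\<close>,
  so functions into the polynomial ring form the ambient vector space.\<close>

definition scale_fun :: "complex \<Rightarrow> ('i \<Rightarrow> 'x cpoly) \<Rightarrow> 'i \<Rightarrow> 'x cpoly" where
  "scale_fun c f = (\<lambda>xs. const_poly c * f xs)"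

lemma vector_space_scale_fun: "vector_space scale_fun"
proof
  show "scale_fun a (x + y) = scale_fun a x + scale_fun a y" for a and x y :: "'i \<Rightarrow> 'x cpoly"
    by (rule ext) (simp only: scale_fun_def plus_fun_apply distrib_left)
  show "scale_fun (a + b) x = scale_fun a x + scale_fun b x" for a b and x :: "'i \<Rightarrow> 'x cpoly"
    by (rule ext) (simp only: scale_fun_def plus_fun_apply distrib_right const_poly_add)
  show "scale_fun a (scale_fun b x) = scale_fun (a * b) x" for a b and x :: "'i \<Rightarrow> 'x cpoly"
    by (rule ext) (simp only: scale_fun_def const_poly_mult mult.assoc)
  show "scale_fun 1 x = x" for x :: "'i \<Rightarrow> 'x cpoly"
    by (rule ext) (simp only: scale_fun_def const_poly_1 mult_1_left)
qed

lemma koszul_mult: "koszul (\<lambda>c p. const_poly c * p) (\<lambda>b v. b * v :: 'x cpoly)"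
  by (intro koszul.intro cpoly.vector_space_axioms koszul_axioms.intro)
     (simp_all add: algebra_simps)

lemma koszul_var_fun: "koszul scale_fun (\<lambda>k v xs. var_poly k * v xs)"
  by (intro koszul.intro vector_space_scale_fun koszul_axioms.intro)
     (simp_all only: scale_fun_def fun_eq_iff minus_apply right_diff_distrib mult.left_commute simp_thms)

text \<open>Chains vanish off lists of length \<open>j\<close>, so a grading by length is constant
  on them. \<open>alt_chains_lift\<close> requires a constant module.\<close>

lemma alt_chains_length:
  assumes "\<And>k. subgrp (M k)"
  shows "alt_chains B (\<lambda>xs. M (length xs)) j = alt_chains B (\<lambda>_. M j) j"
proof -
  have "c xs \<in> M (length xs) \<longleftrightarrow> c xs \<in> M j" if "c xs \<noteq> 0 \<longrightarrow> length xs = j" for c xs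
    using that assms subgrp_zero by (cases "c xs = 0") auto
  then show ?thesis unfolding alt_chains_def by (intro Collect_cong) blast
qed

section \<open>The Koszul complex of E over T\<close>

context minimal_basis
begin

definition wt :: "nat cpoly list \<Rightarrow> int" where
  "wt xs = (\<Sum>b\<leftarrow>xs. int (total_deg b))"

lemma wt_simps [simp]: "wt [] = 0" "wt (b # xs) = int (total_deg b) + wt xs"
    "wt (xs @ ys) = wt xs + wt ys"
  by (simp_all add: wt_def)

lemma wt_nonneg: "0 \<le> wt xs"
  by (induction xs) simp_all

lemma wt_le: "set xs \<subseteq> B \<Longrightarrow> wt xs \<le> int (length xs) * int (order G)"
proof (induction xs)
  case (Cons b xs)
  then have "int (total_deg b) \<le> int (order G)" using basis_element(4)[of b] by simp
  then show ?case using Cons by (simp add: algebra_simps)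
qed simp

text \<open>\<open>K i d\<close> is the degree \<open>d\<close> part of \<open>T \<otimes> \<Lambda>\<^sup>i(E)\<close>.\<close>

definition K :: "nat \<Rightarrow> int \<Rightarrow> (nat cpoly list \<Rightarrow> nat cpoly) set" where
  "K i d = alt_chains B (\<lambda>xs. Th (d - wt xs)) i"

definition bd :: "(nat cpoly list \<Rightarrow> nat cpoly) \<Rightarrow> nat cpoly list \<Rightarrow> nat cpoly" where
  "bd = kos B (\<lambda>b v. b * v)"

text \<open>Vanishing of H_i(K) in degree \<open>d\<close>. For \<open>i = 0\<close> every chain is
  a cycle, and the condition says that T/ET vanishes in degree \<open>d\<close>.\<close>

definition acyclic_at :: "nat \<Rightarrow> int \<Rightarrow> bool" where
  "acyclic_at i d \<longleftrightarrow> (\<forall>z \<in> K i d. bd z = 0 \<longrightarrow> (\<exists>y \<in> K (Suc i) d. bd y = z))"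

interpretation kT: koszul "\<lambda>c p. const_poly c * p" B "\<lambda>b v. b * v :: nat cpoly"
  by (rule koszul_mult)

interpretation kV: koszul scale_fun "{..<n}" "\<lambda>k (v :: nat cpoly list \<Rightarrow> nat cpoly) xs. var_poly k * v xs"
  by (rule koszul_var_fun)

lemma subgrp_K [simp]: "subgrp (K i d)"
  unfolding K_def by (rule subgrp_alt_chains) simp

lemma scale_K: "v \<in> K i d \<Longrightarrow> scale_fun c v \<in> K i d"
  unfolding K_def scale_fun_def
  by (rule alt_chains_comp[where \<phi> = "\<lambda>v. const_poly c * v"]) (auto intro: hpolys_const_mult)

lemma mult_K:
  assumes "v \<in> K i d" "q \<in> Th e"
  shows "(\<lambda>xs. q * v xs) \<in> K i (d + e)"
  using assms(1) unfolding K_def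
proof (rule alt_chains_comp)
  fix xs v assume "v \<in> Th (d - wt xs)"
  then have "q * v \<in> Th (e + (d - wt xs))" by (rule hpolys_mult[OF assms(2)])
  then show "q * v \<in> Th (d + e - wt xs)" by (simp add: algebra_simps)
qed simp_all

lemma bd_K:
  assumes "z \<in> K (Suc i) d"
  shows "bd z \<in> K i d"
  using assms unfolding bd_def K_def
proof (rule kos_alt_chains)
  fix b xs v assume "b \<in> B" "v \<in> Th (d - wt (b # xs))"
  then have "b * v \<in> Th (int (total_deg b) + (d - wt (b # xs)))"
    by (intro hpolys_mult basis_element)
  then show "b * v \<in> Th (d - wt xs)" by simp
qed simp_all

lemma bd_0: "z \<in> K 0 d \<Longrightarrow> bd z = 0"
proof
  fix xs assume z: "z \<in> K 0 d"
  have "z (b # xs) = 0" for b using alt_chainsD(3)[OF z[unfolded K_def], of "b # xs"] by auto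
  then show "bd z xs = 0 xs" by (simp add: bd_def kos_def)
qed

lemma bd_diff: "bd (u - v) = bd u - bd v"
  unfolding bd_def by (rule kT.kos_diff)

lemma bd_add: "bd (u + v) = bd u + bd v"
  by (rule ext) (simp add: bd_def kos_def distrib_left sum.distrib)

lemma bd_zero [simp]: "bd (\<lambda>_. 0) = (\<lambda>_. 0)" "bd 0 = 0"
  by (simp_all add: bd_def kos_def fun_eq_iff)

lemma bd_mult: "bd (\<lambda>xs. q * v xs) = (\<lambda>xs. q * bd v xs)"
  by (simp add: bd_def kos_def fun_eq_iff sum_distrib_left mult.left_commute)

lemma bd_sum: "bd (\<Sum>i\<in>I. f i) = (\<Sum>i\<in>I. bd (f i))"
proof (induction I rule: infinite_finite_induct)
  case (insert i I)
  have "bd (f i + sum f I) = bd (f i) + bd (sum f I)"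
    by (rule bd_add)
  then show ?case by (simp only: insert.IH sum.insert[OF insert.hyps])
qed simp_all

lemma bd_bd: "z \<in> K i d \<Longrightarrow> bd (bd z) = 0"
  unfolding bd_def K_def by (rule kT.kos_kos[OF alt_chainsD(1)])

section \<open>The double complex with the Koszul complex of the variables\<close>

text \<open>\<open>C d i j\<close> is the degree \<open>d\<close> part of \<open>T \<otimes> \<Lambda>\<^sup>i(E) \<otimes> \<Lambda>\<^sup>j(V)\<close>.\<close>

definition C :: "int \<Rightarrow> nat \<Rightarrow> nat \<Rightarrow> (nat list \<Rightarrow> nat cpoly list \<Rightarrow> nat cpoly) set" where
  "C d i j = alt_chains {..<n} (\<lambda>ks. K i (d - int (length ks))) j"

definition kap :: "(nat list \<Rightarrow> nat cpoly list \<Rightarrow> nat cpoly) \<Rightarrow> nat list \<Rightarrow> nat cpoly list \<Rightarrow> nat cpoly" where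
  "kap = kos {..<n} (\<lambda>k v xs. var_poly k * v xs)"

lemma kap_C:
  assumes "c \<in> C d i (Suc j)"
  shows "kap c \<in> C d i j"
  using assms unfolding kap_def C_def
proof (rule kos_alt_chains)
  fix k ks and v :: "nat cpoly list \<Rightarrow> nat cpoly"
  assume "k \<in> {..<n}" "v \<in> K i (d - int (length (k # ks)))"
  then have "(\<lambda>xs. var_poly k * v xs) \<in> K i (d - int (length (k # ks)) + 1)"
    by (intro mult_K) simp_all
  then show "(\<lambda>xs. var_poly k * v xs) \<in> K i (d - int (length ks))" by simp
qed (simp_all add: fun_eq_iff)

text \<open>On the coefficient at \<open>ks\<close>, \<open>xs\<close> the Euler operator multiplies
  by the polynomial degree plus the length of \<open>ks\<close>, that is by
  \<open>d - wt xs\<close>. The excluded case \<open>wt xs = d\<close> is the homology of this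
  complex, a copy of the exterior algebra of \<open>E\<close>.\<close>

lemma kap_exact:
  assumes c: "c \<in> C d i j" and cyc: "kap c = 0"
    and nz: "\<And>ks xs. c ks xs \<noteq> 0 \<Longrightarrow> wt xs \<noteq> d"
  shows "\<exists>y \<in> C d i (Suc j). kap y = c"
  unfolding C_def kap_def
proof (rule kV.kos_exact[where D = "\<lambda>k v xs. pd k (v xs)" and w = "\<lambda>_. 1"
      and L = "\<lambda>v xs. const_poly (1 / of_int (d - wt xs)) * v xs"])
  show "c \<in> alt_chains {..<n} (\<lambda>ks. K i (d - int (length ks))) j"
    using c by (simp add: C_def)
  show "kos {..<n} (\<lambda>k v xs. var_poly k * v xs) c = 0" using cyc by (simp add: kap_def)
  show "(\<lambda>xs. pd k (v xs)) \<in> K i (d - int (length (us @ k # vs)))"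
    if "v \<in> K i (d - int (length (us @ vs)))" for k us vs v
    unfolding K_def
  proof (rule alt_chains_comp[OF that[unfolded K_def]])
    fix xs v assume v: "v \<in> Th (d - int (length (us @ vs)) - wt xs)"
    have "pd k v \<in> Th (d - int (length (us @ vs)) - wt xs - int 1)" by (rule pd_hpolys[OF v])
    then show "pd k v \<in> Th (d - int (length (us @ k # vs)) - wt xs)" by (simp add: algebra_simps)
  next
    show "pd k (- v) = - pd k v" for v :: "nat cpoly" using pd_diff[of k 0 v] by simp
  qed simp
  show "(\<lambda>xs. const_poly (1 / of_int (d - wt xs)) * v xs) \<in> K i (d - int (length ks))"
    if "v \<in> K i (d - int (length ks))" for ks v
  proof -
    note v = that[unfolded K_def]
    show ?thesis
      unfolding K_def
    proof (rule alt_chainsI)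
      \<comment> \<open>The divisor depends on \<open>xs\<close> only through its weight, which
        permutations preserve, so the division keeps chains alternating.\<close>
      have wt_swap: "wt (us @ x # y # vs) = wt (us @ y # x # vs)" for us x y vs by simp
      show "alternating (\<lambda>xs. const_poly (1 / of_int (d - wt xs)) * v xs)"
        unfolding alternating_def
      proof (intro allI)
        fix us x y vs
        show "const_poly (1 / of_int (d - wt (us @ x # y # vs))) * v (us @ x # y # vs) =
          - (const_poly (1 / of_int (d - wt (us @ y # x # vs))) * v (us @ y # x # vs))"
          by (subst alternatingD[OF alt_chainsD(1)[OF v]], subst wt_swap) simp
      qed
      show "const_poly (1 / of_int (d - wt xs)) * v xs \<in> Th (d - int (length ks) - wt xs)" for xs
        by (intro hpolys_const_mult alt_chainsD(2)[OF v])
      show "length xs = i \<and> set xs \<subseteq> B" if "const_poly (1 / of_int (d - wt xs)) * v xs \<noteq> 0" for xs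
        using alt_chainsD(3,4)[OF v, of xs] that by auto
    qed
  qed
  fix ks
  let ?N = "(\<Sum>k\<in>{..<n}. scale_fun 1 (\<lambda>xs. var_poly k * pd k (c ks xs))) +
    scale_fun (\<Sum>x\<leftarrow>ks. 1) (c ks)"
  show "(\<lambda>xs. const_poly (1 / of_int (d - wt xs)) * ?N xs) = c ks"
  proof
    fix xs
    have "c ks \<in> K i (d - int (length ks))" using alt_chainsD(2)[OF c[unfolded C_def]] .
    then have "c ks xs \<in> Th (d - int (length ks) - wt xs)" unfolding K_def by (rule alt_chainsD)
    from euler_identity[OF _ this]
    have "(\<Sum>k<n. var_poly k * pd k (c ks xs)) = const_poly (of_int (d - int (length ks) - wt xs)) * c ks xs"
      by simp
    then have "?N xs = const_poly (of_int (d - wt xs)) * c ks xs"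
      by (simp add: scale_fun_def sum_fun_apply sum_list_triv distrib_right[symmetric]
          const_poly_add[symmetric])
    then have *: "const_poly (1 / of_int (d - wt xs)) * ?N xs =
        const_poly (1 / of_int (d - wt xs) * of_int (d - wt xs)) * c ks xs"
      by (simp only: const_poly_mult mult.assoc)
    show "const_poly (1 / of_int (d - wt xs)) * ?N xs = c ks xs"
    proof (cases "c ks xs = 0")
      case False
      then have "of_int (d - wt xs) \<noteq> (0 :: complex)"
        using nz[OF False] by (metis eq_iff_diff_eq_0 of_int_eq_0_iff)
      then show ?thesis unfolding * by simp
    qed (simp only: *, simp)
  qed
qed (simp_all add: scale_K[unfolded scale_fun_def] fun_eq_iff scale_fun_def pd_diff pd_const_mult
    pd_var_mult right_diff_distrib mult.left_commute)

text \<open>With at least one exterior variable the exceptional degree cannot occur, since a nonzero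
  coefficient has degree \<open>d - length ks - wt xs \<ge> 0\<close>.\<close>

lemma kap_exact_Suc:
  assumes c: "c \<in> C d i (Suc j)" and cyc: "kap c = 0"
  shows "\<exists>y \<in> C d i (Suc (Suc j)). c = kap y"
proof -
  have "wt xs \<noteq> d" if "c ks xs \<noteq> 0" for ks xs
  proof -
    have "c ks \<noteq> 0" using that by auto
    then have len: "length ks = Suc j" using alt_chainsD(3)[OF c[unfolded C_def]] by blast
    have "c ks xs \<in> Th (d - int (length ks) - wt xs)"
      using alt_chainsD(2)[OF c[unfolded C_def], of ks] alt_chainsD(2) unfolding K_def by blast
    then have "\<not> d - int (length ks) - wt xs < 0" using hpolys_negative that by blast
    then show ?thesis using len by simp
  qed
  then show ?thesis using kap_exact[OF c cyc] by metis
qed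

lemma bd_kap:
  assumes "c \<in> C d i (Suc j)"
  shows "(\<lambda>ks. bd (kap c ks)) = kap (\<lambda>ks. bd (c ks))"
proof
  fix ks
  show "bd (kap c ks) = kap (\<lambda>ks. bd (c ks)) ks"
    by (simp add: kap_def kos_def bd_sum bd_mult)
qed

lemma bd_C: "c \<in> C d (Suc i) j \<Longrightarrow> (\<lambda>ks. bd (c ks)) \<in> C d i j"
  unfolding C_def
  by (erule alt_chains_comp[where \<phi> = bd]) (simp_all add: bd_K, metis bd_diff diff_0 bd_zero)

lemma bd_C_exact:
  assumes c: "c \<in> C d i j" and cyc: "\<And>ks. bd (c ks) = 0" and acyc: "acyclic_at i (d - int j)"
  shows "\<exists>y \<in> C d (Suc i) j. c = (\<lambda>ks. bd (y ks))"
proof -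
  have eq: "C d i' j = alt_chains {..<n} (\<lambda>_. K i' (d - int j)) j" for i'
    unfolding C_def by (rule alt_chains_length[of "\<lambda>k. K i' (d - int k)"]) simp
  have "\<exists>y \<in> alt_chains {..<n} (\<lambda>_. K (Suc i) (d - int j)) j. \<forall>ks. bd (y ks) = c ks"
  proof (rule alt_chains_lift[OF vector_space_scale_fun vector_space_scale_fun])
    show "c \<in> alt_chains {..<n} (\<lambda>_. K i (d - int j)) j" using c eq by simp
    show "c ks \<in> bd ` K (Suc i) (d - int j)" for ks
      using acyc cyc alt_chainsD(2)[OF c[unfolded eq]] unfolding acyclic_at_def by (metis imageI)
    show "bd (u - v) = bd u - bd v" for u v by (rule bd_diff)
    show "bd (scale_fun r v) = scale_fun r (bd v)" for r v
      unfolding scale_fun_def by (rule bd_mult)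
  qed (simp_all add: scale_K)
  then show ?thesis unfolding eq by (metis ext)
qed

text \<open>
  Every cycle of \<open>K i\<close> in these degrees is a combination of cycles with coefficients in the maximal
  ideal of \<open>T\<close>. This is the spectral sequence from the groups \<open>Tor\<^sup>T\<close> of the homology of \<open>K\<close> with
  \<open>\<complex>\<close> to \<open>\<Lambda>(E)\<close>, read off near its edge.
\<close>

lemma cycles_in_maximal_ideal:
  assumes z: "z \<in> K i d" "bd z = 0" and d: "int i * int (order G) < d"
    and acyc: "\<And>r. 2 \<le> r \<Longrightarrow> r \<le> Suc i \<Longrightarrow> acyclic_at (Suc i - r) (d - int r)"
  shows "\<exists>c. (\<forall>k<n. c k \<in> K i (d - 1) \<and> bd (c k) = 0) \<and> z = (\<lambda>xs. \<Sum>k<n. var_poly k * c k xs)"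
proof -
  define c0 where "c0 = (\<lambda>ks :: nat list. if ks = [] then z else 0)"
  have c0: "c0 \<in> C d i 0"
    unfolding C_def
  proof (rule alt_chainsI)
    show "c0 ks \<in> K i (d - int (length ks))" for ks
      using z by (auto simp: c0_def intro: subgrp_zero[OF subgrp_K])
  qed (auto simp: c0_def alternating_def split: if_splits)
  \<comment> \<open>The exterior power itself ends in degree \<open>i * order G < d\<close>, so
    \<open>z\<close> has no constant coefficients and is a combination of the variables. The
    coefficients in \<open>z1\<close> need not be cycles yet.\<close>
  have "\<exists>z1 \<in> C d i (Suc 0). kap z1 = c0"
  proof (rule kap_exact[OF c0])
    show "kap c0 = 0" by (simp add: kap_def kos_def fun_eq_iff sum_fun_apply c0_def)
    show "wt xs \<noteq> d" if "c0 ks xs \<noteq> 0" for ks xs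
    proof -
      have "z xs \<noteq> 0" using that by (auto simp: c0_def split: if_splits)
      then have "length xs = i" "set xs \<subseteq> B"
        using alt_chainsD(3,4)[OF z(1)[unfolded K_def]] by blast+
      then show ?thesis using wt_le[of xs] d by auto
    qed
  qed
  then obtain z1 where z1: "z1 \<in> C d i (Suc 0)" "kap z1 = c0" by blast
  \<comment> \<open>Subtracting \<open>kap y\<close> keeps \<open>kap z1\<close> and turns the
    coefficients into cycles. Along the staircase \<open>i' + j = Suc i\<close> the homology needed
    at \<open>j \<ge> 2\<close> is H_i'(K) in degree \<open>d - j\<close>, which is the hypothesis
    for \<open>r = j\<close>.\<close>
  have "\<exists>y \<in> C d i (Suc (Suc 0)). \<forall>ks. bd ((z1 - kap y) ks) = 0"
  proof (rule double_complex_chase[where C = "C d" and D = "C d" and \<kappa> = kap and N = "Suc i"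
        and del = "\<lambda>_ c ks. bd (c ks)" and cyc = "\<lambda>_ c. \<forall>ks. bd (c ks) = 0"])
    show "subgrp (C d i j)" for i j unfolding C_def by (rule subgrp_alt_chains) simp
    show "kap (u - v) = kap u - kap v" for u v unfolding kap_def by (rule kV.kos_diff)
    show "kap c \<in> C d i j" if "c \<in> C d i (Suc j)" for i j c by (rule kap_C[OF that])
    show "kap (kap c) = 0" if "c \<in> C d i j" for i j c
      unfolding kap_def by (rule kV.kos_kos[OF alt_chainsD(1)[OF that[unfolded C_def]]])
    show "\<exists>y \<in> C d i (Suc (Suc j)). c = kap y" if "c \<in> C d i (Suc j)" "kap c = 0" for i j c
      by (rule kap_exact_Suc[OF that])
    show "(\<lambda>ks. bd ((u - v) ks)) = (\<lambda>ks. bd (u ks)) - (\<lambda>ks. bd (v ks))"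
      for u v :: "nat list \<Rightarrow> nat cpoly list \<Rightarrow> nat cpoly"
      by (rule ext) (simp only: minus_apply bd_diff)
    show "(\<lambda>ks. bd (c ks)) \<in> C d i j" if "c \<in> C d (Suc i) j" for i j c by (rule bd_C[OF that])
    show "(\<lambda>ks. bd (kap c ks)) = kap (\<lambda>ks. bd (c ks))" if "c \<in> C d (Suc i) (Suc j)" for i j c
      by (rule bd_kap[OF that])
    show "(\<forall>ks. bd (c ks) = 0) \<longleftrightarrow> (\<lambda>ks. bd (c ks)) = 0"
      for c :: "nat list \<Rightarrow> nat cpoly list \<Rightarrow> nat cpoly"
      by (simp only: fun_eq_iff zero_fun_apply)
    show "\<forall>ks. bd (bd (c ks)) = 0" if "c \<in> C d (Suc i) j" for i j c
      using bd_bd alt_chainsD(2)[OF that[unfolded C_def]] by blast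
    show "\<exists>y \<in> C d (Suc i') j. c = (\<lambda>ks. bd (y ks))"
      if "c \<in> C d i' j" "i' + j = Suc i" "2 \<le> j" "\<forall>ks. bd (c ks) = 0" for i' j c
    proof (rule bd_C_exact)
      have "i' = Suc i - j" using that by simp
      then show "acyclic_at i' (d - int j)" using acyc[of j] that by simp
    qed (use that in auto)
    \<comment> \<open>In row 0 every chain is a cycle, so no correction is required.\<close>
    show "\<exists>y \<in> C d 0 (Suc (Suc i)). \<forall>ks. bd ((c - kap y) ks) = 0" if "c \<in> C d 0 (Suc i)" for c
    proof
      show "0 \<in> C d 0 (Suc (Suc i))" unfolding C_def by (rule subgrp_zero[OF subgrp_alt_chains]) simp
      have "kap 0 = kap 0 - kap 0" unfolding kap_def kV.kos_diff[symmetric] by simp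
      then have "kap 0 = 0" by simp
      moreover have "bd (c ks) = 0" for ks
        by (rule bd_0[OF alt_chainsD(2)[OF that[unfolded C_def]]])
      ultimately show "\<forall>ks. bd ((c - kap 0) ks) = 0" by (simp only: diff_zero simp_thms)
    qed
    show "z1 \<in> C d i (Suc 0)" by (rule z1)
    show "\<forall>ks. bd (kap z1 ks) = 0" using z by (simp add: z1(2) c0_def)
  qed simp_all
  then obtain y where y: "y \<in> C d i (Suc (Suc 0))" "\<And>ks. bd ((z1 - kap y) ks) = 0" by blast
  define c where "c = z1 - kap y"
  have c: "c \<in> C d i (Suc 0)"
    unfolding c_def C_def
    by (rule subgrp_diff[OF subgrp_alt_chains]) (use z1 kap_C[OF y(1)] in \<open>simp_all add: C_def\<close>)
  have "kap c = c0"
  proof -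
    have "kap (kap y) = 0"
      unfolding kap_def by (rule kV.kos_kos[OF alt_chainsD(1)[OF y(1)[unfolded C_def]]])
    then show ?thesis unfolding c_def using kV.kos_diff[of z1 "kap y"] z1(2) by (simp add: kap_def)
  qed
  then have "z = kap c []" by (simp add: c0_def)
  then have "z = (\<lambda>xs. \<Sum>k<n. var_poly k * c [k] xs)"
    by (simp add: kap_def kos_def fun_eq_iff sum_fun_apply)
  moreover have "c [k] \<in> K i (d - 1)" for k using alt_chainsD(2)[OF c[unfolded C_def], of "[k]"] by simp
  moreover have "bd (c [k]) = 0" for k using y(2) by (simp add: c_def)
  ultimately show ?thesis by (intro exI[of _ "\<lambda>k. c [k]"]) simp
qed

text \<open>Exterior multiplication by \<open>b\<close> is a null-homotopy of multiplication by
  \<open>b\<close>, so the whole ideal kills homology. Its elements may be inhomogeneous, hence the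
  component of degree \<open>e\<close>.\<close>

lemma ideal_annihilates:
  assumes "s \<in> ideal_of B {..<n}" and z: "z \<in> K i d" "bd z = 0"
  shows "\<exists>y \<in> K (Suc i) (d + e). bd y = (\<lambda>xs. hcomp (\<lambda>_. 1) e s * z xs)"
  using assms(1)
proof induction
  case zero
  show ?case by (rule bexI[of _ 0]) (auto simp: fun_eq_iff subgrp_zero)
next
  case (step b t s)
  let ?t = "hcomp (\<lambda>_. 1) (e - int (total_deg b)) t"
  have "?t \<in> Th (e - int (total_deg b))" by (rule hcomp_hpolys[OF step.hyps(2)])
  then have tz: "(\<lambda>xs. ?t * z xs) \<in> K i (d + (e - int (total_deg b)))" by (rule mult_K[OF z(1)])
  have cyc: "bd (\<lambda>xs. ?t * z xs) = 0" by (simp add: bd_mult z(2) fun_eq_iff)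
  have "\<exists>y \<in> K (Suc i) (d + e). bd y = (\<lambda>xs. b * (?t * z xs))"
    unfolding K_def bd_def
  proof (rule kT.kos_annihilated[OF finite_B step.hyps(1) tz[unfolded K_def] cyc[unfolded bd_def]])
    show "Th (d + (e - int (total_deg b)) - wt (us @ vs)) \<subseteq> Th (d + e - wt (us @ b # vs))" for us vs
      by (simp add: algebra_simps)
  qed simp
  then obtain y where y: "y \<in> K (Suc i) (d + e)" "bd y = (\<lambda>xs. b * (?t * z xs))" by blast
  obtain y' where y': "y' \<in> K (Suc i) (d + e)" "bd y' = (\<lambda>xs. hcomp (\<lambda>_. 1) e s * z xs)"
    using step.IH by blast
  have h: "hcomp (\<lambda>_. 1) e (b * t + s) = b * ?t + hcomp (\<lambda>_. 1) e s"
    by (simp only: hcomp_add hcomp_mult[OF hpolysD(2)[OF basis_element(2)[OF step.hyps(1)]]])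
  show ?case
  proof
    show "y + y' \<in> K (Suc i) (d + e)" by (rule subgrp_add[OF subgrp_K y(1) y'(1)])
    show "bd (y + y') = (\<lambda>xs. hcomp (\<lambda>_. 1) e (b * t + s) * z xs)"
      by (rule ext) (simp only: h bd_add y(2) y'(2) plus_fun_apply distrib_right mult.assoc)
  qed
qed

text \<open>Splitting a cycle of degree \<open>d + order G\<close> repeatedly, once in each degree
  above \<open>d\<close>, leaves products of \<open>order G\<close> variables times cycles of degree
  \<open>d\<close>. Such products lie in the ideal of \<open>B\<close> and kill homology.\<close>

lemma acyclic_from_maximal_ideal:
  assumes step: "\<And>z d'. z \<in> K i d' \<Longrightarrow> bd z = 0 \<Longrightarrow> d < d' \<Longrightarrow>
      \<exists>c. (\<forall>k<n. c k \<in> K i (d' - 1) \<and> bd (c k) = 0) \<and> z = (\<lambda>xs. \<Sum>k<n. var_poly k * c k xs)"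
  shows "acyclic_at i (d + int (order G))"
proof -
  \<comment> \<open>\<open>ks\<close> collects the variables already split off; \<open>q\<close>
    counts those still to come.\<close>
  have "\<exists>y \<in> K (Suc i) (d + int (order G)). bd y = (\<lambda>xs. prod_list (map var_poly ks) * z xs)"
    if "length ks + q = order G" "set ks \<subseteq> {..<n}" "z \<in> K i (d + int q)" "bd z = 0" for q ks z
    using that
  proof (induction q arbitrary: ks z)
    case 0
    have "prod_list (map var_poly ks) \<in> ideal_of B {..<n}"
      by (rule prod_vars_in_ideal_B) (use 0 in auto)
    moreover have "prod_list (map var_poly ks) \<in> hpolys {..<n} (\<lambda>_. 1) (int (length ks))"
      if "set ks \<subseteq> {..<n}" for ks
      using that
    proof (induction ks)
      case (Cons k ks)
      then have "var_poly k * prod_list (map var_poly ks) \<in> Th (1 + int (length ks))"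
        by (intro hpolys_mult) simp_all
      then show ?case by simp
    qed (use hpolys_const[of 1] in simp)
    then have "hcomp (\<lambda>_. 1) (int (order G)) (prod_list (map var_poly ks)) = prod_list (map var_poly ks)"
      using 0 by (intro hcomp_homogeneous hpolysD(2)) force
    moreover have "z \<in> K i d" using 0 by simp
    ultimately show ?case
      using ideal_annihilates[of "prod_list (map var_poly ks)" z i d "int (order G)"] 0(4)
      by (simp only:)
  next
    case (Suc q)
    obtain c where c: "\<And>k. k < n \<Longrightarrow> c k \<in> K i (d + int (Suc q) - 1) \<and> bd (c k) = 0"
      and z: "z = (\<lambda>xs. \<Sum>k<n. var_poly k * c k xs)"
      using step[OF Suc.prems(3,4)] by auto
    have "\<exists>y \<in> K (Suc i) (d + int (order G)).
        bd y = (\<lambda>xs. prod_list (map var_poly (k # ks)) * c k xs)" if "k < n" for k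
    proof (rule Suc.IH)
      show "c k \<in> K i (d + int q)" "bd (c k) = 0" using c[OF that] by simp_all
    qed (use Suc.prems that in simp_all)
    then obtain y where y: "\<And>k. k < n \<Longrightarrow> y k \<in> K (Suc i) (d + int (order G))"
      "\<And>k. k < n \<Longrightarrow> bd (y k) = (\<lambda>xs. prod_list (map var_poly (k # ks)) * c k xs)"
      by metis
    have "bd (\<Sum>k<n. y k) = (\<lambda>xs. prod_list (map var_poly ks) * z xs)"
      unfolding bd_sum using y(2)
      by (simp add: fun_eq_iff sum_fun_apply z sum_distrib_left mult_ac)
    moreover have "(\<Sum>k<n. y k) \<in> K (Suc i) (d + int (order G))"
      using y(1) by (intro subgrp_sum[OF subgrp_K]) auto
    ultimately show ?case by blast
  qed
  from this[of "[]" "order G"] show ?thesis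
    unfolding acyclic_at_def by (simp only: list.size set_simps list.map prod_list.Nil mult_1_left) simp
qed

theorem acyclic_bound:
  "(int i + 1) * (int (order G) + 1) - 2 < d \<Longrightarrow> acyclic_at i d"
proof (induction i arbitrary: d rule: less_induct)
  case (less i)
  let ?g = "int (order G)"
  have "acyclic_at i (d - ?g + ?g)"
  proof (rule acyclic_from_maximal_ideal, rule cycles_in_maximal_ideal)
    fix d' assume "d - ?g < d'"
    \<comment> \<open>As (i + 1)(g + 1) - 2 = i (g + 1) + (g - 1), all degrees above
      \<open>d - ?g\<close> exceed i (g + 1).\<close>
    then have d': "int i * (?g + 1) < d'" using less.prems by (simp add: algebra_simps)
    then show "int i * ?g < d'" by (simp add: algebra_simps)
    fix r assume r: "2 \<le> r" "r \<le> Suc i"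
    \<comment> \<open>The case \<open>r = 2\<close> is tight and dictates the constant: raising
      \<open>r\<close> by 1 lowers the required bound by g + 1 but the degree only by 1.\<close>
    have "(int r - 2) * 1 \<le> (int r - 2) * (?g + 1)" using r by (intro mult_left_mono) auto
    then have "(int (Suc i - r) + 1) * (?g + 1) - 2 < d' - int r"
      using d' r by (simp add: of_nat_diff algebra_simps)
    then show "acyclic_at (Suc i - r) (d' - int r)" using r by (intro less.IH) auto
  qed
  then show ?case by simp
qed

section \<open>The trivial group\<close>

text \<open>
  For the trivial group the bound above is not good enough. Here \<open>B\<close> is a basis of the linear forms,
  and \<open>K\<close> is a Koszul complex for the variables after a linear change of coordinates.
\<close>

lemma acyclic_trivial_group:
  assumes g: "order G = 1" and d: "0 < d"
  shows "acyclic_at i d"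
  unfolding acyclic_at_def
proof (intro ballI impI)
  have "carrier G = {\<one>}"
    using g one_closed unfolding order_def by (metis card_1_singletonE singletonD)
  then have R_eq: "R = T" using act_one by (auto simp: invariants_iff)
  have deg: "total_deg b = 1" if "b \<in> B" for b using basis_element[OF that] g by simp
  have wt_B: "wt xs = int (length xs)" if "set xs \<subseteq> B" for xs
    using that by (induction xs) (simp_all add: deg)
  \<comment> \<open>The linear part of the ideal is the span of \<open>B\<close>, because
    \<open>B\<close> consists of linear forms, and every positive-degree polynomial is now an
    invariant.\<close>
  have var_span: "var_poly k \<in> cpoly.span B" if k: "k < n" for k
  proof -
    have "hcomp (\<lambda>_. 1) 1 s \<in> cpoly.span B" if "s \<in> ideal_of B {..<n}" for s
      using that
    proof induction
      case (step b t s)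
      have "hcomp (\<lambda>_. 1) 1 (b * t) = b * hcomp (\<lambda>_. 1) (1 - int (total_deg b)) t"
        by (rule hcomp_mult[OF hpolysD(2)[OF basis_element(2)[OF step.hyps(1)]]])
      then have *: "hcomp (\<lambda>_. 1) 1 (b * t) = b * hcomp (\<lambda>_. 1) 0 t" by (simp add: deg step.hyps(1))
      have "hcomp (\<lambda>_. 1) 0 t = const_poly (Poly_Mapping.lookup (hcomp (\<lambda>_. 1) 0 t) 0)"
        by (rule hpolys_deg1_0[OF hcomp_hpolys[OF step.hyps(2)]])
      then have "hcomp (\<lambda>_. 1) 1 (b * t) = const_poly (Poly_Mapping.lookup (hcomp (\<lambda>_. 1) 0 t) 0) * b"
        using * by (metis mult.commute)
      then show ?case
        unfolding hcomp_add using step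
        by (metis cpoly.span_add cpoly.span_base cpoly.span_scale)
    qed (simp add: cpoly.span_zero)
    moreover have "var_poly k \<in> ideal_of B {..<n}"
      using k by (intro invariant_ideal_B[of _ 1]) (simp_all add: R_eq)
    moreover have "hcomp (\<lambda>_. 1) 1 (var_poly k) = var_poly k"
      using hpolysD(2)[OF hpolys_var_deg1[of k "{..<n}"]] k by (intro hcomp_homogeneous) simp
    ultimately show ?thesis by metis
  qed
  \<comment> \<open>Chain rule: \<open>r k b\<close> is the derivative of the variable
    \<open>k\<close> with respect to the coordinate \<open>b\<close>, so \<open>D b\<close> is the
    partial derivative in the coordinates \<open>B\<close>.\<close>
  define r where "r k = cpoly.representation B (var_poly k)" for k :: nat
  define D where "D b p = (\<Sum>k<n. const_poly (r k b) * pd k p)" for b :: "nat cpoly" and p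
  have pd_const: "\<exists>a. pd k b = const_poly a" if "b \<in> B" for k b
  proof -
    have "b \<in> Th 1" using basis_element(2)[OF that] by (simp add: deg[OF that])
    from pd_hpolys[OF this] have "pd k b \<in> Th 0" by simp
    then show ?thesis using hpolys_deg1_0 by blast
  qed
  have b_eq: "b = (\<Sum>k<n. var_poly k * pd k b)" if "b \<in> B" for b
    using euler_identity[OF _ basis_element(2)[OF that]] by (simp add: deg[OF that])
  have D_basis: "D b b' = const_poly (if b = b' then 1 else 0)" if b': "b' \<in> B" for b b'
  proof -
    obtain a where a: "\<And>k. pd k b' = const_poly (a k)" using pd_const[OF b'] by metis
    have "cpoly.representation B b' = cpoly.representation B (\<Sum>k<n. const_poly (a k) * var_poly k)"
      by (subst b_eq[OF b']) (simp add: a mult.commute)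
    also have "\<dots> = (\<lambda>b. \<Sum>k<n. a k * r k b)"
      using independent_B var_span
      by (subst cpoly.representation_sum)
         (simp_all add: cpoly.span_scale cpoly.representation_scale r_def)
    finally have "(\<Sum>k<n. a k * r k b) = (if b = b' then 1 else 0)"
      using cpoly.representation_basis[OF independent_B b'] by metis
    then show ?thesis
      by (simp add: D_def a const_poly_mult[symmetric] const_poly_sum[symmetric] mult.commute)
  qed
  have pd_leibniz: "pd k (b * v) = b * pd k v + pd k b * v" if bB: "b \<in> B" and kn: "k < n" for k b v
  proof -
    obtain a where a: "\<And>k. pd k b = const_poly (a k)" using pd_const[OF bB] by metis
    have b: "b = (\<Sum>l<n. const_poly (a l) * var_poly l)"
      using b_eq[OF bB] by (simp add: a mult.commute)
    have pd_sum: "pd k (\<Sum>l\<in>I. f l) = (\<Sum>l\<in>I. pd k (f l))" for I :: "nat set" and f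
      by (induction I rule: infinite_finite_induct) (simp_all add: pd_add)
    have "pd k (b * v) = (\<Sum>l<n. const_poly (a l) * pd k (var_poly l * v))"
      by (subst b) (simp add: sum_distrib_right pd_sum mult.assoc pd_const_mult)
    also have "\<dots> = (\<Sum>l<n. const_poly (a l) * var_poly l * pd k v + (if l = k then const_poly (a k) * v else 0))"
      by (intro sum.cong) (auto simp: pd_var_mult distrib_left mult.assoc)
    also have "\<dots> = b * pd k v + const_poly (a k) * v"
      using kn by (subst b) (simp add: sum.distrib sum_distrib_right)
    finally show ?thesis by (simp add: a)
  qed
  have D_hpolys: "D b v \<in> Th (e - 1)" if "v \<in> Th e" for b v e
    unfolding D_def using pd_hpolys[OF that] by (intro hpolys_sum hpolys_const_mult) simp
  have D_euler: "(\<Sum>b\<in>B. b * D b v) = const_poly (of_int e) * v" if "v \<in> Th e" for v e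
  proof -
    have "(\<Sum>b\<in>B. b * D b v) = (\<Sum>b\<in>B. \<Sum>k<n. const_poly (r k b) * b * pd k v)"
      by (simp add: D_def sum_distrib_left mult_ac)
    also have "\<dots> = (\<Sum>k<n. \<Sum>b\<in>B. const_poly (r k b) * b * pd k v)" by (rule sum.swap)
    also have "\<dots> = (\<Sum>k<n. var_poly k * pd k v)"
    proof (rule sum.cong[OF refl])
      fix k assume "k \<in> {..<n}"
      then have "(\<Sum>b\<in>B. const_poly (r k b) * b) = var_poly k"
        unfolding r_def using independent_B var_span finite_B
        by (intro cpoly.sum_representation_eq) auto
      then show "(\<Sum>b\<in>B. const_poly (r k b) * b * pd k v) = var_poly k * pd k v"
        by (simp add: sum_distrib_right[symmetric])
    qed
    also have "\<dots> = const_poly (of_int e) * v"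
      using euler_identity[OF _ that] by simp
    finally show ?thesis .
  qed
  fix z assume z: "z \<in> K i d" "bd z = 0"
  let ?M = "\<lambda>xs. Th (d - int (length xs))"
  have K_eq: "K j d = alt_chains B ?M j" for j
  proof -
    have "c xs \<in> Th (d - wt xs) \<longleftrightarrow> c xs \<in> ?M xs" if "c xs \<noteq> 0 \<longrightarrow> set xs \<subseteq> B" for c xs
      using that wt_B[of xs] by (cases "c xs = 0") auto
    then show ?thesis unfolding K_def alt_chains_def by (intro Collect_cong) blast
  qed
  show "\<exists>y \<in> K (Suc i) d. bd y = z"
    unfolding K_eq bd_def
  \<comment> \<open>Polynomial degree plus exterior length is \<open>d\<close> on every chain, so
    the Euler operator is multiplication by \<open>d > 0\<close>.\<close>
  proof (rule kT.kos_exact[where D = D and w = "\<lambda>_. 1" and L = "\<lambda>v. const_poly (1 / of_int d) * v"])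
    show "z \<in> alt_chains B ?M i" using z(1) K_eq by simp
    show "kos B (*) z = 0" using z(2) by (simp add: bd_def)
    show "D b (b' * v) = b' * D b v + (if b = b' then v else 0)" if "b' \<in> B" for b b' v
    proof -
      have "D b (b' * v) = (\<Sum>k<n. b' * (const_poly (r k b) * pd k v) + const_poly (r k b) * pd k b' * v)"
        unfolding D_def by (intro sum.cong) (simp_all add: pd_leibniz[OF that] algebra_simps)
      also have "\<dots> = b' * D b v + D b b' * v"
        by (simp add: D_def sum.distrib sum_distrib_left sum_distrib_right)
      finally show ?thesis by (simp add: D_basis[OF that])
    qed
    show "D b v \<in> ?M (us @ b # vs)" if "v \<in> ?M (us @ vs)" for b us vs v
      using D_hpolys[OF that] by (simp add: algebra_simps)
    show "const_poly (1 / of_int d) *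
        ((\<Sum>b\<in>B. const_poly 1 * (b * D b (z xs))) + const_poly (\<Sum>x\<leftarrow>xs. 1) * z xs) = z xs" for xs
    proof -
      have "z xs \<in> ?M xs" using alt_chainsD(2) z(1) K_eq by blast
      from D_euler[OF this]
      have "(\<Sum>b\<in>B. const_poly 1 * (b * D b (z xs))) + const_poly (\<Sum>x\<leftarrow>xs. 1) * z xs =
          const_poly (of_int d) * z xs"
        by (simp add: sum_list_triv distrib_right[symmetric] const_poly_add[symmetric])
      then have "const_poly (1 / of_int d) *
        ((\<Sum>b\<in>B. const_poly 1 * (b * D b (z xs))) + const_poly (\<Sum>x\<leftarrow>xs. 1) * z xs) =
        const_poly (1 / of_int d * of_int d) * z xs"
        by (simp only: const_poly_mult mult.assoc)
      then show ?thesis using d by simp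
    qed
  qed (simp_all add: finite_B D_def pd_diff pd_const_mult hpolys_const_mult mult.left_commute
      right_diff_distrib sum_subtractf sum_distrib_left)
qed

text \<open>The Reynolds operator, applied to each coefficient, commutes with multiplication by the
  invariants in \<open>B\<close> and fixes \<open>z\<close>; so it carries a bounding chain over
  \<open>T\<close> to one over \<open>R\<close>.\<close>

lemma koszul_invariants_acyclic:
  assumes z: "z \<in> alt_chains B (\<lambda>xs. R \<inter> Th (d - wt xs)) i" "bd z = 0" and acyc: "acyclic_at i d"
  shows "\<exists>y \<in> alt_chains B (\<lambda>_. R) (Suc i). bd y = z"
proof -
  have "z \<in> K i d" using z(1) by (auto simp: K_def alt_chains_def)
  then obtain y where y: "y \<in> K (Suc i) d" "bd y = z" using acyc z(2) by (auto simp: acyclic_at_def)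
  have "(\<lambda>xs. reynolds (y xs)) \<in> alt_chains B (\<lambda>_. R) (Suc i)"
    by (rule alt_chains_comp[OF y(1)[unfolded K_def]])
       (auto simp: reynolds_uminus reynolds_zero intro: reynolds_invariant hpolysD)
  moreover have "bd (\<lambda>xs. reynolds (y xs)) = z"
  proof
    fix xs
    have "bd (\<lambda>xs. reynolds (y xs)) xs = reynolds (bd y xs)"
      by (simp add: bd_def kos_def reynolds_sum reynolds_mult basis_element(1))
    also have "\<dots> = z xs"
      using alt_chainsD(2)[OF z(1), of xs] by (simp add: y(2) reynolds_id)
    finally show "bd (\<lambda>xs. reynolds (y xs)) xs = z xs" .
  qed
  ultimately show ?thesis by blast
qed

end

section \<open>Comparison with a free resolution\<close>

lemma lookup_smult_free: "Poly_Mapping.lookup (smult_free s v) i = s * Poly_Mapping.lookup v i"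
  by (simp add: smult_free_def map.rep_eq when_def)

lemma smult_free_add: "smult_free s (u + v) = smult_free s u + smult_free s v"
  by (rule poly_mapping_eqI) (simp add: lookup_smult_free lookup_add distrib_left)

lemma smult_free_diff: "smult_free s (u - v) = smult_free s u - smult_free s v"
  by (rule poly_mapping_eqI) (simp add: lookup_smult_free lookup_minus right_diff_distrib)

lemma smult_free_left_commute: "smult_free s (smult_free t v) = smult_free t (smult_free s v)"
  by (rule poly_mapping_eqI) (simp add: lookup_smult_free mult.left_commute)

lemma vector_space_smult_free: "vector_space (\<lambda>c. smult_free (const_poly c))"
proof
  show "smult_free (const_poly a) (x + y) = smult_free (const_poly a) x + smult_free (const_poly a) y"
    for a and x y :: "'x free_elem" by (rule smult_free_add)
  show "smult_free (const_poly (a + b)) x = smult_free (const_poly a) x + smult_free (const_poly b) x"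
    for a b and x :: "'x free_elem"
    by (rule poly_mapping_eqI) (simp add: lookup_smult_free lookup_add distrib_right const_poly_add)
  show "smult_free (const_poly a) (smult_free (const_poly b) x) = smult_free (const_poly (a * b)) x"
    for a b and x :: "'x free_elem"
    by (rule poly_mapping_eqI) (simp only: lookup_smult_free const_poly_mult mult.assoc)
  show "smult_free (const_poly 1) x = x" for x :: "'x free_elem"
    by (rule poly_mapping_eqI) (simp add: lookup_smult_free)
qed

lemma koszul_smult_free:
  "koszul (\<lambda>c. smult_free (const_poly c)) (\<lambda>b. smult_free (var_poly b))"
  by (intro koszul.intro vector_space_smult_free koszul_axioms.intro smult_free_diff
      smult_free_left_commute)

lemma free_mod_iff:
  "v \<in> free_mod B X \<longleftrightarrow> Poly_Mapping.keys v \<subseteq> X \<and> (\<forall>i. Poly_Mapping.lookup v i \<in> polys B)"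
  by (simp add: free_mod_def)

lemma free_deg_iff:
  "v \<in> free_deg w B X e d \<longleftrightarrow>
    Poly_Mapping.keys v \<subseteq> X \<and> (\<forall>i. Poly_Mapping.lookup v i \<in> hpolys B w (d - e i))"
proof -
  have "homogeneous w (d - e i) (Poly_Mapping.lookup v i)" if "i \<notin> Poly_Mapping.keys v" for i
    using that by (simp add: in_keys_iff homogeneous_def)
  then show ?thesis by (auto simp: free_deg_def free_mod_def hpolys_def)
qed

lemma free_deg_subset: "free_deg w B X e d \<subseteq> free_mod B X"
  by (auto simp: free_deg_def)

lemma keys_subset_iff: "Poly_Mapping.keys v \<subseteq> X \<longleftrightarrow> (\<forall>i. i \<notin> X \<longrightarrow> Poly_Mapping.lookup v i = 0)"
  by (auto simp: in_keys_iff)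

lemma subgrp_free_mod [simp]: "subgrp (free_mod B X)"
  by (auto simp: subgrp_def free_mod_iff keys_subset_iff lookup_minus intro: polys_diff)

lemma subgrp_free_deg [simp]: "subgrp (free_deg w B X e d)"
  by (auto simp: subgrp_def free_deg_iff keys_subset_iff lookup_minus intro: hpolys_diff)

lemma smult_free_mod: "s \<in> polys B \<Longrightarrow> v \<in> free_mod B X \<Longrightarrow> smult_free s v \<in> free_mod B X"
  unfolding free_mod_iff keys_subset_iff by (simp add: lookup_smult_free polys_mult)

lemma smult_free_deg:
  assumes "s \<in> hpolys B w k" "v \<in> free_deg w B X e d"
  shows "smult_free s v \<in> free_deg w B X e (d + k)"
  unfolding free_deg_iff keys_subset_iff
proof (intro conjI allI impI)
  fix i
  have "s * Poly_Mapping.lookup v i \<in> hpolys B w (k + (d - e i))"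
    using assms by (intro hpolys_mult) (simp_all add: free_deg_iff)
  then show "Poly_Mapping.lookup (smult_free s v) i \<in> hpolys B w (d + k - e i)"
    by (simp add: lookup_smult_free algebra_simps)
qed (use assms(2) in \<open>auto simp: free_deg_iff keys_subset_iff lookup_smult_free\<close>)

lemma add_eq_0_poly_mapping: "m + m' = 0 \<longleftrightarrow> m = 0 \<and> m' = (0 :: 'x \<Rightarrow>\<^sub>0 nat)"
  by (auto simp: poly_mapping_eq_iff fun_eq_iff lookup_add)

lemma lookup_mult_0:
  "Poly_Mapping.lookup (p * q) 0 = Poly_Mapping.lookup p 0 * Poly_Mapping.lookup (q :: 'x cpoly) 0"
proof (induction p rule: cpoly_induct)
  case (single m c)
  show ?case
    by (induction q rule: cpoly_induct)
       (auto simp: mult_single lookup_single when_def distrib_left lookup_add add_eq_0_poly_mapping)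
qed (simp_all add: distrib_right lookup_add)

lemma lookup_var_poly_0: "Poly_Mapping.lookup (var_poly x) 0 = 0"
proof -
  have "Poly_Mapping.single x (1 :: nat) \<noteq> 0"
    by (metis lookup_single_eq lookup_zero one_neq_zero)
  then show ?thesis by (simp add: var_poly_def lookup_single when_def)
qed

lemma hpolys_0_eq_0:
  assumes "p \<in> hpolys B w 0" "\<And>b. b \<in> B \<Longrightarrow> w b > 0" "Poly_Mapping.lookup p 0 = 0"
  shows "p = 0"
proof (rule poly_mapping_eqI)
  fix m
  have "m = 0" if m: "m \<in> Poly_Mapping.keys p"
  proof -
    have "mon_weight w m = 0" "Poly_Mapping.keys m \<subseteq> B"
      using assms(1) m by (auto simp: hpolys_def polys_def homogeneous_def)
    then have "w x = 0" "x \<in> B" if "x \<in> Poly_Mapping.keys m" for x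
      using that by (auto simp: mon_weight_def in_keys_iff)
    then have "x \<notin> Poly_Mapping.keys m" for x using assms(2)[of x] by auto
    then show "m = 0" by (intro poly_mapping_eqI) (simp add: in_keys_iff)
  qed
  then show "Poly_Mapping.lookup p m = Poly_Mapping.lookup 0 m"
    using assms(3) by (cases "m \<in> Poly_Mapping.keys p") (auto simp: in_keys_iff)
qed

section \<open>A free resolution tensored with the exterior algebra of E\<close>

locale invariant_resolution =
  minimal_basis G n \<rho> E B + graded_free_resolution "invariants G n \<rho>" B X e \<epsilon> \<delta>
  for G :: "('g, 'm) monoid_scheme" (structure) and n :: nat and \<rho> :: "'g \<Rightarrow> complex mat"
    and E B :: "nat cpoly set" and X :: "nat \<Rightarrow> nat set" and e :: "nat \<Rightarrow> nat \<Rightarrow> int"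
    and \<epsilon> :: "nat cpoly free_elem \<Rightarrow> nat cpoly"
    and \<delta> :: "nat \<Rightarrow> nat cpoly free_elem \<Rightarrow> nat cpoly free_elem"
begin

interpretation kS: koszul "\<lambda>c. smult_free (const_poly c)" B
    "\<lambda>b. smult_free (var_poly b :: nat cpoly cpoly)"
  by (rule koszul_smult_free)

abbreviation "F i \<equiv> free_mod B (X i)"

abbreviation "Fd i d \<equiv> free_deg total_deg B (X i) (e i) d"

lemma del_mem: "v \<in> F (Suc i) \<Longrightarrow> \<delta> i v \<in> F i"
  using exact_0 exact_Suc[of "i - 1"] by (cases i) auto

lemma eps_mem: "v \<in> F 0 \<Longrightarrow> \<epsilon> v \<in> R"
  using eps_surj by blast

lemma eps_diff:
  assumes "u \<in> F 0" "v \<in> F 0"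
  shows "\<epsilon> (u - v) = \<epsilon> u - \<epsilon> v"
  using eps_add[OF subgrp_diff[OF subgrp_free_mod assms] assms(2)] by simp

lemma del_diff:
  assumes "u \<in> F (Suc i)" "v \<in> F (Suc i)"
  shows "\<delta> i (u - v) = \<delta> i u - \<delta> i v"
  using del_add[OF subgrp_diff[OF subgrp_free_mod assms] assms(2)] by simp

lemma eps_zero: "\<epsilon> 0 = 0"
  using eps_diff[of 0 0] by (simp add: subgrp_zero)

lemma del_zero: "\<delta> i 0 = 0"
  using del_diff[of 0 i 0] by (simp add: subgrp_zero)

lemma eps_uminus: "v \<in> F 0 \<Longrightarrow> \<epsilon> (- v) = - \<epsilon> v"
  using eps_diff[of 0 v] by (simp add: subgrp_zero eps_zero)

lemma del_uminus: "v \<in> F (Suc i) \<Longrightarrow> \<delta> i (- v) = - \<delta> i v"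
  using del_diff[of 0 i v] by (simp add: subgrp_zero del_zero)

lemma eps_sum:
  assumes "\<And>x. x \<in> I \<Longrightarrow> f x \<in> F 0"
  shows "\<epsilon> (\<Sum>x\<in>I. f x) = (\<Sum>x\<in>I. \<epsilon> (f x))"
  using assms
proof (induction I rule: infinite_finite_induct)
  case (insert x I)
  then have "sum f I \<in> F 0" by (intro subgrp_sum) auto
  then show ?case using insert by (simp add: eps_add)
qed (simp_all add: eps_zero)

lemma del_sum:
  assumes "\<And>x. x \<in> I \<Longrightarrow> f x \<in> F (Suc i)"
  shows "\<delta> i (\<Sum>x\<in>I. f x) = (\<Sum>x\<in>I. \<delta> i (f x))"
  using assms
proof (induction I rule: infinite_finite_induct)
  case (insert x I)
  then have "sum f I \<in> F (Suc i)" by (intro subgrp_sum) auto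
  then show ?case using insert by (simp add: del_add)
qed (simp_all add: del_zero)

lemma del_del: "v \<in> F (Suc (Suc i)) \<Longrightarrow> \<delta> i (\<delta> (Suc i) v) = 0"
  using exact_Suc[of i] by blast

lemma eps_del: "v \<in> F (Suc 0) \<Longrightarrow> \<epsilon> (\<delta> 0 v) = 0"
  using exact_0 by auto

text \<open>
  \<open>free_chains i j\<close> is \<open>F\<^sub>i \<otimes> \<Lambda>\<^sup>j(E)\<close>, and \<open>free_chains_deg d i j\<close> is its degree \<open>d\<close> part.
\<close>

definition free_chains :: "nat \<Rightarrow> nat \<Rightarrow> (nat cpoly list \<Rightarrow> nat cpoly free_elem) set" where
  "free_chains i j = alt_chains B (\<lambda>_. F i) j"

definition free_chains_deg :: "int \<Rightarrow> nat \<Rightarrow> nat \<Rightarrow> (nat cpoly list \<Rightarrow> nat cpoly free_elem) set" where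
  "free_chains_deg d i j = alt_chains B (\<lambda>xs. Fd i (d - wt xs)) j"

definition kos_free :: "(nat cpoly list \<Rightarrow> nat cpoly free_elem) \<Rightarrow> nat cpoly list \<Rightarrow> nat cpoly free_elem" where
  "kos_free = kos B (\<lambda>b. smult_free (var_poly b))"

definition cyc :: "nat \<Rightarrow> (nat cpoly list \<Rightarrow> nat cpoly free_elem) \<Rightarrow> bool" where
  "cyc i c \<longleftrightarrow> (case i of 0 \<Rightarrow> \<forall>xs. \<epsilon> (c xs) = 0 | Suc k \<Rightarrow> \<forall>xs. \<delta> k (c xs) = 0)"

lemma subgrp_free_chains [simp]: "subgrp (free_chains i j)"
  unfolding free_chains_def by (rule subgrp_alt_chains) simp

lemma free_chains_mem: "c \<in> free_chains i j \<Longrightarrow> c xs \<in> F i"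
  unfolding free_chains_def by (rule alt_chainsD(2))

lemma free_chains_deg_mem: "c \<in> free_chains_deg d i j \<Longrightarrow> c xs \<in> Fd i (d - wt xs)"
  unfolding free_chains_deg_def by (rule alt_chainsD(2))

lemma free_chains_deg_subset: "free_chains_deg d i j \<subseteq> free_chains i j"
  using free_deg_subset unfolding free_chains_def free_chains_deg_def alt_chains_def by fast

lemma kos_free_diff: "kos_free (u - v) = kos_free u - kos_free v"
  unfolding kos_free_def by (rule kS.kos_diff)

lemma kos_free_kos_free: "c \<in> free_chains i j \<Longrightarrow> kos_free (kos_free c) = 0"
  unfolding kos_free_def free_chains_def by (rule kS.kos_kos[OF alt_chainsD(1)])

lemma kos_free_chains: "c \<in> free_chains i (Suc j) \<Longrightarrow> kos_free c \<in> free_chains i j"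
  unfolding kos_free_def free_chains_def
  by (erule kos_alt_chains) (simp_all add: smult_free_mod kS.a_uminus)

text \<open>The Koszul complex of the variables of \<open>S\<close>, weighted by their degrees. On
  coordinate \<open>k\<close> the Euler operator multiplies by
  \<open>(d - wt xs - e i k) + wt xs = d - e i k\<close>; the excluded case consists of the
  constants.\<close>

lemma kos_free_exact:
  assumes c: "c \<in> free_chains_deg d i j" and cyc: "kos_free c = 0"
    and nz: "\<And>xs k. Poly_Mapping.lookup (c xs) k \<noteq> 0 \<Longrightarrow> e i k \<noteq> d"
  shows "\<exists>y \<in> free_chains_deg d i (Suc j). kos_free y = c"
proof -
  define D :: "nat cpoly \<Rightarrow> nat cpoly free_elem \<Rightarrow> nat cpoly free_elem"
    where "D b = Poly_Mapping.map (pd b)" for b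
  define L :: "nat cpoly free_elem \<Rightarrow> nat cpoly free_elem"
    where "L = Poly_Mapping.mapp (\<lambda>k q. const_poly (1 / of_int (d - e i k)) * q)"
  have lookup_D: "Poly_Mapping.lookup (D b v) k = pd b (Poly_Mapping.lookup v k)" for b v k
    by (simp add: D_def map.rep_eq when_def)
  have lookup_L: "Poly_Mapping.lookup (L v) k =
      const_poly (1 / of_int (d - e i k)) * Poly_Mapping.lookup v k" for v k
    by (simp add: L_def lookup_mapp when_def in_keys_iff)
  have wt_eq: "const_poly (\<Sum>x\<leftarrow>xs. of_nat (total_deg x)) = const_poly (of_int (wt xs))" for xs
    by (induction xs) (simp_all add: const_poly_add)
  show ?thesis
    unfolding free_chains_deg_def kos_free_def
  proof (rule kS.kos_exact[where D = D and L = L and w = "\<lambda>b. of_nat (total_deg b)"])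
    show "c \<in> alt_chains B (\<lambda>xs. Fd i (d - wt xs)) j" using c by (simp add: free_chains_deg_def)
    show "kos B (\<lambda>b. smult_free (var_poly b)) c = 0" using cyc by (simp only: kos_free_def)
    show "D b (u - v) = D b u - D b v" for b u v
      by (rule poly_mapping_eqI) (simp only: lookup_D lookup_minus pd_diff)
    show "D b (smult_free (const_poly r) v) = smult_free (const_poly r) (D b v)" for b r v
      by (rule poly_mapping_eqI) (simp only: lookup_D lookup_smult_free pd_const_mult)
    show "D b (smult_free (var_poly b') v) = smult_free (var_poly b') (D b v) + (if b = b' then v else 0)"
      for b b' v
      by (rule poly_mapping_eqI)
         (simp add: lookup_D lookup_smult_free pd_var_mult lookup_add)
    show "D b v \<in> Fd i (d - wt (us @ b # vs))" if "v \<in> Fd i (d - wt (us @ vs))" for b us vs v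
      unfolding free_deg_iff keys_subset_iff
    proof (intro conjI allI impI)
      fix k
      have "Poly_Mapping.lookup v k \<in> hpolys B total_deg (d - wt (us @ vs) - e i k)"
        using that by (simp only: free_deg_iff)
      from pd_hpolys[OF this, of b]
      show "Poly_Mapping.lookup (D b v) k \<in> hpolys B total_deg (d - wt (us @ b # vs) - e i k)"
        by (simp add: lookup_D algebra_simps)
    qed (use that in \<open>auto simp: free_deg_iff keys_subset_iff lookup_D\<close>)
    show "smult_free (const_poly r) v \<in> Fd i (d - wt xs)" if "v \<in> Fd i (d - wt xs)" for r xs v
      using smult_free_deg[OF hpolys_const that] by simp
    show "L (u - v) = L u - L v" for u v
      by (rule poly_mapping_eqI) (simp only: lookup_L lookup_minus right_diff_distrib)
    show "L (smult_free (var_poly b) v) = smult_free (var_poly b) (L v)" for b v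
      by (rule poly_mapping_eqI) (simp only: lookup_L lookup_smult_free mult.left_commute)
    show "L v \<in> Fd i (d - wt xs)" if "v \<in> Fd i (d - wt xs)" for xs v
      using that unfolding free_deg_iff keys_subset_iff by (simp add: lookup_L hpolys_const_mult)
    fix xs
    show "L ((\<Sum>b\<in>B. smult_free (const_poly (of_nat (total_deg b))) (smult_free (var_poly b) (D b (c xs)))) +
        smult_free (const_poly (\<Sum>x\<leftarrow>xs. of_nat (total_deg x))) (c xs)) = c xs" (is "L ?N = _")
    proof (rule poly_mapping_eqI)
      fix k
      let ?q = "Poly_Mapping.lookup (c xs) k"
      have "?q \<in> hpolys B total_deg (d - wt xs - e i k)"
        using free_chains_deg_mem[OF c, of xs] by (simp only: free_deg_iff)
      from euler_identity[OF finite_B this]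
      have "Poly_Mapping.lookup ?N k = const_poly (of_int (d - wt xs - e i k)) * ?q + const_poly (of_int (wt xs)) * ?q"
        by (simp only: lookup_add lookup_sum lookup_smult_free lookup_D wt_eq)
      also have "\<dots> = const_poly (of_int (d - e i k)) * ?q"
        unfolding distrib_right[symmetric] const_poly_add[symmetric] by simp
      finally have *: "Poly_Mapping.lookup (L ?N) k =
          const_poly (1 / of_int (d - e i k) * of_int (d - e i k)) * ?q"
        by (simp only: lookup_L const_poly_mult mult.assoc)
      show "Poly_Mapping.lookup (L ?N) k = ?q"
      proof (cases "?q = 0")
        case False
        then have "of_int (d - e i k) \<noteq> (0 :: complex)"
          using nz[OF False] by (metis eq_iff_diff_eq_0 of_int_eq_0_iff)
        then show ?thesis unfolding * by simp
      qed (simp only: *, simp)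
    qed
  qed (simp_all add: finite_B)
qed

text \<open>A nonempty list from \<open>B\<close> has positive weight, so a nonzero coordinate
  forces \<open>d - e i k > 0\<close>.\<close>

lemma kos_free_exact_Suc:
  assumes c: "c \<in> free_chains_deg d i (Suc j)" and cyc: "kos_free c = 0"
  shows "\<exists>y \<in> free_chains_deg d i (Suc (Suc j)). c = kos_free y"
proof -
  have "e i k \<noteq> d" if nz: "Poly_Mapping.lookup (c xs) k \<noteq> 0" for xs k
  proof -
    have "c xs \<noteq> 0" using nz by auto
    then have xs: "length xs = Suc j" "set xs \<subseteq> B"
      using alt_chainsD(3,4)[OF c[unfolded free_chains_deg_def]] by blast+
    then obtain b ys where "xs = b # ys" "b \<in> B" by (cases xs) auto
    then have "0 < wt xs" using basis_element(3)[of b] wt_nonneg[of ys] by simp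
    moreover have "Poly_Mapping.lookup (c xs) k \<in> hpolys B total_deg (d - wt xs - e i k)"
      using free_chains_deg_mem[OF c, of xs] by (simp only: free_deg_iff)
    then have "\<not> d - wt xs - e i k < 0" using hpolys_negative nz by blast
    ultimately show ?thesis by simp
  qed
  then show ?thesis using kos_free_exact[OF c cyc] by metis
qed

lemma del_free_chains_deg: "c \<in> free_chains_deg d (Suc i) j \<Longrightarrow> (\<lambda>xs. \<delta> i (c xs)) \<in> free_chains_deg d i j"
  unfolding free_chains_deg_def
  by (erule alt_chains_comp[where \<phi> = "\<delta> i"])
     (simp_all add: del_deg del_uminus del_zero subsetD[OF free_deg_subset])

lemma del_kos_free:
  assumes "c \<in> free_chains (Suc i) (Suc j)"
  shows "(\<lambda>xs. \<delta> i (kos_free c xs)) = kos_free (\<lambda>xs. \<delta> i (c xs))"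
proof
  fix xs
  show "\<delta> i (kos_free c xs) = kos_free (\<lambda>xs. \<delta> i (c xs)) xs"
    unfolding kos_free_def kos_def using free_chains_mem[OF assms]
    by (subst del_sum) (simp_all add: smult_free_mod del_smult)
qed

lemma cyc_exact:
  assumes c: "c \<in> free_chains i j" and "cyc i c"
  shows "\<exists>y \<in> free_chains (Suc i) j. c = (\<lambda>xs. \<delta> i (y xs))"
proof -
  have "c xs \<in> \<delta> i ` F (Suc i)" for xs
    using assms(2) free_chains_mem[OF c, of xs] exact_0 exact_Suc[of "i - 1"]
    by (cases i) (auto simp: cyc_def)
  then have "\<exists>y \<in> alt_chains B (\<lambda>_. F (Suc i)) j. \<forall>xs. \<delta> i (y xs) = c xs"
    using c[unfolded free_chains_def]
    by (intro alt_chains_lift[OF vector_space_smult_free vector_space_smult_free])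
       (auto simp: smult_free_mod del_diff del_smult)
  then show ?thesis unfolding free_chains_def by (metis ext)
qed

text \<open>The bottom of the staircase, where Koszul homology enters: \<open>\<epsilon>\<close>
  maps \<open>z\<close> to a Koszul cycle over \<open>R\<close> of degree \<open>d\<close>, which
  bounds, and the bounding chain lifts because \<open>\<epsilon>\<close> is onto.\<close>

lemma eps_exact:
  assumes acyc: "acyclic_at N d" and z: "z \<in> free_chains_deg d 0 N" and cyc: "cyc 0 (kos_free z)"
  shows "\<exists>y \<in> free_chains 0 (Suc N). cyc 0 (z - kos_free y)"
proof -
  have zC: "z \<in> free_chains 0 N" using z free_chains_deg_subset by blast
  have eps_kos_free: "\<epsilon> (kos_free c xs) = bd (\<lambda>xs. \<epsilon> (c xs)) xs" if "c \<in> free_chains 0 j" for c j xs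
    unfolding kos_free_def kos_def bd_def using free_chains_mem[OF that]
    by (subst eps_sum) (simp_all add: smult_free_mod eps_smult subst_poly_var)
  have "(\<lambda>xs. \<epsilon> (z xs)) \<in> alt_chains B (\<lambda>xs. R \<inter> Th (d - wt xs)) N"
  proof (rule alt_chains_comp[OF z[unfolded free_chains_deg_def]])
    fix xs v assume v: "v \<in> Fd 0 (d - wt xs)"
    then have "\<epsilon> v \<in> R" using free_deg_subset eps_mem by blast
    then show "\<epsilon> v \<in> R \<inter> Th (d - wt xs)"
      using eps_deg[OF v] invariants_polys by (simp add: hpolys_def)
    show "\<epsilon> (- v) = - \<epsilon> v" using v free_deg_subset eps_uminus by blast
  qed (rule eps_zero)
  moreover have "bd (\<lambda>xs. \<epsilon> (z xs)) = 0"
  proof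
    fix xs
    show "bd (\<lambda>xs. \<epsilon> (z xs)) xs = 0 xs"
      using cyc eps_kos_free[OF zC, of xs] by (simp add: cyc_def)
  qed
  ultimately obtain w where w: "w \<in> alt_chains B (\<lambda>_. R) (Suc N)" "bd w = (\<lambda>xs. \<epsilon> (z xs))"
    using koszul_invariants_acyclic acyc by blast
  have "w xs \<in> \<epsilon> ` F 0" for xs using alt_chainsD(2)[OF w(1)] eps_surj by blast
  then have "\<exists>y \<in> alt_chains B (\<lambda>_. F 0) (Suc N). \<forall>xs. \<epsilon> (y xs) = w xs"
    using w(1)
    by (intro alt_chains_lift[OF vector_space_smult_free cpoly.vector_space_axioms])
       (auto simp: smult_free_mod eps_diff eps_smult subst_poly_const)
  then obtain y where y: "y \<in> free_chains 0 (Suc N)" "\<And>xs. \<epsilon> (y xs) = w xs" unfolding free_chains_def by blast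
  have "\<epsilon> ((z - kos_free y) xs) = 0" for xs
  proof -
    have "\<epsilon> ((z - kos_free y) xs) = \<epsilon> (z xs) - \<epsilon> (kos_free y xs)"
      using free_chains_mem[OF zC] free_chains_mem[OF kos_free_chains[OF y(1)]] by (simp add: eps_diff)
    also have "\<epsilon> (kos_free y xs) = bd w xs" using eps_kos_free[OF y(1)] by (simp add: y(2))
    finally show ?thesis by (simp add: w(2))
  qed
  then show ?thesis using y(1) by (auto simp: cyc_def)
qed

text \<open>Balancing of Tor, in the double complex of a resolution of \<open>R\<close> and the
  Koszul complex of \<open>S\<close>, along the antidiagonal \<open>i + j = Suc q\<close>. The
  resolution supplies exactness in the \<open>\<delta>\<close> direction in every degree.\<close>

lemma chase:
  assumes "acyclic_at (Suc q) d" and z: "z \<in> free_chains_deg d q (Suc 0)" "cyc q (kos_free z)"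
  shows "\<exists>y \<in> free_chains q (Suc (Suc 0)). cyc q (z - kos_free y)"
proof (rule double_complex_chase[where C = free_chains and D = "free_chains_deg d" and \<kappa> = kos_free and N = "Suc q"
        and del = "\<lambda>i c xs. \<delta> i (c xs)" and cyc = cyc])
  show "free_chains_deg d i j \<subseteq> free_chains i j" for i j by (rule free_chains_deg_subset)
  show "kos_free (u - v) = kos_free u - kos_free v" for u v by (rule kos_free_diff)
  show "kos_free c \<in> free_chains i j"
    if "c \<in> free_chains i (Suc j)" for i j c
    by (rule kos_free_chains[OF that])
  show "kos_free (kos_free c) = 0"
    if "c \<in> free_chains i j" for i j c
    by (rule kos_free_kos_free[OF that])
  show "\<exists>y \<in> free_chains_deg d i (Suc (Suc j)). c = kos_free y"
    if "c \<in> free_chains_deg d i (Suc j)" "kos_free c = 0" for i j c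
    by (rule kos_free_exact_Suc[OF that])
  show "(\<lambda>xs. \<delta> i ((u - v) xs)) = (\<lambda>xs. \<delta> i (u xs)) - (\<lambda>xs. \<delta> i (v xs))"
    if "u \<in> free_chains (Suc i) j" "v \<in> free_chains (Suc i) j" for i j u v
    by (rule ext) (simp only: minus_apply del_diff[OF free_chains_mem[OF that(1)] free_chains_mem[OF that(2)]])
  show "(\<lambda>xs. \<delta> i (c xs)) \<in> free_chains_deg d i j"
    if "c \<in> free_chains_deg d (Suc i) j" for i j c
    by (rule del_free_chains_deg[OF that])
  show "(\<lambda>xs. \<delta> i (kos_free c xs)) = kos_free (\<lambda>xs. \<delta> i (c xs))"
    if "c \<in> free_chains (Suc i) (Suc j)" for i j c
    by (rule del_kos_free[OF that])
  show "cyc (Suc i) c \<longleftrightarrow> (\<lambda>xs. \<delta> i (c xs)) = 0" for i c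
    by (simp only: cyc_def nat.case fun_eq_iff zero_fun_apply)
  show "cyc i (\<lambda>xs. \<delta> i (c xs))" if "c \<in> free_chains (Suc i) j" for i j c
    using free_chains_mem[OF that] by (cases i) (simp_all add: cyc_def eps_del del_del)
  show "\<exists>y \<in> free_chains (Suc i) j. c = (\<lambda>xs. \<delta> i (y xs))" if "c \<in> free_chains i j" "cyc i c" for i j c
    by (rule cyc_exact[OF that])
  show "\<exists>y \<in> free_chains 0 (Suc (Suc q)). cyc 0 (c - kos_free y)"
    if "c \<in> free_chains_deg d 0 (Suc q)" "cyc 0 (kos_free c)" for c
    by (rule eps_exact[OF assms(1) that])
  show "z \<in> free_chains_deg d q (Suc 0)" "cyc q (kos_free z)" by (fact z)+
qed simp_all

section \<open>Tor and the degree bound\<close>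

lemma del_aug_free:
  assumes a: "a \<in> aug_free B (X (Suc q))"
  shows "\<delta> q a \<in> aug_free B (X q)"
proof -
  let ?K = "Poly_Mapping.keys a"
  have aF: "a \<in> F (Suc q)" and a0: "\<And>i. Poly_Mapping.lookup (Poly_Mapping.lookup a i) 0 = 0"
    using a by (auto simp: aug_free_def)
  have aP: "Poly_Mapping.lookup a i \<in> polys B" for i using aF by (simp add: free_mod_iff)
  have sF: "Poly_Mapping.single i 1 \<in> F (Suc q)" if "i \<in> ?K" for i
    using aF that by (auto simp: free_mod_iff lookup_single when_def)
  have "a = (\<Sum>i\<in>?K. smult_free (Poly_Mapping.lookup a i) (Poly_Mapping.single i 1))"
    by (rule poly_mapping_eqI)
       (auto simp: lookup_sum lookup_smult_free lookup_single when_def in_keys_iff if_distrib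
          cong: if_cong)
  then have "\<delta> q a = \<delta> q (\<Sum>i\<in>?K. smult_free (Poly_Mapping.lookup a i) (Poly_Mapping.single i 1))"
    by (rule arg_cong)
  also have "\<dots> = (\<Sum>i\<in>?K. smult_free (Poly_Mapping.lookup a i) (\<delta> q (Poly_Mapping.single i 1)))"
    using aP sF by (subst del_sum) (simp_all add: smult_free_mod del_smult)
  finally have "Poly_Mapping.lookup (Poly_Mapping.lookup (\<delta> q a) k) 0 = 0" for k
    by (simp add: lookup_sum lookup_smult_free lookup_mult_0 a0)
  then show ?thesis using del_mem[OF aF] by (simp add: aug_free_def)
qed

text \<open>\<open>tor_nonzero\<close> asserts only that boundaries and cycles differ, so refuting
  it takes this inclusion too.\<close>

lemma boundary_is_cycle:
  assumes "z \<in> tor_boundaries B X e \<delta> (Suc q) d"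
  shows "z \<in> tor_cycles B X e \<delta> (Suc q) d"
proof -
  obtain y where z: "z \<in> Fd (Suc q) d" and y: "y \<in> F (Suc (Suc q))"
    and aug: "z - \<delta> (Suc q) y \<in> aug_free B (X (Suc q))"
    using assms by (auto simp: tor_boundaries_def)
  have zF: "z \<in> F (Suc q)" using z free_deg_subset by blast
  have "\<delta> q (z - \<delta> (Suc q) y) = \<delta> q z"
    using del_diff[OF zF del_mem[OF y]] del_del[OF y] by simp
  then show ?thesis using del_aug_free[OF aug] z by (simp add: tor_cycles_def)
qed

text \<open>Modulo the augmentation ideal \<open>z\<close> is a cycle, so
  \<open>\<delta> q z\<close> is a Koszul boundary of some \<open>z'\<close>. The chase replaces
  \<open>z'\<close>, up to a Koszul boundary, by the \<open>\<delta>\<close>-image of a chain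
  \<open>y\<close>. Then \<open>z - kos_free y []\<close> is a true cycle of the resolution, hence a
  boundary, and \<open>kos_free y []\<close> vanishes modulo the augmentation ideal.\<close>

lemma cycle_is_boundary:
  assumes acyc: "acyclic_at (Suc q) d" and "z \<in> tor_cycles B X e \<delta> (Suc q) d"
  shows "z \<in> tor_boundaries B X e \<delta> (Suc q) d"
proof -
  have z: "z \<in> Fd (Suc q) d" and aug: "\<delta> q z \<in> aug_free B (X q)"
    using assms(2) by (auto simp: tor_cycles_def)
  have zF: "z \<in> F (Suc q)" using z free_deg_subset by blast
  define c0 where "c0 = (\<lambda>xs :: nat cpoly list. if xs = [] then \<delta> q z else 0)"
  have c0: "c0 \<in> free_chains_deg d q 0"
    unfolding free_chains_deg_def
  proof (rule alt_chainsI)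
    show "c0 xs \<in> Fd q (d - wt xs)" for xs
      using del_deg[OF z] by (auto simp: c0_def intro: subgrp_zero[OF subgrp_free_deg])
  qed (auto simp: c0_def alternating_def split: if_splits)
  have "\<exists>z' \<in> free_chains_deg d q (Suc 0). kos_free z' = c0"
  proof (rule kos_free_exact[OF c0])
    show "kos_free c0 = 0" by (rule ext) (simp add: kos_free_def kos_def c0_def)
    \<comment> \<open>In the exceptional degree the coordinate of \<open>\<delta> q z\<close> would
      be constant, and \<open>aug\<close> makes it 0.\<close>
    show "e q k \<noteq> d" if nz: "Poly_Mapping.lookup (c0 xs) k \<noteq> 0" for xs k
    proof
      assume "e q k = d"
      have xs: "xs = []" using nz by (auto simp: c0_def split: if_splits)
      have "Poly_Mapping.lookup (\<delta> q z) k \<in> hpolys B total_deg (d - e q k)"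
        using del_deg[OF z] by (simp only: free_deg_iff)
      then have "Poly_Mapping.lookup (\<delta> q z) k = 0"
      proof (intro hpolys_0_eq_0)
        show "0 < total_deg b" if "b \<in> B" for b using basis_element(3)[OF that] by simp
      qed (use aug \<open>e q k = d\<close> in \<open>auto simp: aug_free_def\<close>)
      then show False using nz by (simp add: xs c0_def)
    qed
  qed
  then obtain z' where z': "z' \<in> free_chains_deg d q (Suc 0)" "kos_free z' = c0" by blast
  have "cyc q c0"
    using eps_del[of z] del_del[of z] zF
    by (cases q) (auto simp: cyc_def c0_def eps_zero del_zero)
  then obtain y' where y': "y' \<in> free_chains q (Suc (Suc 0))" "cyc q (z' - kos_free y')"
    using chase[OF acyc z'(1)] z'(2) by auto
  have "z' - kos_free y' \<in> free_chains q (Suc 0)"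
    using z'(1) free_chains_deg_subset kos_free_chains[OF y'(1)] by (blast intro: subgrp_diff[OF subgrp_free_chains])
  then obtain y where y: "y \<in> free_chains (Suc q) (Suc 0)" "z' - kos_free y' = (\<lambda>xs. \<delta> q (y xs))"
    using cyc_exact y'(2) by blast
  have yF: "kos_free y [] \<in> F (Suc q)" by (rule free_chains_mem[OF kos_free_chains[OF y(1)]])
  have "\<delta> q (z - kos_free y []) = \<delta> q z - kos_free (\<lambda>xs. \<delta> q (y xs)) []"
    using del_diff[OF zF yF] fun_cong[OF del_kos_free[OF y(1)], of "[]"] by simp
  also have "kos_free (\<lambda>xs. \<delta> q (y xs)) = kos_free z' - kos_free (kos_free y')"
    unfolding y(2)[symmetric] by (rule kos_free_diff)
  also have "\<delta> q z - (kos_free z' - kos_free (kos_free y')) [] = 0"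
    unfolding kos_free_kos_free[OF y'(1)] z'(2) by (simp add: c0_def)
  finally have "\<delta> q (z - kos_free y []) = 0" .
  moreover have "z - kos_free y [] \<in> F (Suc q)" by (rule subgrp_diff[OF subgrp_free_mod zF yF])
  ultimately obtain u where u: "u \<in> F (Suc (Suc q))" "z - kos_free y [] = \<delta> (Suc q) u"
    using exact_Suc[of q] by blast
  have "Poly_Mapping.lookup (Poly_Mapping.lookup (kos_free y []) k) 0 = 0" for k
    by (simp add: kos_free_def kos_def lookup_sum lookup_smult_free lookup_mult_0 lookup_var_poly_0)
  then have "z - \<delta> (Suc q) u \<in> aug_free B (X (Suc q))"
    using yF unfolding u(2)[symmetric] by (simp add: aug_free_def)
  then show ?thesis using z u(1) by (auto simp: tor_boundaries_def)
qed

end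

lemma (in finite_representation) tor_degree_bound:
  assumes E: "minimal_generating_subspace R E" and tor: "tor_nonzero R E p d" and p: "1 \<le> p"
  shows "d \<le> int (p * order G ^ 3)"
proof (rule ccontr)
  assume "\<not> d \<le> int (p * order G ^ 3)"
  then have d: "int (p * order G ^ 3) < d" by simp
  obtain B X e \<epsilon> \<delta> where B: "homogeneous_basis E B" and res: "graded_free_resolution R B X e \<epsilon> \<delta>"
    and ne: "tor_boundaries B X e \<delta> p d \<noteq> tor_cycles B X e \<delta> p d"
    using tor unfolding tor_nonzero_def by blast
  interpret minimal_basis G n \<rho> E B
    by (intro minimal_basis.intro minimal_basis_axioms.intro finite_representation_axioms E B)
  interpret invariant_resolution G n \<rho> E B X e \<epsilon> \<delta>
    by (intro invariant_resolution.intro minimal_basis_axioms res)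
  have acyc: "acyclic_at p d"
  \<comment> \<open>For g = 1 the general bound reads 2 p and misses the required p.\<close>
  proof (cases "order G = 1")
    case True
    have "0 < d" using d by linarith
    then show ?thesis by (rule acyclic_trivial_group[OF True])
  next
    case False
    define g where "g = int (order G)"
    have g: "2 \<le> g" using False order_pos by (simp add: g_def)
    \<comment> \<open>The general bound p g + p + g - 1 is at most 3 p g, and
      \<open>2 \<le> g\<close> gives room for 4 p g.\<close>
    have "4 * g \<le> g ^ 2 * g" using g power_mono[of 2 g 2] by (intro mult_right_mono) auto
    then have "int p * (4 * g) \<le> int p * g ^ 3"
      by (intro mult_left_mono) (simp_all add: power3_eq_cube power2_eq_square)
    moreover have "int p * 1 \<le> int p * g" "1 * g \<le> int p * g"
      using g p by (intro mult_left_mono mult_right_mono; simp)+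
    moreover have "(int p + 1) * (g + 1) - 2 = int p * g + int p + g - 1" by (simp add: algebra_simps)
    moreover have "int (p * order G ^ 3) = int p * g ^ 3" by (simp add: g_def)
    moreover have "0 \<le> int p * g" using g by simp
    ultimately have "(int p + 1) * (g + 1) - 2 < d" using d by linarith
    then show ?thesis unfolding g_def by (rule acyclic_bound)
  qed
  obtain q where q: "p = Suc q" using p by (cases p) auto
  show False
    using ne cycle_is_boundary[of q d] boundary_is_cycle[of _ q d] acyc unfolding q by blast
qed

theorem corollary3:
  fixes G :: "('g, 'm) monoid_scheme"
    and n p :: nat
    and \<rho> :: "'g \<Rightarrow> complex mat"
  assumes "group G" and "finite (carrier G)"
    and "representation G n \<rho>"
    and "p \<ge> 1"
  shows "syz_degree G n \<rho> p \<le> ereal (real (p * order G ^ 3))"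
proof -
  interpret finite_representation G n \<rho>
    by (intro finite_representation.intro finite_representation_axioms.intro assms)
  have "ereal (of_int d) \<le> ereal (real (p * order G ^ 3))"
    if "minimal_generating_subspace (invariants G n \<rho>) E" "tor_nonzero (invariants G n \<rho>) E p d"
    for E d
    using tor_degree_bound[OF that \<open>p \<ge> 1\<close>] by (metis ereal_less_eq(3) of_int_le_iff of_int_of_nat_eq)
  then show ?thesis
    unfolding syz_degree_def syz_degree_wrt_def by (intro SUP_least) auto
qed

end
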